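(* Let $m>0$. Among all polygons $\mathcal P\in\mathscr P_3$ with $|\mathcal P|=m$, the equilateral triangle of area $m$ is the unique (up to rigid movements of the plane) maximizer of $\mathcal E$. Among all polygons $\mathcal P\in\mathscr P_4$ with $|\mathcal P|=m$, the square of area $m$ is the unique (up to rigid movements of the plane) maximizer of $\mathcal E$.
   Context: For $N\ge 3$, $\mathscr P_N$ denotes the class of all (not necessarily convex) polygons in $\mathbb R^2$ with $N$ sides; a polygon is identified with the bounded planar region enclosed by its boundary, a simple closed polygonal line. $|\mathcal P|$ denotes the area (Lebesgue measure) of $\mathcal P$. For a measurable set $E\subset\mathbb R^2$ of finite Lebesgue measure, $\mathcal E(E)=\int_E\int_E K(|x-y|)\,\mathrm dx\,\mathrm dy$, where the kernel $K:(0,\infty)\to\mathbb R$ satisfies: $K\in C^1((0,\infty))$ and $K\ge 0$; $K$ is strictly decreasing; $\int_0^1 K(r)\,r\,\mathrm dr<\infty$. *)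

theory Defs
  imports "HOL-Analysis.Analysis"
begin

fun polygonal_line :: "'a::real_normed_vector list \<Rightarrow> real \<Rightarrow> 'a" where
  "polygonal_line [] = linepath 0 0"
| "polygonal_line [a] = linepath a a"
| "polygonal_line [a, b] = linepath a b"
| "polygonal_line (a # b # c # vs) = linepath a b +++ polygonal_line (b # c # vs)"

definition closed_polygonal_line :: "'a::real_normed_vector list \<Rightarrow> real \<Rightarrow> 'a" where
  "closed_polygonal_line vs = polygonal_line (vs @ [hd vs])"

text \<open>The last condition rules out straight angles, so that every listed point is a genuine
  vertex and the polygon has exactly as many sides as the list has entries.\<close>

definition polygon_vertices :: "(real ^ 2) list \<Rightarrow> bool" where
  "polygon_vertices vs \<longleftrightarrow>
     3 \<le> length vs \<and>
     simple_path (closed_polygonal_line vs) \<and>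
     (\<forall>i<length vs. \<not> collinear {vs ! i, vs ! (Suc i mod length vs),
                                    vs ! (Suc (Suc i) mod length vs)})"

text \<open>The region is taken without its boundary, a null set.\<close>

definition polygon_region :: "(real ^ 2) list \<Rightarrow> (real ^ 2) set" where
  "polygon_region vs = inside (path_image (closed_polygonal_line vs))"

definition polygons :: "nat \<Rightarrow> (real ^ 2) set set" where
  "polygons N = {polygon_region vs | vs. polygon_vertices vs \<and> length vs = N}"

definition equilateral_triangle :: "(real ^ 2) set \<Rightarrow> bool" where
  "equilateral_triangle T \<longleftrightarrow>
     (\<exists>a b c. polygon_vertices [a, b, c] \<and> T = polygon_region [a, b, c] \<and>
        dist a b = dist b c \<and> dist b c = dist c a)"

definition square :: "(real ^ 2) set \<Rightarrow> bool" where
  "square Q \<longleftrightarrow>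
     (\<exists>a b c d. polygon_vertices [a, b, c, d] \<and> Q = polygon_region [a, b, c, d] \<and>
        dist a b = dist b c \<and> dist b c = dist c d \<and> dist c d = dist d a \<and>
        orthogonal (b - a) (c - b) \<and> orthogonal (c - b) (d - c) \<and>
        orthogonal (d - c) (a - d) \<and> orthogonal (a - d) (b - a))"

definition rigid_motion :: "(real ^ 2 \<Rightarrow> real ^ 2) \<Rightarrow> bool" where
  "rigid_motion f \<longleftrightarrow> (\<exists>g t. orthogonal_transformation g \<and> f = (\<lambda>x. t + g x))"

text \<open>Only the values of \<open>K\<close> on the positive half-line matter: for each \<open>x\<close> the
  point \<open>y = x\<close> is a null set. The integral of the nonnegative kernel is taken in the
  extended nonnegative reals.\<close>

definition energy :: "(real \<Rightarrow> real) \<Rightarrow> (real ^ 2) set \<Rightarrow> ennreal" where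
  "energy K E =
     (\<integral>\<^sup>+x\<in>E. (\<integral>\<^sup>+y\<in>E. ennreal (K (norm (x - y))) \<partial>lebesgue) \<partial>lebesgue)"

end

theory Submission
  imports Defs
begin

text \<open>
  The proof is Steiner symmetrization, arranged so that finitely many steps suffice and no
  limit of shapes is ever taken.

  Fix a direction and cut a region into chords parallel to it. If every chord is an interval,
  with centre \<open>c t\<close> and half-length \<open>l t\<close> at height \<open>t\<close>, then by Fubini the energy is a double
  integral over pairs of heights of the interaction of two intervals. For a symmetric,
  strictly decreasing kernel on the line this interaction strictly decreases as the distance
  of the two centres grows (\<open>interval_energy_contract\<close>). So replacing the centres \<open>c\<close> by
  \<open>\<lambda> c\<close>, with \<open>0 \<le> \<lambda> < 1\<close>, keeps the area and increases the energy, strictly unless \<open>c\<close> is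
  constant where the chords are nonempty (\<open>energy_sliced_contract\<close>). Strictness needs finite
  energy, which is where the integrability of \<open>K r * r\<close> near zero is used. The freedom to stop
  at an intermediate \<open>\<lambda>\<close> is what makes the procedure finite: one may stop exactly when some length
  reaches the value that it has in the optimal shape.

  Quadrilaterals. A simple quadrilateral, convex or not, has a diagonal whose line separates
  the other two vertices, so its chords parallel to this diagonal are intervals. Symmetrizing
  along that diagonal gives a kite, and symmetrizing the kite along its axis gives a rhombus.
  If the half-diagonals of the rhombus differ, one is shorter and the other longer than the
  half-diagonal of the square of the same area. Sliding the rhombus along one of its sides
  towards a rectangle makes the two equal in the end, so at some moment one of them has the
  value of the square. A shear along that diagonal then yields the square
  (\<open>energy_quad_less_square\<close>).

  Triangles. Let \<open>s\<close> be the side of the equilateral triangle of the given area. A triangle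
  with a side of length \<open>s\<close> becomes equilateral by symmetrizing along this side. If one side is
  at most \<open>s\<close> and another at least \<open>s\<close>, sliding the apex along the third side makes one of them
  equal to \<open>s\<close>. If one side is at most \<open>s\<close>, symmetrizing along it gives legs that are at least \<open>s\<close>,
  which is the previous case. A triangle with a given side longer than \<open>s\<close> becomes, by
  symmetrizing along it, one with legs at most \<open>s\<close>, or with legs whose square is at most half
  that of the base; so an induction on the number of halvings finishes
  (\<open>energy_triangle_le_equilateral\<close>). A triangle with two different sides gains strictly in a first
  symmetrization along the third one.

  Equality throughout forces the equilateral triangle or the square itself, and two of these
  with equal area differ by a rigid motion.
\<close>

section \<open>Orthogonal frames of the plane\<close>

definition rot :: "real^2 \<Rightarrow> real^2" where
  "rot v = vector [- v$2, v$1]"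

text \<open>The vector \<open>x\<close> need not have unit length: a shape is described by the same coordinates at
  every scale, and only \<open>norm x\<close> enters areas and energies.\<close>

definition frame :: "real^2 \<Rightarrow> real^2 \<Rightarrow> real \<Rightarrow> real \<Rightarrow> real^2" where
  "frame m x s t = m + s *\<^sub>R x + t *\<^sub>R rot x"

definition along :: "real^2 \<Rightarrow> real^2 \<Rightarrow> real^2 \<Rightarrow> real" where
  "along m x z = ((z - m) \<bullet> x) / (norm x)\<^sup>2"

definition across :: "real^2 \<Rightarrow> real^2 \<Rightarrow> real^2 \<Rightarrow> real" where
  "across m x z = ((z - m) \<bullet> rot x) / (norm x)\<^sup>2"

lemma rot_nth [simp]: "rot v $ 1 = - v$2" "rot v $ 2 = v$1"
  by (simp_all add: rot_def)

lemma inner_plane: "(u::real^2) \<bullet> v = u$1 * v$1 + u$2 * v$2"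
  by (simp add: inner_vec_def sum_2)

lemma norm_plane: "(norm (u::real^2))\<^sup>2 = (u$1)\<^sup>2 + (u$2)\<^sup>2"
  unfolding power2_norm_eq_inner by (simp add: inner_plane power2_eq_square)

lemma plane_eqI: "u$1 = v$1 \<Longrightarrow> u$2 = v$2 \<Longrightarrow> (u::real^2) = v"
  by (simp add: vec_eq_iff forall_2)

lemma rot_inner [simp]: "v \<bullet> rot v = 0" "rot v \<bullet> v = 0"
  by (simp_all add: inner_plane)

lemma norm_rot [simp]: "norm (rot v) = norm v"
  by (rule power2_eq_imp_eq) (simp_all add: norm_plane add.commute)

lemma rot_rot: "rot (rot v) = - v"
  by (rule plane_eqI) simp_all

lemma rot_scaleR: "rot (k *\<^sub>R v) = k *\<^sub>R rot v"
  and rot_minus: "rot (- v) = - rot v"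
  by (rule plane_eqI; simp)+

lemma along_frame [simp]: "x \<noteq> 0 \<Longrightarrow> along m x (frame m x s t) = s"
  by (simp add: along_def frame_def inner_add_left power2_norm_eq_inner)

lemma across_frame [simp]: "x \<noteq> 0 \<Longrightarrow> across m x (frame m x s t) = t"
  by (simp add: across_def frame_def inner_add_left power2_norm_eq_inner[symmetric])

lemma norm_plane_pos:
  fixes x :: "real^2"
  assumes "x \<noteq> 0" shows "(x$1)\<^sup>2 + (x$2)\<^sup>2 > 0"
proof -
  have "0 < (norm x)\<^sup>2" using assms by simp
  then show ?thesis unfolding norm_plane .
qed

lemma frame_along_across:
  assumes "x \<noteq> 0" shows "frame m x (along m x z) (across m x z) = z"
proof -
  have pos: "(x$1)\<^sup>2 + (x$2)\<^sup>2 \<noteq> 0" using norm_plane_pos[OF assms] by (metis less_irrefl)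
  show ?thesis
    by (rule plane_eqI)
      (use pos in \<open>simp_all add: frame_def along_def across_def norm_plane inner_plane divide_simps\<close>,
        algebra+)
qed

lemma frame_diff: "norm (frame m x s t - frame m x s' t') = norm x * sqrt ((s - s')\<^sup>2 + (t - t')\<^sup>2)"
proof -
  have "(norm (frame m x s t - frame m x s' t'))\<^sup>2 = (norm x * sqrt ((s - s')\<^sup>2 + (t - t')\<^sup>2))\<^sup>2"
    by (simp add: power_mult_distrib) (simp add: norm_plane frame_def, algebra)
  then show ?thesis by (rule power2_eq_imp_eq) auto
qed

lemma continuous_frame [continuous_intros]:
  "continuous_on A f \<Longrightarrow> continuous_on A g \<Longrightarrow> continuous_on A (\<lambda>p. frame m x (f p) (g p))"
  unfolding frame_def by (intro continuous_intros)

lemma continuous_along [continuous_intros]: "continuous_on A (along m x)"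
  unfolding along_def by (cases "x = 0") (auto intro!: continuous_intros)

lemma continuous_across [continuous_intros]: "continuous_on A (across m x)"
  unfolding across_def by (cases "x = 0") (auto intro!: continuous_intros)

lemma measurable_along [measurable]: "along m x \<in> borel_measurable borel"
  and measurable_across [measurable]: "across m x \<in> borel_measurable borel"
  by (intro borel_measurable_continuous_onI continuous_intros)+

text \<open>The image of the product measure under \<open>(a, b) \<mapsto> vector [a, b]\<close> agrees with Lebesgue measure on boxes,
  hence everywhere; this makes Fubini available in the plane.\<close>

lemma nn_integral_plane:
  fixes f :: "real^2 \<Rightarrow> ennreal"
  assumes [measurable]: "f \<in> borel_measurable borel"
  shows "(\<integral>\<^sup>+z. f z \<partial>lborel) = (\<integral>\<^sup>+a. \<integral>\<^sup>+b. f (vector [a, b]) \<partial>lborel \<partial>lborel)"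
proof -
  let ?T = "\<lambda>p::real\<times>real. vector [fst p, snd p] :: real^2"
  have T_eq: "?T = (\<lambda>p. fst p *\<^sub>R axis 1 1 + snd p *\<^sub>R axis 2 1)"
    by (rule ext, rule plane_eqI) (simp_all add: axis_def)
  have [measurable]: "?T \<in> borel \<rightarrow>\<^sub>M borel"
    unfolding T_eq by (intro borel_measurable_continuous_onI continuous_intros)
  have "(lborel :: (real^2) measure) = distr lborel borel ?T"
  proof (rule lborel_eqI)
    fix l u :: "real^2" assume lu: "\<And>b. b \<in> Basis \<Longrightarrow> l \<bullet> b \<le> u \<bullet> b"
    have ax: "axis 1 1 \<in> (Basis::(real^2) set)" "axis 2 1 \<in> (Basis::(real^2) set)"
      by (auto simp: Basis_vec_def)
    have B: "(Basis::(real^2) set) = {axis 1 1, axis 2 1}"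
      by (auto simp: Basis_vec_def UNIV_2)
    have ne: "axis 1 (1::real) \<noteq> (axis 2 1 :: real^2)" by (simp add: axis_eq_axis)
    have l12: "l$1 \<le> u$1" "l$2 \<le> u$2" using lu[OF ax(1)] lu[OF ax(2)] by (simp_all add: inner_axis)
    have vim: "?T -` box l u = {l$1<..<u$1} \<times> {l$2<..<u$2}"
      by (auto simp: mem_box_cart forall_2)
    have "emeasure (distr lborel borel ?T) (box l u) = emeasure lborel ({l$1<..<u$1} \<times> {l$2<..<u$2})"
      by (simp add: emeasure_distr vim)
    also have "\<dots> = ennreal (u$1 - l$1) * ennreal (u$2 - l$2)"
      unfolding lborel_prod[symmetric] using l12 by (subst lborel.emeasure_pair_measure_Times) auto
    also have "\<dots> = ennreal (\<Prod>b\<in>Basis. (u - l) \<bullet> b)"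
      unfolding B using ne l12 by (simp add: inner_axis ennreal_mult)
    finally show "emeasure (distr lborel borel ?T) (box l u) = ennreal (\<Prod>b\<in>Basis. (u - l) \<bullet> b)" .
  qed simp
  then have "(\<integral>\<^sup>+z. f z \<partial>lborel) = (\<integral>\<^sup>+z. f z \<partial>distr lborel borel ?T)" by simp
  also have "\<dots> = (\<integral>\<^sup>+p. f (?T p) \<partial>lborel)"
    by (simp add: nn_integral_distr)
  also have "\<dots> = (\<integral>\<^sup>+a. \<integral>\<^sup>+b. f (vector [a, b]) \<partial>lborel \<partial>lborel)"
    unfolding lborel_prod[symmetric]
    by (subst lborel.nn_integral_fst[symmetric]) (simp_all add: lborel_prod)
  finally show ?thesis .
qed

lemma nn_integral_affine_subst:
  fixes g :: "real \<Rightarrow> ennreal"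
  assumes [measurable]: "g \<in> borel_measurable borel" and c: "c \<noteq> 0"
  shows "(\<integral>\<^sup>+s. g (t + c * s) \<partial>lborel) = ennreal \<bar>1/c\<bar> * (\<integral>\<^sup>+a. g a \<partial>lborel)"
proof -
  have "ennreal \<bar>1/c\<bar> * (\<integral>\<^sup>+a. g a \<partial>lborel) = ennreal \<bar>1/c\<bar> * (ennreal \<bar>c\<bar> * (\<integral>\<^sup>+s. g (t + c * s) \<partial>lborel))"
    using nn_integral_real_affine[OF assms, of t] by simp
  also have "\<dots> = (\<integral>\<^sup>+s. g (t + c * s) \<partial>lborel)"
    using c by (simp add: mult.assoc[symmetric] ennreal_mult[symmetric])
  finally show ?thesis by simp
qed

text \<open>The change of variables to the coordinates of a frame has Jacobian \<open>(norm x)\<^sup>2\<close>. The linear map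
  is split into two one-dimensional substitutions, first in \<open>s\<close> for fixed \<open>t\<close>, then in \<open>t\<close> for a
  fixed first coordinate. This works if the first component of \<open>x\<close> is nonzero; otherwise the map
  only exchanges and rescales the axes.\<close>

lemma nn_integral_frame:
  fixes f :: "real^2 \<Rightarrow> ennreal"
  assumes [measurable]: "f \<in> borel_measurable borel" and x: "x \<noteq> 0"
  shows "(\<integral>\<^sup>+z. f z \<partial>lborel) = ennreal ((norm x)\<^sup>2) * (\<integral>\<^sup>+t. \<integral>\<^sup>+s. f (frame m x s t) \<partial>lborel \<partial>lborel)"
proof -
  define F where "F a b = f (vector [a, b])" for a b
  have [measurable]: "(\<lambda>p. vector [fst p, snd p] :: real^2) \<in> borel \<rightarrow>\<^sub>M borel"
  proof -
    have "(\<lambda>p. vector [fst p, snd p] :: real^2) = (\<lambda>p. fst p *\<^sub>R axis 1 1 + snd p *\<^sub>R axis 2 1)"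
      by (rule ext, rule plane_eqI) (simp_all add: axis_def)
    then show ?thesis by (simp, intro borel_measurable_continuous_onI continuous_intros)
  qed
  have Fm: "(\<lambda>p. F (fst p) (snd p)) \<in> borel_measurable (borel :: (real\<times>real) measure)"
    unfolding F_def by measurable
  have Fm' [measurable]: "(\<lambda>y. F (g y) (h y)) \<in> borel_measurable M"
    if [measurable]: "g \<in> borel_measurable M" "h \<in> borel_measurable M"
    for g h :: "'b \<Rightarrow> real" and M
  proof -
    have "(\<lambda>y. (g y, h y)) \<in> M \<rightarrow>\<^sub>M borel" by measurable
    from measurable_compose[OF this Fm] show ?thesis by simp
  qed
  define m1 m2 p q where "m1 = m$1" and "m2 = m$2" and "p = x$1" and "q = x$2"
  note defs = m1_def m2_def p_def q_def
  define I where "I = (\<integral>\<^sup>+a. \<integral>\<^sup>+b. F a b \<partial>lborel \<partial>lborel)"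
  have fr: "f (frame m x s t) = F (m1 + p * s - q * t) (m2 + q * s + p * t)" for s t
    unfolding F_def by (rule arg_cong[where f=f], rule plane_eqI) (simp_all add: frame_def defs)
  have N: "(norm x)\<^sup>2 = p\<^sup>2 + q\<^sup>2" unfolding defs by (rule norm_plane)
  have N0: "p\<^sup>2 + q\<^sup>2 > 0" using norm_plane_pos[OF x] by (simp add: defs)
  have main: "(\<integral>\<^sup>+t. \<integral>\<^sup>+s. f (frame m x s t) \<partial>lborel \<partial>lborel) = ennreal (1 / (norm x)\<^sup>2) * I"
  proof (cases "p = 0")
    case False
    have "(\<integral>\<^sup>+t. \<integral>\<^sup>+s. f (frame m x s t) \<partial>lborel \<partial>lborel)
      = (\<integral>\<^sup>+t. \<integral>\<^sup>+s. F ((m1 - q * t) + p * s) (m2 + (q / p) * ((m1 - q * t) + p * s) - q * m1 / p + ((p\<^sup>2 + q\<^sup>2) / p) * t) \<partial>lborel \<partial>lborel)"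
    proof -
      have "m2 + q * s + p * t = m2 + (q / p) * ((m1 - q * t) + p * s) - q * m1 / p + ((p\<^sup>2 + q\<^sup>2) / p) * t" for s t
        using False by (simp add: field_simps power2_eq_square)
      moreover have "m1 + p * s - q * t = (m1 - q * t) + p * s" for s t by simp
      ultimately show ?thesis unfolding fr by presburger
    qed
    also have "\<dots> = (\<integral>\<^sup>+t. ennreal \<bar>1/p\<bar> * (\<integral>\<^sup>+a. F a (m2 + (q / p) * a - q * m1 / p + ((p\<^sup>2 + q\<^sup>2) / p) * t) \<partial>lborel) \<partial>lborel)"
      by (intro nn_integral_cong nn_integral_affine_subst False) measurable
    also have "\<dots> = ennreal \<bar>1/p\<bar> * (\<integral>\<^sup>+t. (\<integral>\<^sup>+a. F a (m2 + (q / p) * a - q * m1 / p + ((p\<^sup>2 + q\<^sup>2) / p) * t) \<partial>lborel) \<partial>lborel)"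
      by (intro nn_integral_cmult) measurable
    also have "(\<integral>\<^sup>+t. (\<integral>\<^sup>+a. F a (m2 + (q / p) * a - q * m1 / p + ((p\<^sup>2 + q\<^sup>2) / p) * t) \<partial>lborel) \<partial>lborel)
       = (\<integral>\<^sup>+a. (\<integral>\<^sup>+t. F a (m2 + (q / p) * a - q * m1 / p + ((p\<^sup>2 + q\<^sup>2) / p) * t) \<partial>lborel) \<partial>lborel)"
      by (intro lborel_pair.Fubini') measurable
    also have "\<dots> = (\<integral>\<^sup>+a. ennreal \<bar>1/((p\<^sup>2 + q\<^sup>2) / p)\<bar> * (\<integral>\<^sup>+b. F a b \<partial>lborel) \<partial>lborel)"
      by (intro nn_integral_cong nn_integral_affine_subst) (use False N0 in auto)
    also have "\<dots> = ennreal \<bar>1/((p\<^sup>2 + q\<^sup>2) / p)\<bar> * I"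
      unfolding I_def by (intro nn_integral_cmult) measurable
    also have "ennreal \<bar>1/p\<bar> * (ennreal \<bar>1/((p\<^sup>2 + q\<^sup>2) / p)\<bar> * I) = ennreal (1 / (norm x)\<^sup>2) * I"
      using False N0 by (simp add: mult.assoc[symmetric] ennreal_mult[symmetric] abs_mult[symmetric] N)
    finally show ?thesis .
  next
    case True
    then have q: "q \<noteq> 0" using N0 by auto
    have "(\<integral>\<^sup>+t. \<integral>\<^sup>+s. f (frame m x s t) \<partial>lborel \<partial>lborel)
      = (\<integral>\<^sup>+t. \<integral>\<^sup>+s. F (m1 + (- q) * t) (m2 + q * s) \<partial>lborel \<partial>lborel)"
      by (simp add: fr True)
    also have "\<dots> = (\<integral>\<^sup>+t. ennreal \<bar>1/q\<bar> * (\<integral>\<^sup>+b. F (m1 + (- q) * t) b \<partial>lborel) \<partial>lborel)"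
      by (intro nn_integral_cong nn_integral_affine_subst q) measurable
    also have "\<dots> = ennreal \<bar>1/q\<bar> * (\<integral>\<^sup>+t. (\<integral>\<^sup>+b. F (m1 + (- q) * t) b \<partial>lborel) \<partial>lborel)"
      by (intro nn_integral_cmult) measurable
    also have "(\<integral>\<^sup>+t. (\<integral>\<^sup>+b. F (m1 + (- q) * t) b \<partial>lborel) \<partial>lborel) = ennreal \<bar>1/(-q)\<bar> * I"
      unfolding I_def by (rule nn_integral_affine_subst) (use q in auto)
    also have "ennreal \<bar>1/q\<bar> * (ennreal \<bar>1/(-q)\<bar> * I) = ennreal (1 / (norm x)\<^sup>2) * I"
      using q by (simp add: mult.assoc[symmetric] ennreal_mult[symmetric] abs_mult[symmetric] N True power2_eq_square[of q])
    finally show ?thesis .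
  qed
  have "(\<integral>\<^sup>+z. f z \<partial>lborel) = I" unfolding I_def F_def by (rule nn_integral_plane) fact
  then show ?thesis using x unfolding main
    by (simp add: mult.assoc[symmetric] ennreal_mult[symmetric])
qed

section \<open>Interaction of two intervals on the line\<close>

definition interval_energy :: "(real \<Rightarrow> real) \<Rightarrow> real \<Rightarrow> real \<Rightarrow> real \<Rightarrow> real \<Rightarrow> ennreal" where
  "interval_energy k c l c' l' =
     (\<integral>\<^sup>+s. (\<integral>\<^sup>+s'. ennreal (k (s - s')) * indicator {s. \<bar>s - c'\<bar> < l'} s' \<partial>lborel)
        * indicator {s. \<bar>s - c\<bar> < l} s \<partial>lborel)"

lemma antiderivative_UNIV:
  fixes k :: "real \<Rightarrow> real"
  assumes "continuous_on UNIV k"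
  obtains h where "\<And>u. (h has_real_derivative k u) (at u)"
proof -
  have "\<exists>h. \<forall>u. -\<infinity> < ereal u \<longrightarrow> ereal u < \<infinity> \<longrightarrow> (h has_vector_derivative k u) (at u)"
    using assms by (intro einterval_antiderivative) (auto simp: continuous_on_eq_continuous_at)
  with that show ?thesis by (auto simp: has_real_derivative_iff_has_vector_derivative)
qed

lemma nn_integral_open_interval:
  fixes f :: "real \<Rightarrow> ennreal"
  shows "(\<integral>\<^sup>+s. f s * indicator {s. \<bar>s - c\<bar> < l} s \<partial>lborel) = (\<integral>\<^sup>+s. f s * indicator {c - l..c + l} s \<partial>lborel)"
proof (rule nn_integral_cong_AE)
  show "AE s in lborel. f s * indicator {s. \<bar>s - c\<bar> < l} s = f s * indicator {c - l..c + l} s"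
    using AE_lborel_singleton[of "c - l"] AE_lborel_singleton[of "c + l"]
    by eventually_elim (auto simp: indicator_def)
qed

text \<open>Integrating the kernel over two intervals amounts to a second difference of its second
  antiderivative \<open>H\<close>, so the interaction depends on the two centres only through their distance.\<close>

lemma interval_energy_eq:
  assumes h: "\<And>u. (h has_real_derivative k u) (at u)" and H: "\<And>u. (H has_real_derivative h u) (at u)"
    and k0: "\<And>u. 0 \<le> k u" and k: "continuous_on UNIV k" and l: "0 \<le> l" "0 \<le> l'"
  defines "G \<equiv> \<lambda>d. H (d + l + l') - H (d + l - l') - H (d - l + l') + H (d - l - l')"
  shows "interval_energy k c l c' l' = ennreal (G (c - c'))" and "0 \<le> G (c - c')"
proof -
  have h_mono: "h u \<le> h v" if "u \<le> v" for u v
    by (rule DERIV_nonneg_imp_nondecreasing[OF that]) (use h k0 in blast)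
  have cont: "continuous_on UNIV h"
    using h by (meson DERIV_isCont continuous_at_imp_continuous_on)
  have inner: "(\<integral>\<^sup>+s'. ennreal (k (s - s')) * indicator {s. \<bar>s - c'\<bar> < l'} s' \<partial>lborel)
      = ennreal (h (s - c' + l') - h (s - c' - l'))" for s
  proof -
    have "(\<integral>\<^sup>+s'. ennreal (k (s - s')) * indicator {s. \<bar>s - c'\<bar> < l'} s' \<partial>lborel)
      = ennreal (- h (s - (c' + l')) - - h (s - (c' - l')))"
      unfolding nn_integral_open_interval
    proof (rule nn_integral_FTC_Icc)
      show "(\<lambda>s'. k (s - s')) \<in> borel_measurable borel"
        by (intro borel_measurable_continuous_onI continuous_intros continuous_on_compose2[OF k]) auto
      show "((\<lambda>s'. - h (s - s')) has_real_derivative k (s - x)) (at x)" for x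
        by (auto intro!: derivative_eq_intros DERIV_chain2[OF h])
    qed (use l k0 in auto)
    then show ?thesis by (simp add: algebra_simps)
  qed
  define P where "P s = H (s - c' + l') - H (s - c' - l')" for s
  have P: "(P has_real_derivative (h (s - c' + l') - h (s - c' - l'))) (at s)" for s
    unfolding P_def by (auto intro!: derivative_eq_intros DERIV_chain2[OF H])
  have nn: "0 \<le> h (s - c' + l') - h (s - c' - l')" for s using h_mono l by simp
  have PG: "P (c + l) - P (c - l) = G (c - c')"
    unfolding P_def G_def by (simp add: algebra_simps)
  have "interval_energy k c l c' l' = ennreal (P (c + l) - P (c - l))"
    unfolding interval_energy_def inner nn_integral_open_interval
  proof (rule nn_integral_FTC_Icc)
    show "(\<lambda>s. h (s - c' + l') - h (s - c' - l')) \<in> borel_measurable borel"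
      by (intro borel_measurable_continuous_onI continuous_intros continuous_on_compose2[OF cont]) auto
  qed (use P nn l in auto)
  then show "interval_energy k c l c' l' = ennreal (G (c - c'))" by (simp add: PG)
  have "P (c - l) \<le> P (c + l)"
    by (rule DERIV_nonneg_imp_nondecreasing) (use l P nn in \<open>auto intro!: exI\<close>)
  then show "0 \<le> G (c - c')" using PG by simp
qed

text \<open>Let \<open>d\<close> be the difference of the centres. The derivative of the interaction in \<open>d\<close> is
  \<open>f d (l + l') - f d \<bar>l - l'\<bar>\<close> with \<open>f d r = h (d + r) + h (d - r)\<close>, and \<open>f d\<close> has derivative
  \<open>k (d + r) - k (d - r)\<close>. For \<open>d > 0\<close> this is negative for all \<open>r > 0\<close>, because the kernel decreases
  with the distance from the origin; for \<open>d < 0\<close> it is positive.\<close>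

lemma interval_energy_contract:
  assumes k: "continuous_on UNIV k" and k0: "\<And>u. 0 \<le> k u"
    and dec: "\<And>u v. \<bar>u\<bar> < \<bar>v\<bar> \<Longrightarrow> k v < k u"
    and l: "0 < l" "0 < l'" and lam: "0 \<le> lam" "lam < 1" and ne: "c \<noteq> c'"
  shows "interval_energy k c l c' l' < interval_energy k (lam * c) l (lam * c') l'"
proof -
  obtain h where h: "\<And>u. (h has_real_derivative k u) (at u)"
    using antiderivative_UNIV[OF k] by blast
  have "continuous_on UNIV h"
    using h by (meson DERIV_isCont continuous_at_imp_continuous_on)
  then obtain H where H: "\<And>u. (H has_real_derivative h u) (at u)"
    using antiderivative_UNIV by blast
  define G where "G d = H (d + l + l') - H (d + l - l') - H (d - l + l') + H (d - l - l')" for d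
  define g where "g d = h (d + l + l') - h (d + l - l') - h (d - l + l') + h (d - l - l')" for d
  have G': "(G has_real_derivative g d) (at d)" for d
    unfolding G_def g_def by (auto intro!: derivative_eq_intros DERIV_chain2[OF H])
  have Gcont: "continuous_on A G" for A
    using G' by (meson DERIV_isCont continuous_at_imp_continuous_on)
  define p q where "p = l + l'" and "q = \<bar>l - l'\<bar>"
  have pq: "0 \<le> q" "q < p" using l by (auto simp: p_def q_def)
  define f where "f d r = h (d + r) + h (d - r)" for d r
  have f': "(f d has_real_derivative (k (d + r) - k (d - r))) (at r)" for d r
    unfolding f_def by (auto intro!: derivative_eq_intros DERIV_chain2[OF h])
  have fcont: "continuous_on A (f d)" for A d
    using f' by (meson DERIV_isCont continuous_at_imp_continuous_on)
  have gf: "g d = f d p - f d q" for d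
    unfolding g_def f_def p_def q_def by (cases "l \<le> l'") (simp_all add: algebra_simps)
  have neg: "g d < 0" if "0 < d" for d
  proof -
    have "f d p < f d q"
    proof (rule DERIV_neg_imp_decreasing_open[OF pq(2)])
      fix r assume "q < r" "r < p"
      then have "k (d + r) - k (d - r) < 0" using dec[of "d - r" "d + r"] pq that by auto
      then show "\<exists>y. (f d has_real_derivative y) (at r) \<and> y < 0" using f' by blast
    qed (rule fcont)
    then show ?thesis by (simp add: gf)
  qed
  have pos: "0 < g d" if "d < 0" for d
  proof -
    have "f d q < f d p"
    proof (rule DERIV_pos_imp_increasing_open[OF pq(2)])
      fix r assume "q < r" "r < p"
      then have "0 < k (d + r) - k (d - r)" using dec[of "d + r" "d - r"] pq that by auto
      then show "\<exists>y. (f d has_real_derivative y) (at r) \<and> 0 < y" using f' by blast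
    qed (rule fcont)
    then show ?thesis by (simp add: gf)
  qed
  define d where "d = c - c'"
  have "G d < G (lam * d)"
  proof (cases "0 < d")
    case True
    then have lt: "lam * d < d" and ge: "0 \<le> lam * d" using lam by auto
    show ?thesis
    proof (rule DERIV_neg_imp_decreasing_open[OF lt])
      fix r assume "lam * d < r" "r < d"
      then show "\<exists>y. (G has_real_derivative y) (at r) \<and> y < 0" using G' neg[of r] ge by force
    qed (rule Gcont)
  next
    case False
    then have d0: "d < 0" using ne by (simp add: d_def)
    then have lt: "d < lam * d" and le: "lam * d \<le> 0" using lam by (auto simp: mult_nonneg_nonpos)
    show ?thesis
    proof (rule DERIV_pos_imp_increasing_open[OF lt])
      fix r assume "d < r" "r < lam * d"
      then show "\<exists>y. (G has_real_derivative y) (at r) \<and> 0 < y" using G' pos[of r] le by force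
    qed (rule Gcont)
  qed
  moreover have "interval_energy k c l c' l' = ennreal (G d)" "0 \<le> G d"
    using interval_energy_eq[OF h H k0 k, of l l' c c'] l by (simp_all add: G_def d_def)
  moreover have "interval_energy k (lam * c) l (lam * c') l' = ennreal (G (lam * d))"
    using interval_energy_eq(1)[OF h H k0 k, of l l' "lam * c" "lam * c'"] l
    by (simp add: G_def d_def right_diff_distrib)
  ultimately show ?thesis by (simp add: ennreal_less_iff)
qed

section \<open>Energy of regions with interval slices\<close>

text \<open>The value at zero only matters on the diagonal \<open>z = z'\<close>, a null set. Cutting \<open>K\<close> off outside the
  positive half-line makes it Borel on the whole line and changes no energy.\<close>

definition punctured :: "(real \<Rightarrow> real) \<Rightarrow> real \<Rightarrow> real" where
  "punctured K r = (if 0 < r then K r else 0)"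

definition sliced :: "real^2 \<Rightarrow> real^2 \<Rightarrow> (real \<Rightarrow> real) \<Rightarrow> (real \<Rightarrow> real) \<Rightarrow> (real^2) set" where
  "sliced m x c l = {z. \<bar>along m x z - c (across m x z)\<bar> < l (across m x z)}"

lemma frame_in_sliced [simp]:
  "x \<noteq> 0 \<Longrightarrow> frame m x s t \<in> sliced m x c l \<longleftrightarrow> \<bar>s - c t\<bar> < l t"
  by (simp add: sliced_def)

lemma sliced_borel [measurable]:
  assumes [measurable]: "c \<in> borel_measurable borel" "l \<in> borel_measurable borel"
  shows "sliced m x c l \<in> sets borel"
  unfolding sliced_def by measurable

lemma emeasure_sliced:
  assumes [measurable]: "c \<in> borel_measurable borel" "l \<in> borel_measurable borel" and x: "x \<noteq> 0"
  shows "emeasure lebesgue (sliced m x c l) = ennreal ((norm x)\<^sup>2) * (\<integral>\<^sup>+t. ennreal (2 * l t) \<partial>lborel)"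
proof -
  have slice: "(\<integral>\<^sup>+s. indicator (sliced m x c l) (frame m x s t) \<partial>lborel) = ennreal (2 * l t)" for t
  proof (cases "0 \<le> l t")
    case True
    have "(\<integral>\<^sup>+s. indicator (sliced m x c l) (frame m x s t) \<partial>lborel)
        = (\<integral>\<^sup>+s. 1 * indicator {s. \<bar>s - c t\<bar> < l t} s \<partial>lborel)"
      using x by (intro nn_integral_cong) (simp add: indicator_def)
    also have "\<dots> = ennreal (2 * l t)"
      unfolding nn_integral_open_interval using True by simp
    finally show ?thesis .
  next
    case False
    then have "indicator (sliced m x c l) (frame m x s t) = (0 :: ennreal)" for s
      using x by simp
    then show ?thesis using False by (simp add: ennreal_neg)
  qed
  have "emeasure lebesgue (sliced m x c l) = (\<integral>\<^sup>+z. indicator (sliced m x c l) z \<partial>lborel)"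
    by simp
  also have "\<dots> = ennreal ((norm x)\<^sup>2) * (\<integral>\<^sup>+t. \<integral>\<^sup>+s. indicator (sliced m x c l) (frame m x s t) \<partial>lborel \<partial>lborel)"
    by (rule nn_integral_frame[OF _ x]) measurable
  finally show ?thesis unfolding slice .
qed

locale decreasing_kernel =
  fixes K :: "real \<Rightarrow> real"
  assumes continuous: "continuous_on {0<..} K"
    and nonneg: "\<And>r. 0 < r \<Longrightarrow> 0 \<le> K r"
    and decreasing: "\<And>r r'. 0 < r \<Longrightarrow> r < r' \<Longrightarrow> K r' < K r"
    and integrable: "set_integrable lborel {0<..<1} (\<lambda>r. K r * r)"
begin

lemma punctured_measurable [measurable]: "punctured K \<in> borel_measurable borel"
proof -
  have "(\<lambda>r. indicator {0<..} r *\<^sub>R K r) \<in> borel_measurable borel"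
    by (rule borel_measurable_continuous_on_indicator) (auto intro: continuous)
  moreover have "(\<lambda>r. indicator {0<..} r *\<^sub>R K r) = punctured K"
    by (auto simp: punctured_def)
  ultimately show ?thesis by simp
qed

lemma energy_punctured:
  "energy K E = (\<integral>\<^sup>+z. (\<integral>\<^sup>+z'. ennreal (punctured K (norm (z - z'))) * indicator E z' \<partial>lborel)
     * indicator E z \<partial>lborel)"
proof -
  have "(\<integral>\<^sup>+z'. ennreal (K (norm (z - z'))) * indicator E z' \<partial>lborel)
      = (\<integral>\<^sup>+z'. ennreal (punctured K (norm (z - z'))) * indicator E z' \<partial>lborel)" for z
  proof (rule nn_integral_cong_AE)
    show "AE z' in lborel. ennreal (K (norm (z - z'))) * indicator E z'
        = ennreal (punctured K (norm (z - z'))) * indicator E z'"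
      using AE_lborel_singleton[of z] by eventually_elim (auto simp: punctured_def)
  qed
  then show ?thesis unfolding energy_def nn_integral_completion by simp
qed

definition slice_kernel :: "real \<Rightarrow> real \<Rightarrow> real \<Rightarrow> real" where
  "slice_kernel r w u = punctured K (r * sqrt (u\<^sup>2 + w\<^sup>2))"

lemma slice_kernel:
  assumes "0 < r" "w \<noteq> 0"
  shows "continuous_on UNIV (slice_kernel r w)" and "0 \<le> slice_kernel r w u"
    and "\<bar>u\<bar> < \<bar>v\<bar> \<Longrightarrow> slice_kernel r w v < slice_kernel r w u"
proof -
  have pos: "0 < r * sqrt (u\<^sup>2 + w\<^sup>2)" for u
    using assms by (simp add: sum_power2_gt_zero_iff)
  have eq: "slice_kernel r w = (\<lambda>u. K (r * sqrt (u\<^sup>2 + w\<^sup>2)))"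
    using pos by (auto simp: slice_kernel_def punctured_def)
  show "continuous_on UNIV (slice_kernel r w)"
    unfolding eq by (intro continuous_on_compose2[OF continuous] continuous_intros) (use pos in auto)
  show "0 \<le> slice_kernel r w u" unfolding eq using pos nonneg by blast
  show "slice_kernel r w v < slice_kernel r w u" if "\<bar>u\<bar> < \<bar>v\<bar>"
    unfolding eq
  proof (rule decreasing[OF pos])
    have "u\<^sup>2 < v\<^sup>2" using that using power_strict_mono[of "\<bar>u\<bar>" "\<bar>v\<bar>" 2] by simp
    then show "r * sqrt (u\<^sup>2 + w\<^sup>2) < r * sqrt (v\<^sup>2 + w\<^sup>2)" using assms by simp
  qed
qed

lemma slice_kernel_measurable [measurable]:
  assumes [measurable]: "f \<in> borel_measurable M" "g \<in> borel_measurable M"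
  shows "(\<lambda>p. slice_kernel r (f p) (g p)) \<in> borel_measurable M"
  unfolding slice_kernel_def by measurable

text \<open>Fubini, with the roles of the coordinate along the chord \<open>s\<close> and the second height \<open>t'\<close>
  exchanged: for two fixed heights, the two inner integrals are an interaction of intervals for the
  kernel \<open>slice_kernel\<close>. The right-hand side involves \<open>x\<close> only through its norm and \<open>m\<close> not at all,
  so energies of congruent sliced regions agree without any transport of measures.\<close>

lemma energy_sliced:
  assumes [measurable]: "c \<in> borel_measurable borel" "l \<in> borel_measurable borel" and x: "x \<noteq> 0"
  shows "energy K (sliced m x c l) = ennreal ((norm x) ^ 4) *
    (\<integral>\<^sup>+t. \<integral>\<^sup>+t'. interval_energy (slice_kernel (norm x) (t - t')) (c t) (l t) (c t') (l t') \<partial>lborel \<partial>lborel)"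
proof -
  let ?N = "ennreal ((norm x)\<^sup>2)"
  let ?E = "sliced m x c l"
  let ?k = "\<lambda>s t s' t'. ennreal (slice_kernel (norm x) (t - t') (s - s')) * indicator {s. \<bar>s - c t'\<bar> < l t'} s'"
  have [measurable]: "?E \<in> sets borel" by measurable
  have [measurable]: "Measurable.pred M (\<lambda>p. g p \<in> {s. \<bar>s - c (f p)\<bar> < l (f p)})"
    if [measurable]: "f \<in> borel_measurable M" "g \<in> borel_measurable M" for f g :: "'b \<Rightarrow> real" and M
    by simp
  have inner: "(\<integral>\<^sup>+z'. ennreal (punctured K (norm (frame m x s t - z'))) * indicator ?E z' \<partial>lborel)
     = ?N * (\<integral>\<^sup>+t'. \<integral>\<^sup>+s'. ?k s t s' t' \<partial>lborel \<partial>lborel)" for s t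
    using x by (subst nn_integral_frame[OF _ x, of _ m]) (simp_all add: indicator_def frame_diff slice_kernel_def)
  have "energy K ?E = ?N * (\<integral>\<^sup>+t. \<integral>\<^sup>+s. (?N * (\<integral>\<^sup>+t'. \<integral>\<^sup>+s'. ?k s t s' t' \<partial>lborel \<partial>lborel))
          * indicator {s. \<bar>s - c t\<bar> < l t} s \<partial>lborel \<partial>lborel)"
    unfolding energy_punctured inner[symmetric]
    using x by (subst nn_integral_frame[OF _ x, of _ m]) (simp_all add: indicator_def)
  also have "\<dots> = ?N * (\<integral>\<^sup>+t. ?N * (\<integral>\<^sup>+s. \<integral>\<^sup>+t'. (\<integral>\<^sup>+s'. ?k s t s' t' \<partial>lborel)
          * indicator {s. \<bar>s - c t\<bar> < l t} s \<partial>lborel \<partial>lborel) \<partial>lborel)"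
  proof (intro arg_cong[where f="\<lambda>z. ?N * z"] nn_integral_cong)
    fix t
    have "(\<integral>\<^sup>+t'. (\<integral>\<^sup>+s'. ?k s t s' t' \<partial>lborel) * indicator {s. \<bar>s - c t\<bar> < l t} s \<partial>lborel)
      = (\<integral>\<^sup>+t'. \<integral>\<^sup>+s'. ?k s t s' t' \<partial>lborel \<partial>lborel) * indicator {s. \<bar>s - c t\<bar> < l t} s" for s
      by (rule nn_integral_multc) measurable
    moreover have "(\<integral>\<^sup>+s. ?N * ((\<integral>\<^sup>+t'. \<integral>\<^sup>+s'. ?k s t s' t' \<partial>lborel \<partial>lborel) * indicator {s. \<bar>s - c t\<bar> < l t} s) \<partial>lborel)
      = ?N * (\<integral>\<^sup>+s. (\<integral>\<^sup>+t'. \<integral>\<^sup>+s'. ?k s t s' t' \<partial>lborel \<partial>lborel) * indicator {s. \<bar>s - c t\<bar> < l t} s \<partial>lborel)"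
      by (rule nn_integral_cmult) measurable
    ultimately show "(\<integral>\<^sup>+s. (?N * (\<integral>\<^sup>+t'. \<integral>\<^sup>+s'. ?k s t s' t' \<partial>lborel \<partial>lborel)) * indicator {s. \<bar>s - c t\<bar> < l t} s \<partial>lborel)
      = ?N * (\<integral>\<^sup>+s. \<integral>\<^sup>+t'. (\<integral>\<^sup>+s'. ?k s t s' t' \<partial>lborel) * indicator {s. \<bar>s - c t\<bar> < l t} s \<partial>lborel \<partial>lborel)"
      by (simp only: mult.assoc)
  qed
  also have "\<dots> = ?N * (\<integral>\<^sup>+t. ?N * (\<integral>\<^sup>+t'. \<integral>\<^sup>+s. (\<integral>\<^sup>+s'. ?k s t s' t' \<partial>lborel)
          * indicator {s. \<bar>s - c t\<bar> < l t} s \<partial>lborel \<partial>lborel) \<partial>lborel)"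
    by (intro arg_cong[where f="\<lambda>z. ?N * z"] nn_integral_cong lborel_pair.Fubini') measurable
  also have "\<dots> = ?N * (?N * (\<integral>\<^sup>+t. \<integral>\<^sup>+t'. \<integral>\<^sup>+s. (\<integral>\<^sup>+s'. ?k s t s' t' \<partial>lborel)
          * indicator {s. \<bar>s - c t\<bar> < l t} s \<partial>lborel \<partial>lborel \<partial>lborel))"
    by (intro arg_cong[where f="\<lambda>z. ?N * z"] nn_integral_cmult) measurable
  finally show ?thesis
    by (simp add: interval_energy_def mult.assoc[symmetric] ennreal_mult[symmetric])
qed

lemma punctured_integral_finite:
  "(\<integral>\<^sup>+r. ennreal (punctured K \<bar>r\<bar> * \<bar>r\<bar>) * indicator {-1<..<1} r \<partial>lborel) < \<infinity>"
proof -
  define f where "f r = ennreal (punctured K r * r) * indicator {0<..<1} r" for r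
  have [measurable]: "f \<in> borel_measurable borel" unfolding f_def by measurable
  have "(\<integral>\<^sup>+r. f r \<partial>lborel) = (\<integral>\<^sup>+r. ennreal (norm (indicator {0<..<1} r *\<^sub>R (K r * r))) \<partial>lborel)"
    using nonneg by (intro nn_integral_cong) (auto simp: f_def punctured_def indicator_def)
  also have "\<dots> < \<infinity>"
    using integrable unfolding set_integrable_def integrable_iff_bounded by simp
  finally have fin: "(\<integral>\<^sup>+r. f r \<partial>lborel) < \<infinity>" .
  have "(\<integral>\<^sup>+r. ennreal (punctured K \<bar>r\<bar> * \<bar>r\<bar>) * indicator {-1<..<1} r \<partial>lborel)
      = (\<integral>\<^sup>+r. f r + f (0 + (-1) * r) \<partial>lborel)"
    by (intro nn_integral_cong) (auto simp: f_def indicator_def punctured_def)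
  also have "\<dots> = (\<integral>\<^sup>+r. f r \<partial>lborel) + (\<integral>\<^sup>+r. f (0 + (-1) * r) \<partial>lborel)"
    by (intro nn_integral_add) measurable
  also have "(\<integral>\<^sup>+r. f (0 + (-1) * r) \<partial>lborel) = (\<integral>\<^sup>+r. f r \<partial>lborel)"
    by (subst nn_integral_affine_subst) auto
  finally show ?thesis using fin by simp
qed

text \<open>As \<open>K\<close> decreases, \<open>K (norm w)\<close> is at most \<open>K\<close> at the supremum norm of \<open>w\<close>. Splitting the unit square
  according to which coordinate is larger reduces the integral of the latter to a multiple of
  the integral of \<open>K r * r\<close> over the unit interval. Away from the singularity \<open>K\<close> is bounded by \<open>K 1\<close>.\<close>

lemma energy_finite:
  assumes E [measurable]: "E \<in> sets borel" and "bounded E"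
  shows "energy K E < \<infinity>"
proof -
  \<comment> \<open>The bound on the part of the unit square where the first coordinate is the larger one.\<close>
  define Q where "Q a b = ennreal (punctured K \<bar>a\<bar>) * indicator {-1<..<1} a * indicator {-\<bar>a\<bar>..\<bar>a\<bar>} b" for a b
  have Qeq: "Q a b = ennreal (punctured K \<bar>a\<bar>) * (if \<bar>a\<bar> < 1 \<and> \<bar>b\<bar> \<le> \<bar>a\<bar> then 1 else 0)" for a b
    by (auto simp: Q_def indicator_def)
  have [measurable]: "(\<lambda>p. Q (f p) (g p)) \<in> borel_measurable M"
    if [measurable]: "f \<in> borel_measurable M" "g \<in> borel_measurable M" for f g :: "'b \<Rightarrow> real" and M
    unfolding Qeq by measurable
  define B where "B = (\<integral>\<^sup>+a. \<integral>\<^sup>+b. Q a b \<partial>lborel \<partial>lborel)"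
  have B: "B < \<infinity>"
  proof -
    have "B = (\<integral>\<^sup>+a. 2 * (ennreal (punctured K \<bar>a\<bar> * \<bar>a\<bar>) * indicator {-1<..<1} a) \<partial>lborel)"
      unfolding B_def
    proof (intro nn_integral_cong)
      fix a
      have "(\<integral>\<^sup>+b. Q a b \<partial>lborel) = ennreal (punctured K \<bar>a\<bar>) * indicator {-1<..<1} a * ennreal (2 * \<bar>a\<bar>)"
        unfolding Q_def by (subst nn_integral_cmult) auto
      also have "\<dots> = 2 * (ennreal (punctured K \<bar>a\<bar> * \<bar>a\<bar>) * indicator {-1<..<1} a)"
        using nonneg by (auto simp: ennreal_mult'' punctured_def mult_ac)
      finally show "(\<integral>\<^sup>+b. Q a b \<partial>lborel) = \<dots>" .
    qed
    also have "\<dots> = 2 * (\<integral>\<^sup>+a. ennreal (punctured K \<bar>a\<bar> * \<bar>a\<bar>) * indicator {-1<..<1} a \<partial>lborel)"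
      by (rule nn_integral_cmult) measurable
    also have "\<dots> < \<infinity>" using punctured_integral_finite by (simp add: ennreal_mult_less_top)
    finally show ?thesis .
  qed
  define M where "M = B + B + ennreal (K 1) * emeasure lborel E"
  have M: "M < \<infinity>"
    using B emeasure_bounded_finite[OF assms(2)] by (simp add: M_def ennreal_mult_less_top)
  have bound: "(\<integral>\<^sup>+z'. ennreal (punctured K (norm (z - z'))) * indicator E z' \<partial>lborel) \<le> M" for z
  proof -
    have pw: "ennreal (punctured K (norm w)) \<le> Q (w$1) (w$2) + Q (w$2) (w$1) + ennreal (K 1)" for w :: "real^2"
    proof (cases "w = 0")
      case True then show ?thesis by (simp add: punctured_def)
    next
      case False
      have le: "\<bar>w$1\<bar> \<le> norm w" "\<bar>w$2\<bar> \<le> norm w" using component_le_norm_cart by auto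
      define a where "a = max \<bar>w$1\<bar> \<bar>w$2\<bar>"
      have a0: "0 < a" using norm_plane_pos[OF False] unfolding a_def by (smt (verit) power_zero_numeral)
      have le': "a \<le> norm w" using le by (simp add: a_def)
      have Kle: "K (norm w) \<le> K a" using decreasing[OF a0] le' by (cases "a = norm w") (auto simp: less_le)
      show ?thesis
      proof (cases "a < 1")
        case True
        have "ennreal (K a) \<le> Q (w$1) (w$2) + Q (w$2) (w$1)"
          using True a0 unfolding Qeq a_def punctured_def by (auto simp: max_def split: if_splits)
        then show ?thesis using Kle a0 le' by (simp add: punctured_def) (meson add_increasing2 ennreal_leI order_trans zero_le)
      next
        case False
        then have "1 \<le> norm w" using le' by simp
        then have "K (norm w) \<le> K 1" using decreasing[of 1 "norm w"] by (cases "norm w = 1") auto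
        then show ?thesis using \<open>1 \<le> norm w\<close> by (simp add: punctured_def) (meson add_increasing ennreal_leI zero_le)
      qed
    qed
    have "(\<integral>\<^sup>+z'. ennreal (punctured K (norm (z - z'))) * indicator E z' \<partial>lborel)
      \<le> (\<integral>\<^sup>+z'. (Q ((z - z')$1) ((z - z')$2) + Q ((z - z')$2) ((z - z')$1)) + ennreal (K 1) * indicator E z' \<partial>lborel)"
    proof (rule nn_integral_mono)
      fix z'
      show "ennreal (punctured K (norm (z - z'))) * indicator E z' \<le>
         (Q ((z - z')$1) ((z - z')$2) + Q ((z - z')$2) ((z - z')$1)) + ennreal (K 1) * indicator E z'"
        using pw[of "z - z'"] by (auto simp: indicator_def)
    qed
    also have "\<dots> = (\<integral>\<^sup>+z'. Q ((z - z')$1) ((z - z')$2) + Q ((z - z')$2) ((z - z')$1) \<partial>lborel) + ennreal (K 1) * emeasure lborel E"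
      by (subst nn_integral_add) (simp_all add: nn_integral_cmult)
    also have "(\<integral>\<^sup>+z'. Q ((z - z')$1) ((z - z')$2) + Q ((z - z')$2) ((z - z')$1) \<partial>lborel)
      = (\<integral>\<^sup>+z'. Q ((z - z')$1) ((z - z')$2) \<partial>lborel) + (\<integral>\<^sup>+z'. Q ((z - z')$2) ((z - z')$1) \<partial>lborel)"
      by (rule nn_integral_add) measurable
    also have "(\<integral>\<^sup>+z'. Q ((z - z')$1) ((z - z')$2) \<partial>lborel) = B"
    proof -
      have "(\<integral>\<^sup>+z'. Q ((z - z')$1) ((z - z')$2) \<partial>lborel) = (\<integral>\<^sup>+a. \<integral>\<^sup>+b. Q (z$1 - a) (z$2 + (-1) * b) \<partial>lborel \<partial>lborel)"
        by (subst nn_integral_plane) simp_all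
      also have "\<dots> = (\<integral>\<^sup>+a. \<integral>\<^sup>+b. Q (z$1 + (-1) * a) b \<partial>lborel \<partial>lborel)"
        by (subst nn_integral_affine_subst) simp_all
      also have "\<dots> = B"
        unfolding B_def by (subst nn_integral_affine_subst[where g="\<lambda>a. \<integral>\<^sup>+b. Q a b \<partial>lborel"]) simp_all
      finally show ?thesis .
    qed
    also have "(\<integral>\<^sup>+z'. Q ((z - z')$2) ((z - z')$1) \<partial>lborel) = B"
    proof -
      have "(\<integral>\<^sup>+z'. Q ((z - z')$2) ((z - z')$1) \<partial>lborel) = (\<integral>\<^sup>+a. \<integral>\<^sup>+b. Q (z$2 - b) (z$1 - a) \<partial>lborel \<partial>lborel)"
        by (subst nn_integral_plane) simp_all
      also have "\<dots> = (\<integral>\<^sup>+b. \<integral>\<^sup>+a. Q (z$2 - b) (z$1 + (-1) * a) \<partial>lborel \<partial>lborel)"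
        by (subst lborel_pair.Fubini') simp_all
      also have "\<dots> = (\<integral>\<^sup>+b. \<integral>\<^sup>+a. Q (z$2 + (-1) * b) a \<partial>lborel \<partial>lborel)"
        by (subst nn_integral_affine_subst) simp_all
      also have "\<dots> = B"
        unfolding B_def by (subst nn_integral_affine_subst[where g="\<lambda>a. \<integral>\<^sup>+b. Q a b \<partial>lborel"]) simp_all
      finally show ?thesis .
    qed
    finally show ?thesis by (simp add: M_def)
  qed
  have "energy K E \<le> (\<integral>\<^sup>+z. M * indicator E z \<partial>lborel)"
    unfolding energy_punctured by (intro nn_integral_mono mult_right_mono bound) simp
  also have "\<dots> = M * emeasure lborel E" by (simp add: nn_integral_cmult)
  also have "\<dots> < \<infinity>" using M emeasure_bounded_finite[OF assms(2)] by (simp add: ennreal_mult_less_top)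
  finally show ?thesis .
qed

lemma interval_energy_slice_measurable [measurable]:
  assumes [measurable]: "c \<in> borel_measurable borel" "l \<in> borel_measurable borel"
    and [measurable]: "f \<in> borel_measurable M" "g \<in> borel_measurable M"
  shows "(\<lambda>p. interval_energy (slice_kernel r (f p - g p)) (c (f p)) (l (f p)) (c (g p)) (l (g p)))
    \<in> borel_measurable M"
  unfolding interval_energy_def indicator_def by measurable

lemma interval_energy_slice_contract:
  assumes "0 < r" "w \<noteq> 0" and lam: "0 \<le> lam" "lam < 1"
  shows "interval_energy (slice_kernel r w) c l c' l'
      \<le> interval_energy (slice_kernel r w) (lam * c) l (lam * c') l'"
    and "0 < l \<Longrightarrow> 0 < l' \<Longrightarrow> c \<noteq> c' \<Longrightarrow> interval_energy (slice_kernel r w) c l c' l'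
      < interval_energy (slice_kernel r w) (lam * c) l (lam * c') l'"
proof -
  note k = slice_kernel[OF assms(1,2)]
  show strict: "interval_energy (slice_kernel r w) c l c' l'
      < interval_energy (slice_kernel r w) (lam * c) l (lam * c') l'"
    if "0 < l" "0 < l'" "c \<noteq> c'"
    using interval_energy_contract[OF k] that lam by blast
  show "interval_energy (slice_kernel r w) c l c' l'
      \<le> interval_energy (slice_kernel r w) (lam * c) l (lam * c') l'"
  proof (cases "0 < l \<and> 0 < l'")
    case True
    show ?thesis
    proof (cases "c = c'")
      case False then show ?thesis using strict True by (simp add: less_imp_le)
    next
      case eq: True
      obtain h where h: "\<And>u. (h has_real_derivative slice_kernel r w u) (at u)"
        using antiderivative_UNIV[OF k(1)] by blast
      have "continuous_on UNIV h"
        using h by (meson DERIV_isCont continuous_at_imp_continuous_on)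
      then obtain H where H: "\<And>u. (H has_real_derivative h u) (at u)"
        using antiderivative_UNIV by blast
      show ?thesis
        using interval_energy_eq(1)[OF h H k(2) k(1), of l l'] True eq by simp
    qed
  next
    case False
    then have "{s. \<bar>s - c\<bar> < l} = {} \<or> {s. \<bar>s - c'\<bar> < l'} = {}" by auto
    then have "interval_energy (slice_kernel r w) c l c' l' = 0"
      by (auto simp: interval_energy_def)
    then show ?thesis by simp
  qed
qed

text \<open>The interaction of the slices at heights \<open>t\<close> and \<open>t'\<close> increases for every pair \<open>t \<noteq> t'\<close>. It
  increases strictly on the set of pairs in \<open>V \<times> V\<close> with \<open>c t \<noteq> c t'\<close>; this set is open because \<open>c\<close> is
  continuous, so it is not a null set as soon as it contains one pair.\<close>

lemma energy_sliced_contract: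
  assumes c: "continuous_on UNIV c" and l [measurable]: "l \<in> borel_measurable borel" and x: "x \<noteq> 0"
    and bdd: "bounded (sliced m x c l)" and lam: "0 \<le> lam" "lam < 1"
  shows "energy K (sliced m x c l) \<le> energy K (sliced m x (\<lambda>t. lam * c t) l)"
    and "open V \<Longrightarrow> (\<And>t. t \<in> V \<Longrightarrow> 0 < l t) \<Longrightarrow> t \<in> V \<Longrightarrow> t' \<in> V \<Longrightarrow> c t \<noteq> c t' \<Longrightarrow>
      energy K (sliced m x c l) < energy K (sliced m x (\<lambda>t. lam * c t) l)"
proof -
  have [measurable]: "c \<in> borel_measurable borel" by (rule borel_measurable_continuous_onI[OF c])
  define F where "F b p = interval_energy (slice_kernel (norm x) (fst p - snd p))
      (b * c (fst p)) (l (fst p)) (b * c (snd p)) (l (snd p))" for b and p :: "real \<times> real"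
  have Fm [measurable]: "F b \<in> borel_measurable (lborel \<Otimes>\<^sub>M lborel)" for b
    unfolding F_def[abs_def] by (intro interval_energy_slice_measurable[where c="\<lambda>t. b * c t"]) measurable
  define I where "I b = (\<integral>\<^sup>+p. F b p \<partial>(lborel \<Otimes>\<^sub>M lborel))" for b
  have en: "energy K (sliced m x (\<lambda>t. b * c t) l) = ennreal ((norm x) ^ 4) * I b" for b
  proof -
    have "energy K (sliced m x (\<lambda>t. b * c t) l)
      = ennreal ((norm x) ^ 4) * (\<integral>\<^sup>+t. \<integral>\<^sup>+t'. F b (t, t') \<partial>lborel \<partial>lborel)"
      using x by (subst energy_sliced) (simp_all add: F_def)
    also have "(\<integral>\<^sup>+t. \<integral>\<^sup>+t'. F b (t, t') \<partial>lborel \<partial>lborel) = I b"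
      unfolding I_def by (rule lborel.nn_integral_fst) measurable
    finally show ?thesis .
  qed
  have "energy K (sliced m x c l) < \<infinity>"
    by (rule energy_finite[OF _ bdd]) measurable
  then have "ennreal ((norm x) ^ 4) * I 1 < \<infinity>" using en[of 1] by simp
  then have fin: "I 1 \<noteq> \<infinity>" using x by (auto simp: ennreal_mult_less_top)
  have N: "0 < norm x" using x by simp
  have le: "F 1 p \<le> F lam p" if "fst p \<noteq> snd p" for p
    using interval_energy_slice_contract(1)[OF N _ lam, of "fst p - snd p"] that by (simp add: F_def)
  \<comment> \<open>For equal heights the slice kernel is singular, but the diagonal is a null set.\<close>
  have diag: "AE p in lborel \<Otimes>\<^sub>M lborel. F 1 p \<le> F lam p"
  proof -
    have "{p::real\<times>real. fst p = snd p} \<in> null_sets lborel"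
    proof -
      have "{p::real\<times>real. fst p = snd p} = {p. ((1::real), (-1::real)) \<bullet> p = 0}" by (auto simp: inner_prod_def)
      then have "negligible {p::real\<times>real. fst p = snd p}"
        by (simp only:) (rule negligible_hyperplane, simp add: zero_prod_def)
      moreover have "closed {p::real\<times>real. fst p = snd p}"
        by (intro closed_Collect_eq continuous_intros)
      ultimately show ?thesis by (simp add: negligible_iff_null_sets null_sets_completion_iff borel_closed)
    qed
    then have "AE p in lborel. (p::real\<times>real) \<notin> {p. fst p = snd p}" by (rule AE_not_in)
    then show ?thesis unfolding lborel_prod by eventually_elim (use le in auto)
  qed
  show "energy K (sliced m x c l) \<le> energy K (sliced m x (\<lambda>t. lam * c t) l)"
    using mult_left_mono[OF nn_integral_mono_AE[OF diag], of "ennreal ((norm x) ^ 4)"] en[of 1] en[of lam]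
    by (simp add: I_def)
  show "energy K (sliced m x c l) < energy K (sliced m x (\<lambda>t. lam * c t) l)"
    if V: "open V" "\<And>t. t \<in> V \<Longrightarrow> 0 < l t" "t \<in> V" "t' \<in> V" "c t \<noteq> c t'"
  proof -
    define U where "U = (V \<times> V) \<inter> {p. c (fst p) \<noteq> c (snd p)}"
    have "open U" unfolding U_def
      by (intro open_Int open_Times V open_Collect_neq continuous_on_compose2[OF c] continuous_intros) auto
    moreover have "(t, t') \<in> U" using V by (simp add: U_def)
    ultimately have U: "\<not> negligible U" by (metis empty_iff open_not_negligible)
    have less: "F 1 p < F lam p" if "p \<in> U" for p
    proof -
      have "fst p \<noteq> snd p" using that by (auto simp: U_def)
      then show ?thesis
        using interval_energy_slice_contract(2)[OF N _ lam, of "fst p - snd p"] that V(2)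
        by (simp add: F_def U_def mem_Times_iff)
    qed
    have "\<not> (AE p in lborel \<Otimes>\<^sub>M lborel. F lam p \<le> F 1 p)"
    proof
      assume "AE p in lborel \<Otimes>\<^sub>M lborel. F lam p \<le> F 1 p"
      then have "AE p in lborel. p \<notin> U"
        unfolding lborel_prod by eventually_elim (use less in force)
      then have "U \<in> null_sets lborel" using \<open>open U\<close> by (subst AE_iff_null_sets) auto
      then show False using U by (simp add: negligible_iff_null_sets null_sets_completionI)
    qed
    then have "I 1 < I lam"
      using fin unfolding I_def by (intro nn_integral_less[OF _ _ _ diag]) auto
    then have "ennreal ((norm x) ^ 4) * I 1 < ennreal ((norm x) ^ 4) * I lam"
      using N by (intro ennreal_mult_strict_left_mono) auto
    then show ?thesis using en[of 1] en[of lam] by simp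
  qed
qed

end

section \<open>The regions enclosed by triangles and quadrilaterals\<close>

lemma frame_eq_iff: "x \<noteq> 0 \<Longrightarrow> frame m x s t = frame m x s' t' \<longleftrightarrow> s = s' \<and> t = t'"
  by (metis across_frame along_frame)

lemma frame_in_segment:
  assumes "x \<noteq> 0"
  shows "frame m x s t \<in> closed_segment (frame m x s0 t0) (frame m x s1 t1) \<longleftrightarrow>
    (\<exists>u. 0 \<le> u \<and> u \<le> 1 \<and> s = (1 - u) * s0 + u * s1 \<and> t = (1 - u) * t0 + u * t1)"
proof -
  have "(1 - u) *\<^sub>R frame m x s0 t0 + u *\<^sub>R frame m x s1 t1
      = frame m x ((1 - u) * s0 + u * s1) ((1 - u) * t0 + u * t1)" for u
    by (rule plane_eqI; simp add: frame_def; algebra)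
  then show ?thesis using frame_eq_iff[OF assms] by (auto simp: closed_segment_def)
qed

text \<open>This identifies the region enclosed by a polygon without the Jordan curve theorem. A point of
  \<open>{f > 0}\<close> escapes to infinity along a ray that never meets the zero set, hence lies outside. A
  connected set that avoids the zero set and meets \<open>{f < 0}\<close> stays there by the intermediate
  value theorem, hence is bounded.\<close>

lemma inside_level_set:
  fixes f :: "'a::real_normed_vector \<Rightarrow> real"
  assumes cont: "continuous_on UNIV f" and bdd: "bounded {z. f z < 0}"
    and ray: "\<And>z. 0 < f z \<Longrightarrow> \<exists>v. v \<noteq> 0 \<and> (\<forall>\<tau>\<ge>0. 0 < f (z + \<tau> *\<^sub>R v))"
  shows "inside {z. f z = 0} = {z. f z < 0}"
proof (intro equalityI subsetI)
  fix z assume z: "z \<in> inside {z. f z = 0}"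
  then have b: "bounded (connected_component_set (- {z. f z = 0}) z)" and "f z \<noteq> 0"
    by (auto simp: inside_def)
  show "z \<in> {z. f z < 0}"
  proof (rule ccontr)
    assume "z \<notin> {z. f z < 0}"
    with \<open>f z \<noteq> 0\<close> have "0 < f z" by simp
    then obtain v where v: "v \<noteq> 0" "\<And>\<tau>. 0 \<le> \<tau> \<Longrightarrow> 0 < f (z + \<tau> *\<^sub>R v)" using ray by blast
    define R where "R = (\<lambda>\<tau>. z + \<tau> *\<^sub>R v) ` {0..}"
    have "connected R" unfolding R_def
      by (intro connected_continuous_image continuous_intros) (auto simp: is_interval_connected_1[symmetric])
    moreover have "z \<in> R" unfolding R_def by (rule image_eqI[of _ _ 0]) auto
    moreover have "R \<subseteq> - {z. f z = 0}" unfolding R_def using v(2) by force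
    ultimately have "R \<subseteq> connected_component_set (- {z. f z = 0}) z"
      by (intro connected_component_maximal)
    then have "bounded R" using b bounded_subset by blast
    then obtain B where B: "\<And>y. y \<in> R \<Longrightarrow> norm y \<le> B" by (auto simp: bounded_iff)
    define \<tau> where "\<tau> = (B + norm z + 1) / norm v"
    have B0: "0 \<le> B" using B[OF \<open>z \<in> R\<close>] norm_ge_zero order_trans by blast
    then have "0 \<le> \<tau>" by (simp add: \<tau>_def)
    then have "norm (z + \<tau> *\<^sub>R v) \<le> B" using B unfolding R_def by blast
    moreover have "norm (\<tau> *\<^sub>R v) = B + norm z + 1" using v(1) B0 by (simp add: \<tau>_def)
    moreover have "norm (\<tau> *\<^sub>R v) \<le> norm (z + \<tau> *\<^sub>R v) + norm z"
      by (metis add.commute add_diff_cancel_left' norm_triangle_sub norm_minus_commute norm_triangle_ineq4)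
    ultimately show False by simp
  qed
next
  fix z assume z: "z \<in> {z. f z < 0}"
  define C where "C = connected_component_set (- {z. f z = 0}) z"
  have "connected (f ` C)" unfolding C_def
    by (intro connected_continuous_image continuous_on_subset[OF cont]) auto
  moreover have "f z \<in> f ` C" using z unfolding C_def by (intro imageI) (auto simp: connected_component_refl)
  moreover have "0 \<notin> f ` C" unfolding C_def using connected_component_subset by fastforce
  ultimately have "C \<subseteq> {z. f z < 0}"
    using z by (smt (verit) connectedD_interval image_eqI mem_Collect_eq subsetI)
  then have "bounded C" using bdd bounded_subset by blast
  then show "z \<in> inside {z. f z = 0}" using z by (simp add: inside_def C_def)
qed

lemma bounded_frame:
  assumes "x \<noteq> 0" "\<And>z. z \<in> A \<Longrightarrow> \<bar>along m x z\<bar> \<le> B \<and> \<bar>across m x z\<bar> \<le> B"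
  shows "bounded A"
proof -
  have "norm z \<le> norm m + B * norm x + B * norm x" if "z \<in> A" for z
  proof -
    have "norm z = norm (m + along m x z *\<^sub>R x + across m x z *\<^sub>R rot x)"
      using frame_along_across[OF assms(1), of m z] by (simp add: frame_def)
    also have "\<dots> \<le> norm m + norm (along m x z *\<^sub>R x) + norm (across m x z *\<^sub>R rot x)"
      by (intro order_trans[OF norm_triangle_ineq] add_right_mono norm_triangle_ineq)
    also have "\<dots> \<le> norm m + B * norm x + B * norm x"
      using assms(2)[OF that] by (intro add_mono) (auto intro: mult_right_mono)
    finally show ?thesis .
  qed
  then show ?thesis unfolding bounded_iff by blast
qed

text \<open>A diagonal of the quadrilateral is taken as the segment from \<open>s = -1\<close> to \<open>s = 1\<close> on the line
  \<open>t = 0\<close>. The other two vertices are \<open>(\<beta>, \<eta>)\<close> above and \<open>(\<delta>, -\<zeta>)\<close> below this line. Centre and half-length of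
  the chords are then piecewise linear in the height \<open>t\<close>.\<close>

definition quad_centre :: "real \<Rightarrow> real \<Rightarrow> real \<Rightarrow> real \<Rightarrow> real \<Rightarrow> real" where
  "quad_centre \<beta> \<delta> \<eta> \<zeta> t = \<beta> * (max t 0 / \<eta>) + \<delta> * (max (- t) 0 / \<zeta>)"

text \<open>Outside \<open>[-\<zeta>, \<eta>]\<close> the value is negative, which makes the slice empty.\<close>

definition quad_width :: "real \<Rightarrow> real \<Rightarrow> real \<Rightarrow> real" where
  "quad_width \<eta> \<zeta> t = min (1 - t / \<eta>) (1 + t / \<zeta>)"

definition quad :: "real^2 \<Rightarrow> real^2 \<Rightarrow> real \<Rightarrow> real \<Rightarrow> real \<Rightarrow> real \<Rightarrow> (real^2) set" where
  "quad m x \<beta> \<delta> \<eta> \<zeta> = sliced m x (quad_centre \<beta> \<delta> \<eta> \<zeta>) (quad_width \<eta> \<zeta>)"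

text \<open>The triangle with base from \<open>(-1, 0)\<close> to \<open>(1, 0)\<close> and apex \<open>(\<beta>, \<eta>)\<close> in frame coordinates.\<close>

definition tri :: "real^2 \<Rightarrow> real^2 \<Rightarrow> real \<Rightarrow> real \<Rightarrow> (real^2) set" where
  "tri m x \<beta> \<eta> = sliced m x (\<lambda>t. \<beta> * t / \<eta>) (\<lambda>t. if 0 < t then 1 - t / \<eta> else 0)"

lemma quad_centre_cases:
  "0 \<le> t \<Longrightarrow> quad_centre \<beta> \<delta> \<eta> \<zeta> t = \<beta> * (t / \<eta>)"
  "t \<le> 0 \<Longrightarrow> quad_centre \<beta> \<delta> \<eta> \<zeta> t = \<delta> * (- t / \<zeta>)"
  by (simp_all add: quad_centre_def max_def)

lemma quad_width_cases:
  assumes "0 < \<eta>" "0 < \<zeta>"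
  shows "0 \<le> t \<Longrightarrow> quad_width \<eta> \<zeta> t = 1 - t / \<eta>"
    and "t \<le> 0 \<Longrightarrow> quad_width \<eta> \<zeta> t = 1 + t / \<zeta>"
proof -
  show "quad_width \<eta> \<zeta> t = 1 - t / \<eta>" if "0 \<le> t"
  proof -
    have "0 \<le> t / \<eta>" "0 \<le> t / \<zeta>" using that assms by auto
    then show ?thesis unfolding quad_width_def by linarith
  qed
  show "quad_width \<eta> \<zeta> t = 1 + t / \<zeta>" if "t \<le> 0"
  proof -
    have "t / \<eta> \<le> 0" "t / \<zeta> \<le> 0" using that assms by (auto simp: divide_nonpos_pos)
    then show ?thesis unfolding quad_width_def by linarith
  qed
qed

lemma frame_in_side:
  assumes "x \<noteq> 0" "\<eta> \<noteq> 0"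
  shows "frame m x s t \<in> closed_segment (frame m x \<epsilon> 0) (frame m x \<beta> \<eta>) \<longleftrightarrow>
    0 \<le> t / \<eta> \<and> t / \<eta> \<le> 1 \<and> s = \<epsilon> * (1 - t / \<eta>) + \<beta> * (t / \<eta>)"
  unfolding frame_in_segment[OF assms(1)]
proof
  assume "\<exists>u. 0 \<le> u \<and> u \<le> 1 \<and> s = (1 - u) * \<epsilon> + u * \<beta> \<and> t = (1 - u) * 0 + u * \<eta>"
  then obtain u where u: "0 \<le> u" "u \<le> 1" "s = (1 - u) * \<epsilon> + u * \<beta>" "t = u * \<eta>" by auto
  then have "t / \<eta> = u" using assms by simp
  then show "0 \<le> t / \<eta> \<and> t / \<eta> \<le> 1 \<and> s = \<epsilon> * (1 - t / \<eta>) + \<beta> * (t / \<eta>)"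
    using u by (simp add: mult.commute)
next
  assume "0 \<le> t / \<eta> \<and> t / \<eta> \<le> 1 \<and> s = \<epsilon> * (1 - t / \<eta>) + \<beta> * (t / \<eta>)"
  then show "\<exists>u. 0 \<le> u \<and> u \<le> 1 \<and> s = (1 - u) * \<epsilon> + u * \<beta> \<and> t = (1 - u) * 0 + u * \<eta>"
    using assms by (intro exI[of _ "t / \<eta>"]) (simp add: mult.commute)
qed

lemma bounded_quad:
  assumes "x \<noteq> 0" "0 < \<eta>" "0 < \<zeta>"
  shows "bounded (quad m x \<beta> \<delta> \<eta> \<zeta>)"
proof (rule bounded_frame[OF assms(1)])
  fix z assume "z \<in> quad m x \<beta> \<delta> \<eta> \<zeta>"
  then have z: "\<bar>along m x z - quad_centre \<beta> \<delta> \<eta> \<zeta> (across m x z)\<bar> < quad_width \<eta> \<zeta> (across m x z)"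
    by (simp add: quad_def sliced_def)
  define s t where "s = along m x z" and "t = across m x z"
  have "\<bar>s\<bar> \<le> 1 + \<bar>\<beta>\<bar> + \<bar>\<delta>\<bar> \<and> \<bar>t\<bar> \<le> \<eta> + \<zeta>"
  proof (cases "0 \<le> t")
    case True
    then have *: "\<bar>s - \<beta> * (t / \<eta>)\<bar> < 1 - t / \<eta>" using z assms
      by (simp add: quad_centre_cases quad_width_cases s_def t_def)
    then have u: "0 \<le> t / \<eta>" "t / \<eta> < 1" using True assms by (simp, linarith)
    then have "\<bar>\<beta> * (t / \<eta>)\<bar> \<le> \<bar>\<beta>\<bar> * 1" unfolding abs_mult by (intro mult_left_mono) auto
    moreover have "t < \<eta>" using u assms by (simp add: divide_less_eq)
    ultimately show ?thesis using * u True assms by linarith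
  next
    case False
    then have *: "\<bar>s - \<delta> * (- t / \<zeta>)\<bar> < 1 + t / \<zeta>" using z assms
      by (simp add: quad_centre_cases quad_width_cases s_def t_def)
    then have u: "0 \<le> - t / \<zeta>" "- t / \<zeta> < 1" using False assms by (simp add: divide_nonpos_pos, linarith)
    then have "\<bar>\<delta> * (- t / \<zeta>)\<bar> \<le> \<bar>\<delta>\<bar> * 1" unfolding abs_mult by (intro mult_left_mono) auto
    moreover have "- t < \<zeta>" using u(2) assms by (simp add: less_divide_eq)
    ultimately show ?thesis using * u False assms by linarith
  qed
  then show "\<bar>along m x z\<bar> \<le> 1 + \<bar>\<beta>\<bar> + \<bar>\<delta>\<bar> + \<eta> + \<zeta> \<and> \<bar>across m x z\<bar> \<le> 1 + \<bar>\<beta>\<bar> + \<bar>\<delta>\<bar> + \<eta> + \<zeta>"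
    using assms unfolding s_def t_def by linarith
qed

text \<open>Moving along a chord direction, away from the centre \<open>c\<close>, keeps the height and does not come
  closer to \<open>c\<close>. These are the rays that \<open>inside_level_set\<close> asks for.\<close>

lemma horizontal_ray:
  assumes "x \<noteq> 0"
  shows "\<exists>v. v \<noteq> 0 \<and> (\<forall>\<tau>\<ge>0. across m x (z + \<tau> *\<^sub>R v) = across m x z \<and>
    \<bar>along m x z - c\<bar> \<le> \<bar>along m x (z + \<tau> *\<^sub>R v) - c\<bar>)"
proof -
  \<comment> \<open>The direction of motion is chosen to point away from \<open>c\<close>.\<close>
  define k where "k = (if along m x z \<ge> c then 1 else - 1 :: real)"
  have "z + \<tau> *\<^sub>R (k *\<^sub>R x) = frame m x (along m x z + \<tau> * k) (across m x z)" for \<tau>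
  proof -
    have "z + \<tau> *\<^sub>R (k *\<^sub>R x) = frame m x (along m x z) (across m x z) + \<tau> *\<^sub>R (k *\<^sub>R x)"
      by (simp add: frame_along_across[OF assms])
    also have "\<dots> = frame m x (along m x z + \<tau> * k) (across m x z)"
      by (simp add: frame_def algebra_simps)
    finally show ?thesis .
  qed
  then have "across m x (z + \<tau> *\<^sub>R (k *\<^sub>R x)) = across m x z \<and>
      along m x (z + \<tau> *\<^sub>R (k *\<^sub>R x)) = along m x z + \<tau> * k" for \<tau>
    using assms by simp
  moreover have "\<bar>along m x z - c\<bar> \<le> \<bar>along m x z + \<tau> * k - c\<bar>" if "0 \<le> \<tau>" for \<tau>
    using that by (auto simp: k_def)
  ultimately show ?thesis using assms by (intro exI[of _ "k *\<^sub>R x"]) (auto simp: k_def)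
qed

lemma continuous_quad_centre: "0 < \<eta> \<Longrightarrow> 0 < \<zeta> \<Longrightarrow> continuous_on A (quad_centre \<beta> \<delta> \<eta> \<zeta>)"
  unfolding quad_centre_def by (intro continuous_intros) auto

lemma continuous_quad_width: "0 < \<eta> \<Longrightarrow> 0 < \<zeta> \<Longrightarrow> continuous_on A (quad_width \<eta> \<zeta>)"
  unfolding quad_width_def by (intro continuous_intros) auto

lemma inside_quad:
  assumes x: "x \<noteq> 0" and pos: "0 < \<eta>" "0 < \<zeta>"
    and a: "a = frame m x (-1) 0" and b: "b = frame m x \<beta> \<eta>" and c: "c = frame m x 1 0" and d: "d = frame m x \<delta> (-\<zeta>)"
  shows "inside (closed_segment a b \<union> closed_segment b c \<union> closed_segment c d \<union> closed_segment d a)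
    = quad m x \<beta> \<delta> \<eta> \<zeta>"
proof -
  define f where "f z = \<bar>along m x z - quad_centre \<beta> \<delta> \<eta> \<zeta> (across m x z)\<bar> - quad_width \<eta> \<zeta> (across m x z)" for z
  have neg: "{z. f z < 0} = quad m x \<beta> \<delta> \<eta> \<zeta>" by (auto simp: f_def quad_def sliced_def)
  have zero: "{z. f z = 0} = closed_segment a b \<union> closed_segment b c \<union> closed_segment c d \<union> closed_segment d a"
  proof (rule set_eqI)
    fix z
    define s t where "s = along m x z" and "t = across m x z"
    have z: "z = frame m x s t" using frame_along_across[OF x] by (simp add: s_def t_def)
    have f: "f z = 0 \<longleftrightarrow> \<bar>s - quad_centre \<beta> \<delta> \<eta> \<zeta> t\<bar> = quad_width \<eta> \<zeta> t"
      by (simp add: f_def s_def t_def)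
    have ab: "z \<in> closed_segment a b \<longleftrightarrow> 0 \<le> t / \<eta> \<and> t / \<eta> \<le> 1 \<and> s = - (1 - t / \<eta>) + \<beta> * (t / \<eta>)"
      unfolding z a b using frame_in_side[OF x, of \<eta> m s t "-1" \<beta>] pos by simp
    have cb: "z \<in> closed_segment b c \<longleftrightarrow> 0 \<le> t / \<eta> \<and> t / \<eta> \<le> 1 \<and> s = (1 - t / \<eta>) + \<beta> * (t / \<eta>)"
      unfolding z c b closed_segment_commute[of "frame m x \<beta> \<eta>"] using frame_in_side[OF x, of \<eta> m s t 1 \<beta>] pos by simp
    have cd: "z \<in> closed_segment c d \<longleftrightarrow> 0 \<le> - t / \<zeta> \<and> - t / \<zeta> \<le> 1 \<and> s = (1 - - t / \<zeta>) + \<delta> * (- t / \<zeta>)"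
      unfolding z c d using frame_in_side[OF x, of "-\<zeta>" m s t 1 \<delta>] pos by simp
    have ad: "z \<in> closed_segment d a \<longleftrightarrow> 0 \<le> - t / \<zeta> \<and> - t / \<zeta> \<le> 1 \<and> s = - (1 - - t / \<zeta>) + \<delta> * (- t / \<zeta>)"
      unfolding z a d closed_segment_commute[of "frame m x \<delta> (-\<zeta>)"] using frame_in_side[OF x, of "-\<zeta>" m s t "-1" \<delta>] pos by simp
    show "z \<in> {z. f z = 0} \<longleftrightarrow> z \<in> closed_segment a b \<union> closed_segment b c \<union> closed_segment c d \<union> closed_segment d a"
    proof (cases "0 \<le> t")
      case True
      have q: "quad_centre \<beta> \<delta> \<eta> \<zeta> t = \<beta> * (t / \<eta>)" "quad_width \<eta> \<zeta> t = 1 - t / \<eta>"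
        using quad_centre_cases(1)[OF True] quad_width_cases(1)[OF pos True] by auto
      have u: "0 \<le> t / \<eta>" using True pos by simp
      have "- t / \<zeta> \<le> 0" "0 \<le> - t / \<zeta> \<Longrightarrow> t = 0"
        using True pos by (auto simp: divide_le_0_iff zero_le_divide_iff)
      then show ?thesis using f q u unfolding mem_Collect_eq Un_iff ab cb cd ad by (cases "t = 0") force+
    next
      case False
      then have t: "t \<le> 0" by simp
      have q: "quad_centre \<beta> \<delta> \<eta> \<zeta> t = \<delta> * (- t / \<zeta>)" "quad_width \<eta> \<zeta> t = 1 + t / \<zeta>"
        using quad_centre_cases(2)[OF t] quad_width_cases(2)[OF pos t] by auto
      have u: "0 \<le> - t / \<zeta>" "\<not> 0 \<le> t / \<eta>" using False pos by (auto simp: zero_le_divide_iff divide_le_0_iff)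
      show ?thesis using f q u unfolding mem_Collect_eq Un_iff ab cb cd ad by force
    qed
  qed
  have "inside {z. f z = 0} = {z. f z < 0}"
  proof (rule inside_level_set)
    show "continuous_on UNIV f" unfolding f_def
      by (intro continuous_intros continuous_on_compose2[OF continuous_quad_centre[OF pos]]
          continuous_on_compose2[OF continuous_quad_width[OF pos]]) auto
    show "bounded {z. f z < 0}" unfolding neg by (rule bounded_quad[OF x pos])
    show "\<exists>v. v \<noteq> 0 \<and> (\<forall>\<tau>\<ge>0. 0 < f (z + \<tau> *\<^sub>R v))" if "0 < f z" for z
      using horizontal_ray[OF x, of m z "quad_centre \<beta> \<delta> \<eta> \<zeta> (across m x z)"] that
      unfolding f_def by (metis (no_types, lifting) diff_gt_0_iff_gt less_le_trans)
  qed
  then show ?thesis unfolding zero neg .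
qed

lemma bounded_tri:
  assumes "x \<noteq> 0" "0 < \<eta>"
  shows "bounded (tri m x \<beta> \<eta>)"
proof -
  have "tri m x \<beta> \<eta> \<subseteq> quad m x \<beta> 0 \<eta> 1"
  proof
    fix z assume "z \<in> tri m x \<beta> \<eta>"
    then have "\<bar>along m x z - \<beta> * (across m x z / \<eta>)\<bar> < 1 - across m x z / \<eta>" "0 < across m x z"
      by (auto simp: tri_def sliced_def split: if_splits)
    then show "z \<in> quad m x \<beta> 0 \<eta> 1"
      using assms by (simp add: quad_def sliced_def quad_centre_cases quad_width_cases)
  qed
  then show ?thesis using bounded_quad[of x \<eta> 1] assms bounded_subset by simp blast
qed

lemma inside_tri:
  assumes x: "x \<noteq> 0" and pos: "0 < \<eta>"
    and a: "a = frame m x (-1) 0" and b: "b = frame m x 1 0" and c: "c = frame m x \<beta> \<eta>"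
  shows "inside (closed_segment a b \<union> closed_segment b c \<union> closed_segment c a) = tri m x \<beta> \<eta>"
proof -
  define f where "f z = max (- across m x z) (\<bar>along m x z - \<beta> * (across m x z / \<eta>)\<bar> - (1 - across m x z / \<eta>))" for z
  have neg: "{z. f z < 0} = tri m x \<beta> \<eta>" by (auto simp: f_def tri_def sliced_def)
  have zero: "{z. f z = 0} = closed_segment a b \<union> closed_segment b c \<union> closed_segment c a"
  proof (rule set_eqI)
    fix z
    define s t where "s = along m x z" and "t = across m x z"
    have z: "z = frame m x s t" using frame_along_across[OF x] by (simp add: s_def t_def)
    have f: "f z = 0 \<longleftrightarrow> max (- t) (\<bar>s - \<beta> * (t / \<eta>)\<bar> - (1 - t / \<eta>)) = 0"
      by (simp add: f_def s_def t_def)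
    have ca: "z \<in> closed_segment c a \<longleftrightarrow> 0 \<le> t / \<eta> \<and> t / \<eta> \<le> 1 \<and> s = - (1 - t / \<eta>) + \<beta> * (t / \<eta>)"
      unfolding z a c closed_segment_commute[of "frame m x \<beta> \<eta>"] using frame_in_side[OF x, of \<eta> m s t "-1" \<beta>] pos by simp
    have bc: "z \<in> closed_segment b c \<longleftrightarrow> 0 \<le> t / \<eta> \<and> t / \<eta> \<le> 1 \<and> s = (1 - t / \<eta>) + \<beta> * (t / \<eta>)"
      unfolding z c b using frame_in_side[OF x, of \<eta> m s t 1 \<beta>] pos by simp
    have ab: "z \<in> closed_segment a b \<longleftrightarrow> t = 0 \<and> \<bar>s\<bar> \<le> 1"
    proof -
      have "(\<exists>u. 0 \<le> u \<and> u \<le> 1 \<and> s = (1 - u) * (- 1) + u * 1) \<longleftrightarrow> \<bar>s\<bar> \<le> 1"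
      proof
        assume "\<bar>s\<bar> \<le> 1"
        then show "\<exists>u. 0 \<le> u \<and> u \<le> 1 \<and> s = (1 - u) * (- 1) + u * 1"
          by (intro exI[of _ "(s + 1) / 2"]) (auto simp: field_simps)
      qed auto
      then show ?thesis unfolding z a b frame_in_segment[OF x] by auto
    qed
    show "z \<in> {z. f z = 0} \<longleftrightarrow> z \<in> closed_segment a b \<union> closed_segment b c \<union> closed_segment c a"
    proof (cases "0 < t")
      case True
      then have u: "0 < t / \<eta>" using pos by simp
      show ?thesis using f u True unfolding mem_Collect_eq Un_iff ab bc ca by (auto simp: max_def)
    next
      case False
      show ?thesis
      proof (cases "t = 0")
        case True
        then show ?thesis using f unfolding mem_Collect_eq Un_iff ab bc ca by (auto simp: max_def)
      next
        case t: False
        then have "\<not> 0 \<le> t / \<eta>" using False pos by (auto simp: zero_le_divide_iff)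
        then show ?thesis using f t False unfolding mem_Collect_eq Un_iff ab bc ca by auto
      qed
    qed
  qed
  have "inside {z. f z = 0} = {z. f z < 0}"
  proof (rule inside_level_set)
    show "continuous_on UNIV f" unfolding f_def using pos by (intro continuous_intros) auto
    show "bounded {z. f z < 0}" unfolding neg by (rule bounded_tri[OF x pos])
    show "\<exists>v. v \<noteq> 0 \<and> (\<forall>\<tau>\<ge>0. 0 < f (z + \<tau> *\<^sub>R v))" if "0 < f z" for z
    proof -
      obtain v where "v \<noteq> 0" and v: "\<And>\<tau>. 0 \<le> \<tau> \<Longrightarrow> across m x (z + \<tau> *\<^sub>R v) = across m x z \<and>
          \<bar>along m x z - \<beta> * (across m x z / \<eta>)\<bar> \<le> \<bar>along m x (z + \<tau> *\<^sub>R v) - \<beta> * (across m x z / \<eta>)\<bar>"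
        using horizontal_ray[OF x, of m z "\<beta> * (across m x z / \<eta>)"] by blast
      have "0 < f (z + \<tau> *\<^sub>R v)" if "0 \<le> \<tau>" for \<tau>
        using v[OF that] \<open>0 < f z\<close> unfolding f_def by auto
      then show ?thesis using \<open>v \<noteq> 0\<close> by blast
    qed
  qed
  then show ?thesis unfolding zero neg .
qed

section \<open>The separating diagonal of a simple quadrilateral\<close>

text \<open>Twice the signed area of the triangle \<open>a b c\<close>.\<close>

definition ori :: "real^2 \<Rightarrow> real^2 \<Rightarrow> real^2 \<Rightarrow> real" where
  "ori a b c = (b$1 - a$1) * (c$2 - a$2) - (b$2 - a$2) * (c$1 - a$1)"

lemma collinear_ori: "collinear {a, b, c} \<longleftrightarrow> ori a b c = 0"
proof -
  have "collinear {a, b, c} \<longleftrightarrow> collinear {b, a, c}" by (simp add: insert_commute)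
  also have "\<dots> \<longleftrightarrow> collinear {0, b - a, c - a}"
    by (subst collinear_3) (simp_all add: NO_MATCH_def)
  also have "\<dots> \<longleftrightarrow> ori a b c = 0"
  proof
    assume "collinear {0, b - a, c - a}"
    then have "b - a = 0 \<or> c - a = 0 \<or> (\<exists>k. c - a = k *\<^sub>R (b - a))" by (simp only: collinear_lemma)
    then consider "b - a = 0" | "c - a = 0" | k where "c - a = k *\<^sub>R (b - a)" by blast
    then show "ori a b c = 0"
    proof cases
      case 3
      then have "c$1 - a$1 = k * (b$1 - a$1)" "c$2 - a$2 = k * (b$2 - a$2)"
        by (metis vector_minus_component vector_scaleR_component real_scaleR_def)+
      then show ?thesis by (simp add: ori_def)
    qed (auto simp: ori_def)
  next
    assume o: "ori a b c = 0"
    show "collinear {0, b - a, c - a}"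
    proof (cases "b = a")
      case False
      then have ba: "b - a \<noteq> 0" by simp
      have "c - a = along 0 (b - a) (c - a) *\<^sub>R (b - a) + across 0 (b - a) (c - a) *\<^sub>R rot (b - a)"
        using frame_along_across[OF ba, of 0 "c - a"] by (simp add: frame_def)
      moreover have "across 0 (b - a) (c - a) = 0"
        using o by (simp add: across_def inner_plane ori_def algebra_simps)
      ultimately have "c - a = along 0 (b - a) (c - a) *\<^sub>R (b - a)" by simp
      then show ?thesis unfolding collinear_lemma by blast
    qed simp
  qed
  finally show ?thesis .
qed

text \<open>If \<open>c\<close>, \<open>d\<close> lie strictly on opposite sides of the line \<open>a b\<close> and vice versa, the crossing point of the
  lines divides both segments in ratios given by the signed areas.\<close>

lemma opposite_sides_cross:
  assumes "ori a b c * ori a b d < 0" "ori c d a * ori c d b < 0"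
  obtains p where "p \<in> closed_segment a b" "p \<in> closed_segment c d" "p \<notin> {a, b, c, d}"
proof -
  define D where "D = ori a b c - ori a b d"
  have D: "D = ori c d b - ori c d a" by (simp add: D_def ori_def algebra_simps)
  have frac: "0 < r / (r - s) \<and> r / (r - s) < 1" if "r * s < 0" for r s :: real
    using that by (auto simp: mult_less_0_iff zero_less_divide_iff divide_less_eq)
  define u v where "u = ori c d a / (ori c d a - ori c d b)" and "v = ori a b c / (ori a b c - ori a b d)"
  have u: "0 < u" "u < 1" and v: "0 < v" "v < 1"
    using frac[OF assms(1)] frac[OF assms(2)] by (auto simp: u_def v_def)
  have D0: "D \<noteq> 0" using assms(1) by (auto simp: D_def mult_less_0_iff)
  have uden: "ori c d a - ori c d b = - D" using D by simp
  have uD: "u * D = - ori c d a" and vD: "v * D = ori a b c"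
    unfolding u_def v_def uden D_def[symmetric] using D0 by simp_all
  define p where "p = (1 - u) *\<^sub>R a + u *\<^sub>R b"
  \<comment> \<open>Multiplying by the common denominator \<open>D\<close> turns the claim into a polynomial identity.\<close>
  have "D *\<^sub>R p = D *\<^sub>R ((1 - v) *\<^sub>R c + v *\<^sub>R d)"
  proof (rule plane_eqI)
    have e: "D *\<^sub>R p = D *\<^sub>R a + (u * D) *\<^sub>R (b - a)"
      "D *\<^sub>R ((1 - v) *\<^sub>R c + v *\<^sub>R d) = D *\<^sub>R c + (v * D) *\<^sub>R (d - c)"
      by (simp_all add: p_def algebra_simps)
    show "(D *\<^sub>R p)$1 = (D *\<^sub>R ((1 - v) *\<^sub>R c + v *\<^sub>R d))$1"
      unfolding e uD vD by (simp add: D_def ori_def) algebra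
    show "(D *\<^sub>R p)$2 = (D *\<^sub>R ((1 - v) *\<^sub>R c + v *\<^sub>R d))$2"
      unfolding e uD vD by (simp add: D_def ori_def) algebra
  qed
  then have p2: "p = (1 - v) *\<^sub>R c + v *\<^sub>R d" using D0 by simp
  have ne: "a \<noteq> b" "c \<noteq> d" using assms by (auto simp: ori_def)
  have "p \<in> open_segment a b" unfolding in_segment p_def using u ne by auto
  moreover have "p \<in> open_segment c d" unfolding in_segment p2 using v ne by auto
  ultimately show ?thesis by (intro that[of p]) (auto simp: open_segment_def)
qed

lemma path_image_triangle:
  "path_image (closed_polygonal_line [a, b, c]) = closed_segment a b \<union> closed_segment b c \<union> closed_segment c a"
  by (simp add: closed_polygonal_line_def path_image_join Un_assoc)

lemma path_image_quadrilateral: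
  "path_image (closed_polygonal_line [a, b, c, d]) =
    closed_segment a b \<union> closed_segment b c \<union> closed_segment c d \<union> closed_segment d a"
  by (simp add: closed_polygonal_line_def path_image_join Un_assoc)

lemma simple_quadrilateral_sides:
  assumes "simple_path (closed_polygonal_line [a, b, c, d])"
  shows "closed_segment a b \<inter> closed_segment c d \<subseteq> {a, b}"
    and "closed_segment b c \<inter> closed_segment d a \<subseteq> {c}"
proof -
  have "simple_path (linepath a b +++ (linepath b c +++ (linepath c d +++ linepath d a)))"
    using assms by (simp add: closed_polygonal_line_def)
  then have 1: "arc (linepath b c +++ (linepath c d +++ linepath d a))"
    "path_image (linepath a b) \<inter> path_image (linepath b c +++ (linepath c d +++ linepath d a)) \<subseteq> {a, b}"
    by (subst (asm) simple_path_join_loop_eq; simp)+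
  then have 2: "path_image (linepath b c) \<inter> path_image (linepath c d +++ linepath d a) \<subseteq> {c}"
    by (subst (asm) arc_join_eq; simp)
  show "closed_segment a b \<inter> closed_segment c d \<subseteq> {a, b}" using 1(2) by (auto simp: path_image_join)
  show "closed_segment b c \<inter> closed_segment d a \<subseteq> {c}" using 2 by (auto simp: path_image_join)
qed

lemma polygon_vertices_triangle:
  "polygon_vertices [a, b, c] \<longleftrightarrow> simple_path (closed_polygonal_line [a, b, c]) \<and> ori a b c \<noteq> 0"
proof -
  have len: "length [a, b, c] = 3" by simp
  have all: "(\<forall>i<3. P i) \<longleftrightarrow> P 0 \<and> P 1 \<and> P 2" for P :: "nat \<Rightarrow> bool"
    by (simp add: numeral_3_eq_3 numeral_2_eq_2 All_less_Suc) blast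
  have "ori b c a = ori a b c" "ori c a b = ori a b c" by (simp_all add: ori_def algebra_simps)
  then show ?thesis unfolding polygon_vertices_def len all by (simp add: collinear_ori)
qed

lemma polygon_vertices_quadrilateral:
  "polygon_vertices [a, b, c, d] \<longleftrightarrow> simple_path (closed_polygonal_line [a, b, c, d]) \<and>
     ori a b c \<noteq> 0 \<and> ori b c d \<noteq> 0 \<and> ori c d a \<noteq> 0 \<and> ori d a b \<noteq> 0"
proof -
  have len: "length [a, b, c, d] = 4" by simp
  have all: "(\<forall>i<4. P i) \<longleftrightarrow> P 0 \<and> P 1 \<and> P 2 \<and> P 3" for P :: "nat \<Rightarrow> bool"
    by (simp add: eval_nat_numeral All_less_Suc) blast
  show ?thesis unfolding polygon_vertices_def len all by (simp add: collinear_ori)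
qed

text \<open>The four signed areas satisfy \<open>p + r = q + s\<close>. If neither diagonal separated the other two
  vertices, then \<open>p\<close>, \<open>r\<close> and \<open>q\<close>, \<open>s\<close> would have opposite signs. Whichever way the signs match up, a pair of
  opposite sides would cross, against simplicity of the path.\<close>

lemma simple_quadrilateral_diagonal:
  assumes "polygon_vertices [a, b, c, d]"
  shows "ori a c b * ori a c d < 0 \<or> ori b d a * ori b d c < 0"
proof (rule ccontr)
  assume neg: "\<not> ?thesis"
  from assms have s: "simple_path (closed_polygonal_line [a, b, c, d])"
    and o: "ori a b c \<noteq> 0" "ori b c d \<noteq> 0" "ori c d a \<noteq> 0" "ori d a b \<noteq> 0"
    by (simp_all add: polygon_vertices_quadrilateral)
  define p q r s where "p = ori a b c" and "q = ori b c d" and "r = ori c d a" and "s = ori d a b"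
  have n: "p \<noteq> 0" "q \<noteq> 0" "r \<noteq> 0" "s \<noteq> 0" using o by (simp_all add: p_def q_def r_def s_def)
  have sum: "p + r = q + s" by (simp add: p_def q_def r_def s_def ori_def algebra_simps)
  have "ori a c b = - p" "ori a c d = r" "ori b d a = s" "ori b d c = - q"
    by (simp_all add: p_def q_def r_def s_def ori_def algebra_simps)
  then have pr: "p * r < 0" and qs: "q * s < 0"
    using neg n by (auto simp: not_less mult_le_0_iff mult_less_0_iff zero_le_mult_iff)
  have no1: "\<not> (ori a b c * ori a b d < 0 \<and> ori c d a * ori c d b < 0)"
    using opposite_sides_cross[of a b c d] simple_quadrilateral_sides(1)[OF \<open>simple_path _\<close>] by blast
  have no2: "\<not> (ori b c d * ori b c a < 0 \<and> ori d a b * ori d a c < 0)"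
    using opposite_sides_cross[of b c d a] simple_quadrilateral_sides(2)[OF \<open>simple_path _\<close>] by blast
  have "ori a b d = s" "ori c d b = q" "ori b c a = p" "ori d a c = r"
    by (simp_all add: p_def q_def r_def s_def ori_def algebra_simps)
  then have "\<not> (p * s < 0 \<and> r * q < 0)" "\<not> (q * p < 0 \<and> s * r < 0)"
    using no1 no2 by (simp_all add: p_def q_def r_def s_def)
  then show False using pr qs by (auto simp: mult_less_0_iff)
qed

lemma ori_frame:
  "ori (frame m x (-1) 0) (frame m x 1 0) (frame m x s t) = 2 * t * (norm x)\<^sup>2"
  unfolding norm_plane by (simp add: ori_def frame_def power2_eq_square algebra_simps)

lemma frame_of_diagonal:
  assumes "a \<noteq> c"
  defines "m \<equiv> (1/2) *\<^sub>R (a + c)" and "x \<equiv> (1/2) *\<^sub>R (c - a)"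
  shows "x \<noteq> 0" "a = frame m x (-1) 0" "c = frame m x 1 0"
proof -
  show "x \<noteq> 0" using assms by simp
  show "a = frame m x (-1) 0" "c = frame m x 1 0"
    by (rule plane_eqI; simp add: frame_def m_def x_def field_simps)+
qed

lemma frame_minus: "frame m (- x) s t = frame m x (- s) (- t)"
  by (simp add: frame_def rot_minus)

text \<open>Exchanging \<open>a\<close> and \<open>c\<close> reverses the frame, so \<open>b\<close> may be assumed to lie on the positive side.\<close>

lemma split_quadrilateral:
  assumes "ori a c b * ori a c d < 0"
  shows "\<exists>m x \<beta> \<delta> \<eta> \<zeta> a' c'. x \<noteq> 0 \<and> 0 < \<eta> \<and> 0 < \<zeta> \<and> (a', c') \<in> {(a, c), (c, a)} \<and>
    a' = frame m x (-1) 0 \<and> b = frame m x \<beta> \<eta> \<and> c' = frame m x 1 0 \<and> d = frame m x \<delta> (-\<zeta>)"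
proof -
  have "a \<noteq> c" using assms by (auto simp: ori_def)
  note fr = frame_of_diagonal[OF this]
  define m x where "m = (1/2) *\<^sub>R (a + c)" and "x = (1/2) *\<^sub>R (c - a)"
  note fr' = fr[folded m_def x_def]
  obtain \<beta> \<eta> where b: "b = frame m x \<beta> \<eta>" using frame_along_across[OF fr'(1)] by metis
  obtain \<delta> \<zeta> where d: "d = frame m x \<delta> (-\<zeta>)" using frame_along_across[OF fr'(1)] by (metis minus_minus)
  have n: "0 < (norm x)\<^sup>2" using fr'(1) by simp
  have "ori a c b = \<eta> * (2 * (norm x)\<^sup>2)" "ori a c d = - \<zeta> * (2 * (norm x)\<^sup>2)"
    by (simp_all add: fr'(2,3) b d ori_frame)
  then have "(\<eta> * \<zeta>) * (2 * (norm x)\<^sup>2)\<^sup>2 > 0" using assms by (simp add: power2_eq_square mult_ac)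
  then have "0 < \<eta> * \<zeta>" using n by (simp add: zero_less_mult_iff)
  then consider "0 < \<eta>" "0 < \<zeta>" | "0 < - \<eta>" "0 < - \<zeta>" by (auto simp: zero_less_mult_iff)
  then show ?thesis
  proof cases
    case 1
    then show ?thesis using fr' b d by blast
  next
    case 2
    then show ?thesis using fr' b d
      by (intro exI[of _ m] exI[of _ "- x"] exI[of _ "- \<beta>"] exI[of _ "- \<delta>"] exI[of _ "- \<eta>"] exI[of _ "- \<zeta>"] exI[of _ c] exI[of _ a])
        (simp add: frame_minus)
  qed
qed

lemma polygon_quadrilateral_cases:
  assumes "polygon_vertices [a, b, c, d]"
  obtains m x \<beta> \<delta> \<eta> \<zeta> a' b' c' d' where "x \<noteq> 0" "0 < \<eta>" "0 < \<zeta>"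
    "(a', b', c', d') \<in> {(a, b, c, d), (c, b, a, d), (b, c, d, a), (d, c, b, a)}"
    "a' = frame m x (-1) 0" "b' = frame m x \<beta> \<eta>" "c' = frame m x 1 0" "d' = frame m x \<delta> (-\<zeta>)"
    "polygon_region [a, b, c, d] = quad m x \<beta> \<delta> \<eta> \<zeta>"
proof -
  have "\<exists>m x \<beta> \<delta> \<eta> \<zeta> a' b' c' d'. x \<noteq> 0 \<and> 0 < \<eta> \<and> 0 < \<zeta> \<and>
    (a', b', c', d') \<in> {(a, b, c, d), (c, b, a, d), (b, c, d, a), (d, c, b, a)} \<and>
    a' = frame m x (-1) 0 \<and> b' = frame m x \<beta> \<eta> \<and> c' = frame m x 1 0 \<and> d' = frame m x \<delta> (-\<zeta>)"
    using simple_quadrilateral_diagonal[OF assms]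
  proof
    assume "ori a c b * ori a c d < 0"
    from split_quadrilateral[OF this] obtain m x \<beta> \<delta> \<eta> \<zeta> a' c' where
      *: "x \<noteq> 0" "0 < \<eta>" "0 < \<zeta>" "(a', c') \<in> {(a, c), (c, a)}"
        "a' = frame m x (-1) 0" "b = frame m x \<beta> \<eta>" "c' = frame m x 1 0" "d = frame m x \<delta> (-\<zeta>)"
      by blast
    have "(a', b, c', d) \<in> {(a, b, c, d), (c, b, a, d), (b, c, d, a), (d, c, b, a)}" using *(4) by auto
    with * show ?thesis by blast
  next
    assume "ori b d a * ori b d c < 0"
    then have "ori b d c * ori b d a < 0" by (simp add: mult.commute)
    from split_quadrilateral[OF this] obtain m x \<beta> \<delta> \<eta> \<zeta> b' d' where
      *: "x \<noteq> 0" "0 < \<eta>" "0 < \<zeta>" "(b', d') \<in> {(b, d), (d, b)}"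
        "b' = frame m x (-1) 0" "c = frame m x \<beta> \<eta>" "d' = frame m x 1 0" "a = frame m x \<delta> (-\<zeta>)"
      by blast
    have "(b', c, d', a) \<in> {(a, b, c, d), (c, b, a, d), (b, c, d, a), (d, c, b, a)}" using *(4) by auto
    with * show ?thesis by blast
  qed
  then obtain m x \<beta> \<delta> \<eta> \<zeta> a' b' c' d' where *: "x \<noteq> 0" "0 < \<eta>" "0 < \<zeta>"
    "(a', b', c', d') \<in> {(a, b, c, d), (c, b, a, d), (b, c, d, a), (d, c, b, a)}"
    "a' = frame m x (-1) 0" "b' = frame m x \<beta> \<eta>" "c' = frame m x 1 0" "d' = frame m x \<delta> (-\<zeta>)"
    by blast
  have "polygon_region [a, b, c, d] = inside (closed_segment a' b' \<union> closed_segment b' c' \<union> closed_segment c' d' \<union> closed_segment d' a')"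
    unfolding polygon_region_def path_image_quadrilateral
    using *(4) by (auto simp: closed_segment_commute intro!: arg_cong[where f=inside])
  also have "\<dots> = quad m x \<beta> \<delta> \<eta> \<zeta>" by (rule inside_quad[OF *(1,2,3,5-8)])
  finally show ?thesis using * that by blast
qed

section \<open>From a quadrilateral to the square\<close>

text \<open>The two functions are the squared lengths of two sides, or of the two half-diagonals, during a
  shear with parameter \<open>lam\<close>. They agree in the symmetric position \<open>lam = 0\<close>; if \<open>D\<close> lies between their
  initial values at \<open>lam = 1\<close>, one of them passes through \<open>D\<close>.\<close>

lemma crossing_value:
  fixes g h :: "real \<Rightarrow> real"
  assumes "continuous_on {0..1} g" "continuous_on {0..1} h" "g 0 = h 0" "(g 1 - D) * (h 1 - D) \<le> 0"
  obtains lam where "0 \<le> lam" "lam \<le> 1" "g lam = D \<or> h lam = D"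
proof -
  have *: "\<exists>lam. 0 \<le> lam \<and> lam \<le> 1 \<and> f lam = D"
    if f: "continuous_on {0..1} f" "(f 0 - D) * (f 1 - D) \<le> 0" for f :: "real \<Rightarrow> real"
  proof (cases "f 0 \<le> D")
    case True
    then have "D \<le> f 1 \<or> f 0 = D" using f(2) by (auto simp: mult_le_0_iff)
    then show ?thesis using IVT'[of f 0 D 1] True f(1) by force
  next
    case False
    then have "f 1 \<le> D" using f(2) by (auto simp: mult_le_0_iff)
    then show ?thesis using IVT2'[of f 1 D 0] False f(1) by force
  qed
  have "(g 0 - D) * (g 1 - D) \<le> 0 \<or> (h 0 - D) * (h 1 - D) \<le> 0"
    using assms(3,4) by (auto simp: mult_le_0_iff)
  then show ?thesis using *[OF assms(1)] *[OF assms(2)] that by blast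
qed

lemma measurable_quad_centre [measurable]:
  "0 < \<eta> \<Longrightarrow> 0 < \<zeta> \<Longrightarrow> quad_centre \<beta> \<delta> \<eta> \<zeta> \<in> borel_measurable borel"
  by (intro borel_measurable_continuous_onI continuous_quad_centre)

lemma measurable_quad_width [measurable]:
  "0 < \<eta> \<Longrightarrow> 0 < \<zeta> \<Longrightarrow> quad_width \<eta> \<zeta> \<in> borel_measurable borel"
  by (intro borel_measurable_continuous_onI continuous_quad_width)

lemma nn_integral_half_tent:
  fixes \<eta> :: real
  assumes "0 < \<eta>"
  shows "(\<integral>\<^sup>+t. ennreal (2 * (1 - t / \<eta>)) * indicator {0..\<eta>} t \<partial>lborel) = ennreal \<eta>"
    and "(\<integral>\<^sup>+t. ennreal (2 * (1 + t / \<eta>)) * indicator {-\<eta>..0} t \<partial>lborel) = ennreal \<eta>"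
proof -
  have "(\<integral>\<^sup>+t. ennreal (2 * (1 - t / \<eta>)) * indicator {0..\<eta>} t \<partial>lborel)
      = ennreal ((\<lambda>t. 2 * t - t\<^sup>2 / \<eta>) \<eta> - (\<lambda>t. 2 * t - t\<^sup>2 / \<eta>) 0)"
    by (rule nn_integral_FTC_Icc) (use assms in \<open>auto intro!: derivative_eq_intros simp: field_simps\<close>)
  then show "(\<integral>\<^sup>+t. ennreal (2 * (1 - t / \<eta>)) * indicator {0..\<eta>} t \<partial>lborel) = ennreal \<eta>"
    using assms by (simp add: power2_eq_square)
  have "(\<integral>\<^sup>+t. ennreal (2 * (1 + t / \<eta>)) * indicator {-\<eta>..0} t \<partial>lborel)
      = ennreal ((\<lambda>t. 2 * t + t\<^sup>2 / \<eta>) 0 - (\<lambda>t. 2 * t + t\<^sup>2 / \<eta>) (-\<eta>))"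
    by (rule nn_integral_FTC_Icc) (use assms in \<open>auto intro!: derivative_eq_intros simp: field_simps\<close>)
  then show "(\<integral>\<^sup>+t. ennreal (2 * (1 + t / \<eta>)) * indicator {-\<eta>..0} t \<partial>lborel) = ennreal \<eta>"
    using assms by (simp add: power2_eq_square)
qed

lemma measure_quad:
  assumes x: "x \<noteq> 0" and pos: "0 < \<eta>" "0 < \<zeta>"
  shows "measure lebesgue (quad m x \<beta> \<delta> \<eta> \<zeta>) = (norm x)\<^sup>2 * (\<eta> + \<zeta>)"
proof -
  have [measurable]: "quad_centre \<beta> \<delta> \<eta> \<zeta> \<in> borel_measurable borel" "quad_width \<eta> \<zeta> \<in> borel_measurable borel"
    using pos by simp_all
  have "(\<integral>\<^sup>+t. ennreal (2 * quad_width \<eta> \<zeta> t) \<partial>lborel)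
    = (\<integral>\<^sup>+t. ennreal (2 * (1 - t / \<eta>)) * indicator {0..\<eta>} t + ennreal (2 * (1 + t / \<zeta>)) * indicator {-\<zeta>..0} t \<partial>lborel)"
  proof (rule nn_integral_cong_AE)
    show "AE t in lborel. ennreal (2 * quad_width \<eta> \<zeta> t) =
      ennreal (2 * (1 - t / \<eta>)) * indicator {0..\<eta>} t + ennreal (2 * (1 + t / \<zeta>)) * indicator {-\<zeta>..0} t"
      using AE_lborel_singleton[of 0]
    proof eventually_elim
      case (elim t)
      show ?case
      proof (cases "0 < t")
        case True
        then have q: "quad_width \<eta> \<zeta> t = 1 - t / \<eta>" using quad_width_cases(1)[OF pos, of t] by simp
        show ?thesis
        proof (cases "t \<le> \<eta>")
          case True then show ?thesis using q \<open>0 < t\<close> by simp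
        next
          case False
          then have "1 - t / \<eta> \<le> 0" using pos by (simp add: le_divide_eq)
          then show ?thesis unfolding q using False \<open>0 < t\<close> by (simp add: ennreal_neg)
        qed
      next
        case False
        then have t: "t < 0" using elim by simp
        then have q: "quad_width \<eta> \<zeta> t = 1 + t / \<zeta>" using quad_width_cases(2)[OF pos, of t] by simp
        show ?thesis
        proof (cases "- \<zeta> \<le> t")
          case True then show ?thesis using q t by simp
        next
          case False
          then have "1 + t / \<zeta> \<le> 0" using pos by (simp add: divide_le_eq field_simps)
          then show ?thesis unfolding q using False t by (simp add: ennreal_neg)
        qed
      qed
    qed
  qed
  also have "\<dots> = (\<integral>\<^sup>+t. ennreal (2 * (1 - t / \<eta>)) * indicator {0..\<eta>} t \<partial>lborel)
      + (\<integral>\<^sup>+t. ennreal (2 * (1 + t / \<zeta>)) * indicator {-\<zeta>..0} t \<partial>lborel)"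
    by (rule nn_integral_add) measurable
  also have "\<dots> = ennreal \<eta> + ennreal \<zeta>"
    unfolding nn_integral_half_tent(1)[OF pos(1)] nn_integral_half_tent(2)[OF pos(2)] ..
  finally have "emeasure lebesgue (quad m x \<beta> \<delta> \<eta> \<zeta>) = ennreal ((norm x)\<^sup>2 * (\<eta> + \<zeta>))"
    unfolding quad_def using x pos by (subst emeasure_sliced) (simp_all add: ennreal_mult)
  then show ?thesis using pos by (simp add: measure_def)
qed

lemma measure_tri:
  assumes x: "x \<noteq> 0" and pos: "0 < \<eta>"
  shows "measure lebesgue (tri m x \<beta> \<eta>) = (norm x)\<^sup>2 * \<eta>"
proof -
  have "(\<integral>\<^sup>+t. ennreal (2 * (if 0 < t then 1 - t / \<eta> else 0)) \<partial>lborel)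
    = (\<integral>\<^sup>+t. ennreal (2 * (1 - t / \<eta>)) * indicator {0..\<eta>} t \<partial>lborel)"
  proof (rule nn_integral_cong_AE)
    show "AE t in lborel. ennreal (2 * (if 0 < t then 1 - t / \<eta> else 0)) =
      ennreal (2 * (1 - t / \<eta>)) * indicator {0..\<eta>} t"
      using AE_lborel_singleton[of 0]
    proof eventually_elim
      case (elim t)
      show ?case
      proof (cases "0 \<le> t \<and> \<eta> < t")
        case True
        then have "1 - t / \<eta> \<le> 0" using pos by (simp add: le_divide_eq)
        then show ?thesis using True by (simp add: ennreal_neg)
      qed (use elim in auto)
    qed
  qed
  then have int: "(\<integral>\<^sup>+t. ennreal (2 * (if 0 < t then 1 - t / \<eta> else 0)) \<partial>lborel) = ennreal \<eta>"
    unfolding nn_integral_half_tent(1)[OF pos] .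
  have "emeasure lebesgue (tri m x \<beta> \<eta>) = ennreal ((norm x)\<^sup>2) *
      (\<integral>\<^sup>+t. ennreal (2 * (if 0 < t then 1 - t / \<eta> else 0)) \<partial>lborel)"
    unfolding tri_def by (rule emeasure_sliced[OF _ _ x]) measurable
  then have "emeasure lebesgue (tri m x \<beta> \<eta>) = ennreal ((norm x)\<^sup>2 * \<eta>)"
    unfolding int using pos by (simp add: ennreal_mult)
  then show ?thesis using pos by (simp add: measure_def)
qed

text \<open>The vectors \<open>u\<close> and \<open>v\<close> are half-diagonals. In this form the two diagonals play symmetric roles.\<close>

definition parallelogram :: "real^2 \<Rightarrow> real^2 \<Rightarrow> real^2 \<Rightarrow> (real^2) set" where
  "parallelogram m u v = {m + p *\<^sub>R u + q *\<^sub>R v | p q. \<bar>p\<bar> + \<bar>q\<bar> < 1}"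

lemma parallelogram_commute: "parallelogram m u v = parallelogram m v u"
proof -
  have "parallelogram m u v \<subseteq> parallelogram m v u" for u v
    unfolding parallelogram_def
  proof clarify
    fix p q :: real assume "\<bar>p\<bar> + \<bar>q\<bar> < 1"
    then show "\<exists>p' q'. m + p *\<^sub>R u + q *\<^sub>R v = m + p' *\<^sub>R v + q' *\<^sub>R u \<and> \<bar>p'\<bar> + \<bar>q'\<bar> < 1"
      by (intro exI[of _ q] exI[of _ p]) (simp add: add_ac)
  qed
  then show ?thesis by blast
qed

lemma mem_sliced_frame: "x \<noteq> 0 \<Longrightarrow> z \<in> sliced m x c l \<longleftrightarrow> (\<exists>s t. z = frame m x s t \<and> \<bar>s - c t\<bar> < l t)"
  by (metis frame_along_across frame_in_sliced)

text \<open>Chords parallel to a diagonal: their centres depend linearly on the height, so contracting the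
  centres is a shear and the result is again a parallelogram.\<close>

lemma parallelogram_diagonal_slices:
  assumes u: "u \<noteq> 0" and "\<eta> \<noteq> 0"
  shows "parallelogram m u (\<beta> *\<^sub>R u + \<eta> *\<^sub>R rot u) = sliced m u (\<lambda>t. \<beta> * t / \<eta>) (\<lambda>t. 1 - \<bar>t / \<eta>\<bar>)"
proof (rule set_eqI)
  fix z
  have e: "m + p *\<^sub>R u + q *\<^sub>R (\<beta> *\<^sub>R u + \<eta> *\<^sub>R rot u) = frame m u (p + q * \<beta>) (q * \<eta>)" for p q
    by (simp add: frame_def algebra_simps)
  show "z \<in> parallelogram m u (\<beta> *\<^sub>R u + \<eta> *\<^sub>R rot u) \<longleftrightarrow> z \<in> sliced m u (\<lambda>t. \<beta> * t / \<eta>) (\<lambda>t. 1 - \<bar>t / \<eta>\<bar>)"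
    unfolding mem_sliced_frame[OF u] parallelogram_def e mem_Collect_eq
  proof safe
    fix p q :: real assume "\<bar>p\<bar> + \<bar>q\<bar> < 1"
    then show "\<exists>s t. frame m u (p + q * \<beta>) (q * \<eta>) = frame m u s t \<and> \<bar>s - \<beta> * t / \<eta>\<bar> < 1 - \<bar>t / \<eta>\<bar>"
      using assms by (intro exI[of _ "p + q * \<beta>"] exI[of _ "q * \<eta>"]) simp
  next
    fix s t assume "\<bar>s - \<beta> * t / \<eta>\<bar> < 1 - \<bar>t / \<eta>\<bar>"
    then show "\<exists>p q. frame m u s t = frame m u (p + q * \<beta>) (q * \<eta>) \<and> \<bar>p\<bar> + \<bar>q\<bar> < 1"
      using assms by (intro exI[of _ "s - \<beta> * t / \<eta>"] exI[of _ "t / \<eta>"]) simp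
  qed
qed

text \<open>Chords parallel to a side, with \<open>e\<close> and \<open>\<beta> e + \<eta> rot e\<close> half-sides: all chords have the same length.\<close>

lemma parallelogram_side_slices:
  assumes e: "e \<noteq> 0" and "\<eta> \<noteq> 0"
  shows "parallelogram m (e + (\<beta> *\<^sub>R e + \<eta> *\<^sub>R rot e)) (e - (\<beta> *\<^sub>R e + \<eta> *\<^sub>R rot e))
    = sliced m e (\<lambda>t. \<beta> * t / \<eta>) (\<lambda>t. if \<bar>t / \<eta>\<bar> < 1 then 1 else 0)"
proof (rule set_eqI)
  fix z
  have eq: "m + p *\<^sub>R (e + (\<beta> *\<^sub>R e + \<eta> *\<^sub>R rot e)) + q *\<^sub>R (e - (\<beta> *\<^sub>R e + \<eta> *\<^sub>R rot e))
     = frame m e (p + q + (p - q) * \<beta>) ((p - q) * \<eta>)" for p q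
    by (simp add: frame_def algebra_simps)
  show "z \<in> parallelogram m (e + (\<beta> *\<^sub>R e + \<eta> *\<^sub>R rot e)) (e - (\<beta> *\<^sub>R e + \<eta> *\<^sub>R rot e)) \<longleftrightarrow>
     z \<in> sliced m e (\<lambda>t. \<beta> * t / \<eta>) (\<lambda>t. if \<bar>t / \<eta>\<bar> < 1 then 1 else 0)"
    unfolding mem_sliced_frame[OF e] parallelogram_def eq mem_Collect_eq
  proof safe
    fix p q :: real assume "\<bar>p\<bar> + \<bar>q\<bar> < 1"
    then have "\<bar>p - q\<bar> < 1" "\<bar>p + q\<bar> < 1" by linarith+
    then show "\<exists>s t. frame m e (p + q + (p - q) * \<beta>) ((p - q) * \<eta>) = frame m e s t \<and>
        \<bar>s - \<beta> * t / \<eta>\<bar> < (if \<bar>t / \<eta>\<bar> < 1 then 1 else 0)"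
      using assms by (intro exI[of _ "p + q + (p - q) * \<beta>"] exI[of _ "(p - q) * \<eta>"]) simp
  next
    fix s t assume st: "\<bar>s - \<beta> * t / \<eta>\<bar> < (if \<bar>t / \<eta>\<bar> < 1 then 1 else 0)"
    define P Q where "P = s - \<beta> * t / \<eta>" and "Q = t / \<eta>"
    have "\<bar>P\<bar> < 1" "\<bar>Q\<bar> < 1" using st by (auto simp: P_def Q_def split: if_splits)
    moreover have "s = P + Q * \<beta>" "t = Q * \<eta>" using assms by (simp_all add: P_def Q_def)
    ultimately show "\<exists>p q. frame m e s t = frame m e (p + q + (p - q) * \<beta>) ((p - q) * \<eta>) \<and> \<bar>p\<bar> + \<bar>q\<bar> < 1"
      by (intro exI[of _ "(P + Q) / 2"] exI[of _ "(P - Q) / 2"]) (auto simp: field_simps)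
  qed
qed

lemma bounded_parallelogram: "bounded (parallelogram m u v)"
proof -
  have "norm z \<le> norm m + norm u + norm v" if "z \<in> parallelogram m u v" for z
  proof -
    from that obtain p q where z: "z = m + p *\<^sub>R u + q *\<^sub>R v" and pq: "\<bar>p\<bar> + \<bar>q\<bar> < 1"
      by (auto simp: parallelogram_def)
    have "norm z \<le> norm m + norm (p *\<^sub>R u) + norm (q *\<^sub>R v)"
      unfolding z by (intro order_trans[OF norm_triangle_ineq] add_right_mono norm_triangle_ineq)
    moreover have "norm (p *\<^sub>R u) \<le> norm u" "norm (q *\<^sub>R v) \<le> norm v"
      using pq by (auto intro!: mult_left_le_one_le)
    ultimately show ?thesis by simp
  qed
  then show ?thesis unfolding bounded_iff by blast
qed

lemma quad_width_same: "quad_width \<kappa> \<kappa> = (\<lambda>t. 1 - \<bar>t / \<kappa>\<bar>)"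
proof -
  have "min (1 - r) (1 + r) = 1 - \<bar>r\<bar>" for r :: real by (simp add: min_def abs_if)
  then show ?thesis unfolding quad_width_def[abs_def] by simp
qed

lemma rhombus_parallelogram:
  assumes x: "x \<noteq> 0" and "0 < \<kappa>"
  shows "parallelogram m x (\<kappa> *\<^sub>R rot x) = quad m x 0 0 \<kappa> \<kappa>"
proof -
  have "quad_centre 0 0 \<kappa> \<kappa> = (\<lambda>t. 0)" by (auto simp: quad_centre_def)
  then show ?thesis unfolding quad_def quad_width_same
    using parallelogram_diagonal_slices[OF x, of \<kappa> m 0] assms by simp
qed

lemma along_rot: "along m (rot x) z = across m x z" "across m (rot x) z = - along m x z"
  by (simp_all add: along_def across_def rot_rot)

text \<open>On the line at signed distance \<open>s\<close> from its axis of symmetry, the kite occupies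
  \<open>-\<zeta> (1 - \<bar>s\<bar>) < t < \<eta> (1 - \<bar>s\<bar>)\<close>. This chord is an interval too, so the kite can be symmetrized a
  second time, along its axis.\<close>

lemma kite_slices:
  assumes "x \<noteq> 0" and pos: "0 < \<eta>" "0 < \<zeta>"
  shows "quad m x 0 0 \<eta> \<zeta> = sliced m (rot x) (\<lambda>t. (\<eta> - \<zeta>) / 2 * (1 - \<bar>t\<bar>)) (\<lambda>t. (\<eta> + \<zeta>) / 2 * (1 - \<bar>t\<bar>))"
proof (rule set_eqI)
  fix z
  define s t where "s = along m x z" and "t = across m x z"
  have "z \<in> quad m x 0 0 \<eta> \<zeta> \<longleftrightarrow> \<bar>s\<bar> < 1 - t / \<eta> \<and> \<bar>s\<bar> < 1 + t / \<zeta>"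
    by (simp add: quad_def sliced_def quad_width_def quad_centre_def s_def t_def)
  also have "\<dots> \<longleftrightarrow> t < \<eta> * (1 - \<bar>s\<bar>) \<and> - t < \<zeta> * (1 - \<bar>s\<bar>)"
    using pos by (simp add: field_simps)
  also have "\<dots> \<longleftrightarrow> \<bar>t - (\<eta> - \<zeta>) / 2 * (1 - \<bar>s\<bar>)\<bar> < (\<eta> + \<zeta>) / 2 * (1 - \<bar>s\<bar>)"
    by (auto simp: abs_less_iff field_simps)
  finally show "z \<in> quad m x 0 0 \<eta> \<zeta> \<longleftrightarrow> z \<in> sliced m (rot x) (\<lambda>t. (\<eta> - \<zeta>) / 2 * (1 - \<bar>t\<bar>)) (\<lambda>t. (\<eta> + \<zeta>) / 2 * (1 - \<bar>t\<bar>))"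
    by (simp add: sliced_def along_rot s_def t_def)
qed

lemma rot_eq_0_iff [simp]: "rot x = 0 \<longleftrightarrow> x = 0"
  by (metis norm_eq_zero norm_rot)

context decreasing_kernel
begin

lemma energy_sliced_norm_cong:
  assumes "c \<in> borel_measurable borel" "l \<in> borel_measurable borel" "x \<noteq> 0" "norm x = norm y"
  shows "energy K (sliced m x c l) = energy K (sliced n y c l)"
proof -
  have "y \<noteq> 0" using assms by auto
  then show ?thesis using assms by (simp add: energy_sliced)
qed

lemma energy_quad_norm_cong:
  assumes "x \<noteq> 0" "0 < \<eta>" "0 < \<zeta>" "norm x = norm y"
  shows "energy K (quad m x \<beta> \<delta> \<eta> \<zeta>) = energy K (quad n y \<beta> \<delta> \<eta> \<zeta>)"
  unfolding quad_def using assms by (intro energy_sliced_norm_cong) auto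

lemma energy_quad_le_kite:
  assumes x: "x \<noteq> 0" and pos: "0 < \<eta>" "0 < \<zeta>"
  shows "energy K (quad m x \<beta> \<delta> \<eta> \<zeta>) \<le> energy K (quad m x 0 0 \<eta> \<zeta>)"
    and "\<beta> \<noteq> 0 \<or> \<delta> \<noteq> 0 \<Longrightarrow> energy K (quad m x \<beta> \<delta> \<eta> \<zeta>) < energy K (quad m x 0 0 \<eta> \<zeta>)"
proof -
  have "(\<lambda>t. 0 * quad_centre \<beta> \<delta> \<eta> \<zeta> t) = quad_centre 0 0 \<eta> \<zeta>" by (auto simp: quad_centre_def)
  note contract = energy_sliced_contract[OF continuous_quad_centre[OF pos] measurable_quad_width[OF pos] x
      bounded_quad[OF x pos, of m \<beta> \<delta>, unfolded quad_def], of 0, unfolded this, folded quad_def]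
  show "energy K (quad m x \<beta> \<delta> \<eta> \<zeta>) \<le> energy K (quad m x 0 0 \<eta> \<zeta>)"
    using contract(1) by simp
  assume "\<beta> \<noteq> 0 \<or> \<delta> \<noteq> 0"
  then show "energy K (quad m x \<beta> \<delta> \<eta> \<zeta>) < energy K (quad m x 0 0 \<eta> \<zeta>)"
  proof
    assume "\<beta> \<noteq> 0"
    then show ?thesis
      using pos by (intro contract(2)[of "{0<..<\<eta>}" "\<eta>/3" "\<eta>/2"])
        (auto simp: quad_centre_cases quad_width_cases)
  next
    assume "\<delta> \<noteq> 0"
    then show ?thesis
      using pos by (intro contract(2)[of "{-\<zeta><..<0}" "-\<zeta>/3" "-\<zeta>/2"])
        (auto simp: quad_centre_cases quad_width_cases field_simps)
  qed
qed

lemma energy_kite_le_rhombus: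
  assumes x: "x \<noteq> 0" and pos: "0 < \<eta>" "0 < \<zeta>"
  defines "\<kappa> \<equiv> (\<eta> + \<zeta>) / 2"
  shows "energy K (quad m x 0 0 \<eta> \<zeta>) \<le> energy K (quad m x 0 0 \<kappa> \<kappa>)"
    and "\<eta> \<noteq> \<zeta> \<Longrightarrow> energy K (quad m x 0 0 \<eta> \<zeta>) < energy K (quad m x 0 0 \<kappa> \<kappa>)"
proof -
  have \<kappa>: "0 < \<kappa>" using pos by (simp add: \<kappa>_def)
  let ?c = "\<lambda>t::real. (\<eta> - \<zeta>) / 2 * (1 - \<bar>t\<bar>)" and ?l = "\<lambda>t::real. (\<eta> + \<zeta>) / 2 * (1 - \<bar>t\<bar>)"
  have kite: "quad m x 0 0 \<eta> \<zeta> = sliced m (rot x) ?c ?l" by (rule kite_slices[OF x pos])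
  have rhombus: "quad m x 0 0 \<kappa> \<kappa> = sliced m (rot x) (\<lambda>t. 0 * ?c t) ?l"
    using kite_slices[OF x \<kappa> \<kappa>] by (simp add: \<kappa>_def)
  have c: "continuous_on UNIV ?c" and l: "?l \<in> borel_measurable borel"
    by (intro continuous_intros, measurable)
  have r: "rot x \<noteq> 0" using x by simp
  note contract = energy_sliced_contract[OF c l r bounded_quad[OF x pos, of m 0 0, unfolded kite], of 0, folded kite rhombus]
  show "energy K (quad m x 0 0 \<eta> \<zeta>) \<le> energy K (quad m x 0 0 \<kappa> \<kappa>)" using contract(1) by simp
  show "energy K (quad m x 0 0 \<eta> \<zeta>) < energy K (quad m x 0 0 \<kappa> \<kappa>)" if "\<eta> \<noteq> \<zeta>"
    using that pos by (intro contract(2)[of "{-1<..<1}" 0 "1/2"]) auto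
qed

lemma energy_parallelogram_diagonal_shear:
  assumes u: "u \<noteq> 0" and \<eta>: "\<eta> \<noteq> 0"
  shows "energy K (parallelogram m u (\<beta> *\<^sub>R u + \<eta> *\<^sub>R rot u)) \<le> energy K (quad m u 0 0 \<bar>\<eta>\<bar> \<bar>\<eta>\<bar>)"
proof -
  let ?c = "\<lambda>t. \<beta> * t / \<eta>" and ?l = "\<lambda>t. 1 - \<bar>t / \<eta>\<bar>"
  have c: "continuous_on UNIV ?c" and l: "?l \<in> borel_measurable borel"
    using \<eta> by (intro continuous_intros, simp, measurable)
  note eq = parallelogram_diagonal_slices[OF u \<eta>]
  have "quad m u 0 0 \<bar>\<eta>\<bar> \<bar>\<eta>\<bar> = sliced m u (\<lambda>t. 0 * ?c t) ?l"
  proof -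
    have "quad_width \<bar>\<eta>\<bar> \<bar>\<eta>\<bar> = ?l" unfolding quad_width_same by (simp add: abs_divide)
    moreover have "quad_centre 0 0 \<bar>\<eta>\<bar> \<bar>\<eta>\<bar> = (\<lambda>t. 0 * ?c t)" by (auto simp: quad_centre_def)
    ultimately show ?thesis by (simp add: quad_def)
  qed
  then show ?thesis
    using energy_sliced_contract(1)[OF c l u bounded_parallelogram[of m u "\<beta> *\<^sub>R u + \<eta> *\<^sub>R rot u", unfolded eq], of 0]
    by (simp add: eq)
qed

text \<open>The vectors \<open>e\<close> and \<open>f b\<close> are half-sides; \<open>b = 0\<close> is the rectangle on the side \<open>e\<close>.\<close>

lemma energy_parallelogram_side_shear:
  assumes e: "e \<noteq> 0" and \<eta>: "\<eta> \<noteq> 0" and lam: "0 \<le> lam" "lam < 1" and \<beta>: "\<beta> \<noteq> 0"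
  defines "f \<equiv> \<lambda>b. (b * \<beta>) *\<^sub>R e + \<eta> *\<^sub>R rot e"
  shows "energy K (parallelogram m (e + f 1) (e - f 1)) < energy K (parallelogram m (e + f lam) (e - f lam))"
proof -
  let ?c = "\<lambda>t. \<beta> * t / \<eta>" and ?l = "\<lambda>t. if \<bar>t / \<eta>\<bar> < 1 then 1 else 0 :: real"
  have eq: "parallelogram m (e + f b) (e - f b) = sliced m e (\<lambda>t. b * ?c t) ?l" for b
    unfolding f_def using parallelogram_side_slices[OF e \<eta>, of m "b * \<beta>"] by (simp add: mult.assoc)
  have c: "continuous_on UNIV ?c" and l: "?l \<in> borel_measurable borel"
    using \<eta> by (intro continuous_intros, simp, measurable)
  have bdd: "bounded (sliced m e ?c ?l)"
    using bounded_parallelogram[of m "e + f 1" "e - f 1"] unfolding eq by simp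
  have "energy K (sliced m e ?c ?l) < energy K (sliced m e (\<lambda>t. lam * ?c t) ?l)"
    using \<eta> \<beta>
    by (intro energy_sliced_contract(2)[OF c l e bdd lam, of "{-\<bar>\<eta>\<bar><..<\<bar>\<eta>\<bar>}" 0 "\<eta>/2"])
      (auto simp: abs_divide divide_less_eq)
  then show ?thesis unfolding eq by simp
qed

text \<open>The half-diagonals \<open>x\<close> and \<open>\<kappa> rot x\<close> have squared lengths \<open>N\<close> and \<open>\<kappa>\<^sup>2 N\<close>, with geometric mean \<open>D\<close>, the
  squared half-diagonal of the square of equal area. As \<open>\<kappa> \<noteq> 1\<close>, the value \<open>D\<close> lies strictly
  between them. Shearing along the side \<open>e\<close> makes the half-diagonals equal in the end, so one of
  them takes the value \<open>D\<close> at a parameter \<open>lam < 1\<close>, and the shear has strictly increased the energy. A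
  second shear, along the diagonal of the right length, then produces the square.\<close>

lemma energy_rhombus_less_square:
  assumes x: "x \<noteq> 0" and \<kappa>: "0 < \<kappa>" "\<kappa> \<noteq> 1" and D: "\<kappa> * (norm x)\<^sup>2 = D" and y: "(norm y)\<^sup>2 = D"
  shows "energy K (quad m x 0 0 \<kappa> \<kappa>) < energy K (quad n y 0 0 1 1)"
proof -
  define N where "N = (norm x)\<^sup>2"
  have N: "0 < N" using x by (simp add: N_def)
  have D0: "0 < D" using D \<kappa>(1) x by (metis mult_pos_pos zero_less_norm_iff zero_less_power)
  define e where "e = (1/2) *\<^sub>R (x + \<kappa> *\<^sub>R rot x)"
  define f where "f = (1/2) *\<^sub>R (x - \<kappa> *\<^sub>R rot x)"
  have Ne: "(norm e)\<^sup>2 = (1 + \<kappa>\<^sup>2) * N / 4"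
    unfolding e_def N_def norm_plane by (simp add: power2_eq_square field_simps)
  have e: "e \<noteq> 0" using Ne N by (auto simp: add_nonneg_eq_0_iff)
  define \<beta> \<eta> where "\<beta> = along 0 e f" and "\<eta> = across 0 e f"
  have f: "f = \<beta> *\<^sub>R e + \<eta> *\<^sub>R rot e"
    using frame_along_across[OF e, of 0 f] by (simp add: frame_def \<beta>_def \<eta>_def)
  have "f \<bullet> e = (1 - \<kappa>\<^sup>2) * N / 4" "f \<bullet> rot e = - \<kappa> * N / 2"
    unfolding e_def f_def N_def norm_plane inner_plane by (simp_all add: power2_eq_square field_simps)
  then have \<beta>N: "\<beta> * (norm e)\<^sup>2 = (1 - \<kappa>\<^sup>2) * N / 4" and \<eta>N: "\<eta> * (norm e)\<^sup>2 = - \<kappa> * N / 2"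
    using e by (simp_all add: \<beta>_def \<eta>_def along_def across_def)
  have "\<kappa>\<^sup>2 \<noteq> 1" using \<kappa> by (simp add: power2_eq_1_iff)
  then have \<beta>: "\<beta> \<noteq> 0" using \<beta>N N by auto
  have \<eta>: "\<eta> \<noteq> 0" using \<eta>N N \<kappa> by auto
  define w where "w b = (b * \<beta>) *\<^sub>R e + \<eta> *\<^sub>R rot e" for b
  have w1: "e + w 1 = x" "e - w 1 = \<kappa> *\<^sub>R rot x"
    by (simp_all add: w_def f[symmetric]) (simp_all add: e_def f_def algebra_simps flip: scaleR_add_left)
  define g h where "g b = (norm (e + w b))\<^sup>2" and "h b = (norm (e - w b))\<^sup>2" for b
  have g1: "g 1 = N" and h1: "h 1 = \<kappa>\<^sup>2 * N"
    unfolding g_def h_def w1 by (simp_all add: N_def power_mult_distrib)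
  have DN: "D = \<kappa> * N" using D by (simp add: N_def)
  have "(g 1 - D) * (h 1 - D) = - (\<kappa> * N\<^sup>2 * (1 - \<kappa>)\<^sup>2)"
    unfolding g1 h1 DN by algebra
  then have cross: "(g 1 - D) * (h 1 - D) < 0" using N \<kappa> by simp
  have gh0: "g 0 = h 0" unfolding g_def h_def w_def norm_plane by (simp add: power2_eq_square algebra_simps)
  have "continuous_on {0..1} g" "continuous_on {0..1} h"
    unfolding g_def h_def w_def by (intro continuous_intros)+
  from crossing_value[OF this gh0 less_imp_le[OF cross]]
  obtain lam where lam: "0 \<le> lam" "lam \<le> 1" "g lam = D \<or> h lam = D" by blast
  have "lam \<noteq> 1" using lam(3) cross by auto
  then have "lam < 1" using lam by simp
  from energy_parallelogram_side_shear[OF e \<eta> lam(1) this \<beta>, of m, folded w_def]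
  have less: "energy K (quad m x 0 0 \<kappa> \<kappa>) < energy K (parallelogram m (e + w lam) (e - w lam))"
    unfolding w1 rhombus_parallelogram[OF x \<kappa>(1)] .
  \<comment> \<open>The shear along the diagonal \<open>u\<close>: as the area is that of the square, the height \<open>t\<close> is \<open>1\<close> or \<open>-1\<close>.\<close>
  have final: "energy K (parallelogram m u v) \<le> energy K (quad n y 0 0 1 1)"
    if u: "(norm u)\<^sup>2 = D" and uv: "\<bar>v \<bullet> rot u\<bar> = D" for u v
  proof -
    have u0: "u \<noteq> 0" using u D0 by auto
    define b t where "b = along 0 u v" and "t = across 0 u v"
    have v: "v = b *\<^sub>R u + t *\<^sub>R rot u"
      using frame_along_across[OF u0, of 0 v] by (simp add: frame_def b_def t_def)
    have t: "\<bar>t\<bar> = 1" using uv D0 by (simp add: t_def across_def u abs_divide)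
    have "energy K (parallelogram m u v) \<le> energy K (quad m u 0 0 \<bar>t\<bar> \<bar>t\<bar>)"
      unfolding v by (rule energy_parallelogram_diagonal_shear[OF u0]) (use t in auto)
    also have "\<dots> = energy K (quad n y 0 0 1 1)"
      unfolding t using u0 power2_eq_imp_eq[of "norm u" "norm y"] u y by (intro energy_quad_norm_cong) auto
    finally show ?thesis .
  qed
  have "(e - w b) \<bullet> rot (e + w b) = - 2 * (\<eta> * (norm e)\<^sup>2)" for b
    unfolding norm_plane inner_plane w_def by (simp add: power2_eq_square algebra_simps)
  then have c1: "(e - w b) \<bullet> rot (e + w b) = D" for b unfolding \<eta>N DN by simp
  have "(e + w b) \<bullet> rot (e - w b) = - ((e - w b) \<bullet> rot (e + w b))" for b
    unfolding inner_plane by (simp add: algebra_simps)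
  then have c2: "(e + w b) \<bullet> rot (e - w b) = - D" for b unfolding c1 .
  have "energy K (parallelogram m (e + w lam) (e - w lam)) \<le> energy K (quad n y 0 0 1 1)"
    using lam(3)
  proof
    assume "g lam = D"
    then show ?thesis using final[of "e + w lam" "e - w lam"] c1 D0 by (simp add: g_def)
  next
    assume "h lam = D"
    then show ?thesis using final[of "e - w lam" "e + w lam"] c2 D0
      by (simp add: h_def parallelogram_commute[of m "e + w lam"])
  qed
  with less show ?thesis by simp
qed

text \<open>The chain is quadrilateral, kite, rhombus, square. The first step is strict unless
  \<open>\<beta> = \<delta> = 0\<close>, the second unless \<open>\<eta> = \<zeta>\<close>, the third unless \<open>\<kappa> = 1\<close>.\<close>

lemma energy_quad_less_square:
  assumes x: "x \<noteq> 0" and pos: "0 < \<eta>" "0 < \<zeta>" and D: "(norm x)\<^sup>2 * (\<eta> + \<zeta>) = 2 * (norm y)\<^sup>2"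
    and ne: "\<not> (\<beta> = 0 \<and> \<delta> = 0 \<and> \<eta> = 1 \<and> \<zeta> = 1)"
  shows "energy K (quad m x \<beta> \<delta> \<eta> \<zeta>) < energy K (quad n y 0 0 1 1)"
proof -
  define \<kappa> where "\<kappa> = (\<eta> + \<zeta>) / 2"
  have \<kappa>: "0 < \<kappa>" using pos by (simp add: \<kappa>_def)
  have D': "\<kappa> * (norm x)\<^sup>2 = (norm y)\<^sup>2" using D by (simp add: \<kappa>_def mult.commute)
  have last: "energy K (quad m x 0 0 \<kappa> \<kappa>) \<le> energy K (quad n y 0 0 1 1)"
  proof (cases "\<kappa> = 1")
    case True
    then have "(norm x)\<^sup>2 = (norm y)\<^sup>2" using D' by simp
    then have "norm x = norm y" by (rule power2_eq_imp_eq) auto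
    then show ?thesis unfolding True
      using energy_quad_norm_cong[OF x zero_less_one zero_less_one, of y m 0 0 n] by simp
  next
    case False
    then show ?thesis using energy_rhombus_less_square[OF x \<kappa> False D' refl] by (simp add: less_imp_le)
  qed
  note s1 = energy_quad_le_kite[OF x pos, where m=m and \<beta>=\<beta> and \<delta>=\<delta>] and s2 = energy_kite_le_rhombus[OF x pos, where m=m, folded \<kappa>_def]
  consider "\<beta> \<noteq> 0 \<or> \<delta> \<noteq> 0" | "\<eta> \<noteq> \<zeta>" | "\<eta> = \<zeta>" "\<kappa> \<noteq> 1" using ne by (force simp: \<kappa>_def)
  then show ?thesis
  proof cases
    case 1 then show ?thesis using s1(2) s2(1) last by (meson less_le_trans)
  next
    case 2 then show ?thesis using s1(1) s2(2) last by (meson less_le_trans le_less_trans)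
  next
    case 3 then show ?thesis using s1(1) s2(1) energy_rhombus_less_square[OF x \<kappa> 3(2) D' refl]
      by (meson le_less_trans)
  qed
qed

end

section \<open>From a triangle to the equilateral triangle\<close>

text \<open>Unlike \<open>tri\<close>, this form is visibly invariant under permutations of the vertices, so any side can be
  taken as the base of the next symmetrization.\<close>

definition triangle_inside :: "real^2 \<Rightarrow> real^2 \<Rightarrow> real^2 \<Rightarrow> (real^2) set" where
  "triangle_inside a b c = inside (closed_segment a b \<union> closed_segment b c \<union> closed_segment c a)"

lemma triangle_inside_permute:
  "triangle_inside b a c = triangle_inside a b c" "triangle_inside a c b = triangle_inside a b c"
  by (simp_all add: triangle_inside_def closed_segment_commute Un_ac)

lemma ori_permute: "ori b a c = - ori a b c" "ori a c b = - ori a b c"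
  by (simp_all add: ori_def algebra_simps)

lemma triangle_frame:
  assumes "ori a b c \<noteq> 0"
  obtains m x \<beta> \<eta> where "x \<noteq> 0" "\<eta> \<noteq> 0" "a = frame m x (-1) 0" "b = frame m x 1 0" "c = frame m x \<beta> \<eta>"
proof -
  have "a \<noteq> b" using assms by (auto simp: ori_def)
  note fr = frame_of_diagonal[OF this]
  define m x where "m = (1/2) *\<^sub>R (a + b)" and "x = (1/2) *\<^sub>R (b - a)"
  note fr = fr[folded m_def x_def]
  obtain \<beta> \<eta> where c: "c = frame m x \<beta> \<eta>" using frame_along_across[OF fr(1)] by metis
  have "ori a b c = 2 * \<eta> * (norm x)\<^sup>2" unfolding fr(2,3) c by (rule ori_frame)
  then have "\<eta> \<noteq> 0" using assms by auto
  then show ?thesis using that fr c by blast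
qed

lemma frame_diff_sq: "(norm (frame m x s t - frame m x s' t'))\<^sup>2 = (norm x)\<^sup>2 * ((s - s')\<^sup>2 + (t - t')\<^sup>2)"
  by (simp add: frame_diff power_mult_distrib)

context decreasing_kernel
begin

lemma energy_tri_norm_cong:
  assumes "x \<noteq> 0" "norm x = norm y"
  shows "energy K (tri m x \<beta> \<eta>) = energy K (tri n y \<beta> \<eta>)"
  unfolding tri_def using assms by (intro energy_sliced_norm_cong) measurable

lemma energy_tri_slide:
  assumes x: "x \<noteq> 0" and \<eta>: "0 < \<eta>" and lam: "0 \<le> lam" "lam < 1"
  shows "energy K (tri m x \<beta> \<eta>) \<le> energy K (tri m x (lam * \<beta>) \<eta>)"
    and "\<beta> \<noteq> 0 \<Longrightarrow> energy K (tri m x \<beta> \<eta>) < energy K (tri m x (lam * \<beta>) \<eta>)"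
proof -
  let ?c = "\<lambda>t. \<beta> * t / \<eta>" and ?l = "\<lambda>t. if 0 < t then 1 - t / \<eta> else 0"
  have c: "continuous_on UNIV ?c" and l: "?l \<in> borel_measurable borel"
    using \<eta> by (intro continuous_intros, simp, measurable)
  have slid: "tri m x (lam * \<beta>) \<eta> = sliced m x (\<lambda>t. lam * ?c t) ?l"
    by (simp add: tri_def mult.assoc)
  note contract = energy_sliced_contract[OF c l x bounded_tri[OF x \<eta>, of m \<beta>, unfolded tri_def] lam,
      folded slid tri_def]
  show "energy K (tri m x \<beta> \<eta>) \<le> energy K (tri m x (lam * \<beta>) \<eta>)" by (rule contract(1))
  show "energy K (tri m x \<beta> \<eta>) < energy K (tri m x (lam * \<beta>) \<eta>)" if "\<beta> \<noteq> 0"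
    using \<eta> that by (intro contract(2)[of "{0<..<\<eta>}" "\<eta>/3" "\<eta>/2"]) auto
qed

text \<open>The sign of \<open>\<eta>\<close> is left open, since passing to another base may reverse the orientation;
  for a negative sign the frame is turned around.\<close>

lemma energy_triangle_slide:
  fixes m x :: "real^2"
  assumes x: "x \<noteq> 0" and \<eta>: "\<eta> \<noteq> 0" and lam: "0 \<le> lam" "lam < 1"
  defines "T \<equiv> \<lambda>\<beta>. triangle_inside (frame m x (-1) 0) (frame m x 1 0) (frame m x \<beta> \<eta>)"
  shows "energy K (T \<beta>) \<le> energy K (T (lam * \<beta>))"
    and "\<beta> \<noteq> 0 \<Longrightarrow> energy K (T \<beta>) < energy K (T (lam * \<beta>))"
proof -
  define k :: real where "k = sgn \<eta>"
  have T: "T \<beta> = tri m (k *\<^sub>R x) (k * \<beta>) \<bar>\<eta>\<bar>" for \<beta>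
  proof (cases "0 < \<eta>")
    case True
    then show ?thesis using inside_tri[OF x True refl refl refl] by (simp add: T_def triangle_inside_def k_def)
  next
    case False
    then have n: "0 < - \<eta>" using \<eta> by simp
    have "T \<beta> = triangle_inside (frame m (-x) (-1) 0) (frame m (-x) 1 0) (frame m (-x) (-\<beta>) (-\<eta>))"
      unfolding T_def by (simp add: frame_minus triangle_inside_permute)
    also have "\<dots> = tri m (-x) (-\<beta>) (-\<eta>)"
      unfolding triangle_inside_def using x n by (intro inside_tri) auto
    finally show ?thesis using n by (simp add: k_def)
  qed
  have k: "k \<noteq> 0" "k *\<^sub>R x \<noteq> 0" "0 < \<bar>\<eta>\<bar>" using x \<eta> by (auto simp: k_def sgn_0_0)
  have kl: "k * (lam * \<beta>) = lam * (k * \<beta>)" by simp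
  show "energy K (T \<beta>) \<le> energy K (T (lam * \<beta>))"
    unfolding T kl by (rule energy_tri_slide(1)[OF k(2,3) lam])
  show "energy K (T \<beta>) < energy K (T (lam * \<beta>))" if "\<beta> \<noteq> 0"
    unfolding T kl by (rule energy_tri_slide(2)[OF k(2,3) lam]) (use that k(1) in simp)
qed

text \<open>Full symmetrization along the side \<open>a b\<close>. The apex keeps its height \<open>\<bar>ori a b c\<bar> / norm (b - a)\<close>, so
  Pythagoras gives the length of the legs.\<close>

lemma energy_triangle_isosceles:
  assumes o: "ori a b c \<noteq> 0"
  obtains c' where "ori a b c' = ori a b c"
    "energy K (triangle_inside a b c) \<le> energy K (triangle_inside a b c')"
    "norm (c - a) \<noteq> norm (c - b) \<Longrightarrow> energy K (triangle_inside a b c) < energy K (triangle_inside a b c')"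
    "(norm (c' - a))\<^sup>2 = (norm (b - a))\<^sup>2 / 4 + (ori a b c)\<^sup>2 / (norm (b - a))\<^sup>2"
    "norm (c' - b) = norm (c' - a)"
proof -
  obtain m x \<beta> \<eta> where x: "x \<noteq> 0" "\<eta> \<noteq> 0" and abc: "a = frame m x (-1) 0" "b = frame m x 1 0" "c = frame m x \<beta> \<eta>"
    using triangle_frame[OF o] by metis
  have ba: "(norm (b - a))\<^sup>2 = 4 * (norm x)\<^sup>2" unfolding abc frame_diff_sq by simp
  show ?thesis
  proof (rule that[of "frame m x (0 * \<beta>) \<eta>"])
    show "ori a b (frame m x (0 * \<beta>) \<eta>) = ori a b c" unfolding abc ori_frame ..
    show "energy K (triangle_inside a b c) \<le> energy K (triangle_inside a b (frame m x (0 * \<beta>) \<eta>))"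
      unfolding abc by (rule energy_triangle_slide(1)[OF x]) auto
    show "energy K (triangle_inside a b c) < energy K (triangle_inside a b (frame m x (0 * \<beta>) \<eta>))"
      if "norm (c - a) \<noteq> norm (c - b)"
      unfolding abc
    proof (rule energy_triangle_slide(2)[OF x])
      show "\<beta> \<noteq> 0" using that unfolding abc frame_diff by auto
    qed auto
    show "(norm (frame m x (0 * \<beta>) \<eta> - a))\<^sup>2 = (norm (b - a))\<^sup>2 / 4 + (ori a b c)\<^sup>2 / (norm (b - a))\<^sup>2"
      unfolding ba unfolding abc frame_diff_sq ori_frame using x(1)
      by (simp add: field_simps power2_eq_square)
    show "norm (frame m x (0 * \<beta>) \<eta> - b) = norm (frame m x (0 * \<beta>) \<eta> - a)"
      unfolding abc frame_diff by simp
  qed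
qed

text \<open>Partial symmetrization, stopped when one of the two sides at the apex reaches squared length \<open>\<sigma>\<close>.\<close>

lemma energy_triangle_reach_side:
  assumes o: "ori a b c \<noteq> 0" and \<sigma>: "((norm (c - a))\<^sup>2 - \<sigma>) * ((norm (c - b))\<^sup>2 - \<sigma>) \<le> 0"
  obtains c' where "ori a b c' = ori a b c"
    "energy K (triangle_inside a b c) \<le> energy K (triangle_inside a b c')"
    "(norm (c' - a))\<^sup>2 = \<sigma> \<or> (norm (c' - b))\<^sup>2 = \<sigma>"
proof -
  obtain m x \<beta> \<eta> where x: "x \<noteq> 0" "\<eta> \<noteq> 0" and abc: "a = frame m x (-1) 0" "b = frame m x 1 0" "c = frame m x \<beta> \<eta>"
    using triangle_frame[OF o] by metis
  define g h where "g l = (norm (frame m x (l * \<beta>) \<eta> - a))\<^sup>2" and "h l = (norm (frame m x (l * \<beta>) \<eta> - b))\<^sup>2" for l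
  have "continuous_on {0..1} g" "continuous_on {0..1} h"
    unfolding g_def h_def by (intro continuous_intros)+
  moreover have "g 0 = h 0" by (simp add: g_def h_def abc frame_diff_sq)
  moreover have "(g 1 - \<sigma>) * (h 1 - \<sigma>) \<le> 0" using \<sigma> by (simp add: g_def h_def abc(3))
  ultimately obtain lam where lam: "0 \<le> lam" "lam \<le> 1" "g lam = \<sigma> \<or> h lam = \<sigma>"
    by (rule crossing_value)
  show ?thesis
  proof (rule that[of "frame m x (lam * \<beta>) \<eta>"])
    show "ori a b (frame m x (lam * \<beta>) \<eta>) = ori a b c" unfolding abc ori_frame ..
    show "energy K (triangle_inside a b c) \<le> energy K (triangle_inside a b (frame m x (lam * \<beta>) \<eta>))"
    proof (cases "lam = 1")
      case True then show ?thesis by (simp add: abc)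
    next
      case False
      then show ?thesis unfolding abc using lam by (intro energy_triangle_slide(1)[OF x]) auto
    qed
    show "(norm (frame m x (lam * \<beta>) \<eta> - a))\<^sup>2 = \<sigma> \<or> (norm (frame m x (lam * \<beta>) \<eta> - b))\<^sup>2 = \<sigma>"
      using lam(3) by (simp add: g_def h_def)
  qed
qed

text \<open>The area fixes the height over the base \<open>a b\<close> to that of the equilateral triangle.\<close>

lemma energy_triangle_le_equal_side:
  assumes o: "\<bar>ori a b c\<bar> = sqrt 3 / 2 * (norm (b - a))\<^sup>2" and y: "2 * norm y = norm (b - a)" "y \<noteq> 0"
  shows "energy K (triangle_inside a b c) \<le> energy K (tri n y 0 (sqrt 3))"
proof -
  have o0: "ori a b c \<noteq> 0" using o y by auto
  obtain m x \<beta> \<eta> where x: "x \<noteq> 0" "\<eta> \<noteq> 0" and abc: "a = frame m x (-1) 0" "b = frame m x 1 0" "c = frame m x \<beta> \<eta>"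
    using triangle_frame[OF o0] by metis
  have "(norm (b - a))\<^sup>2 = (2 * norm x)\<^sup>2" unfolding abc frame_diff_sq by (simp add: power_mult_distrib)
  then have ba: "norm (b - a) = 2 * norm x" by (rule power2_eq_imp_eq) auto
  have \<eta>: "\<bar>\<eta>\<bar> = sqrt 3"
  proof -
    have "\<bar>ori a b c\<bar> = 2 * \<bar>\<eta>\<bar> * (norm x)\<^sup>2" unfolding abc ori_frame by (simp add: abs_mult)
    then have "2 * \<bar>\<eta>\<bar> * (norm x)\<^sup>2 = sqrt 3 / 2 * (2 * norm x)\<^sup>2" unfolding o ba ..
    also have "\<dots> = 2 * sqrt 3 * (norm x)\<^sup>2" by (simp add: power_mult_distrib)
    finally have "2 * (norm x)\<^sup>2 * \<bar>\<eta>\<bar> = 2 * (norm x)\<^sup>2 * sqrt 3" by (simp only: mult_ac)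
    moreover have "2 * (norm x)\<^sup>2 \<noteq> 0" using x(1) by simp
    ultimately show ?thesis using mult_left_cancel by blast
  qed
  have "energy K (triangle_inside a b c) \<le> energy K (triangle_inside a b (frame m x (0 * \<beta>) \<eta>))"
    unfolding abc by (rule energy_triangle_slide(1)[OF x]) auto
  also have "triangle_inside a b (frame m x (0 * \<beta>) \<eta>) = tri m (sgn \<eta> *\<^sub>R x) 0 (sqrt 3)"
  proof (cases "0 < \<eta>")
    case True
    then have e: "\<eta> = sqrt 3" using \<eta> by simp
    show ?thesis unfolding triangle_inside_def
      using x by (subst inside_tri[where m=m and x=x and \<beta>=0 and \<eta>=\<eta>]) (simp_all add: abc e)
  next
    case False
    then have e: "\<eta> = - sqrt 3" using \<eta> by simp
    have "triangle_inside a b (frame m x (0 * \<beta>) \<eta>) = triangle_inside b a (frame m x (0 * \<beta>) \<eta>)"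
      by (simp add: triangle_inside_permute)
    also have "\<dots> = tri m (-x) 0 (sqrt 3)"
      unfolding triangle_inside_def using x
      by (intro inside_tri) (simp_all add: abc e frame_minus)
    finally show ?thesis by (simp add: e sgn_minus)
  qed
  also have "energy K (tri m (sgn \<eta> *\<^sub>R x) 0 (sqrt 3)) = energy K (tri n y 0 (sqrt 3))"
    using x y ba by (intro energy_tri_norm_cong) (auto simp: abs_sgn_eq sgn_0_0)
  finally show ?thesis .
qed

text \<open>With \<open>p\<close> the squared base, the squared leg \<open>l\<close> after symmetrization satisfies
  \<open>4 p (l - \<sigma>) = (\<sigma> - p) (3 \<sigma> - p)\<close>, so it is at least \<open>\<sigma>\<close>. Now one side is at most and another at least
  \<open>\<sigma>\<close>, and the apex \<open>b\<close> over the remaining side can be slid until a side of squared length \<open>\<sigma>\<close> appears.\<close>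

lemma energy_triangle_le_short_side:
  assumes o: "\<bar>ori a b c\<bar> = sqrt 3 / 2 * \<sigma>" and y: "4 * (norm y)\<^sup>2 = \<sigma>" "y \<noteq> 0"
    and short: "(norm (b - a))\<^sup>2 \<le> \<sigma>"
  shows "energy K (triangle_inside a b c) \<le> energy K (tri n y 0 (sqrt 3))"
proof -
  have \<sigma>: "0 < \<sigma>" using y by (auto simp flip: y(1))
  have o0: "ori a b c \<noteq> 0" using o \<sigma> by auto
  have ab: "a \<noteq> b" using o0 by (auto simp: ori_def)
  have side: "2 * norm y = r" if "r\<^sup>2 = \<sigma>" "0 \<le> r" for r
    by (rule power2_eq_imp_eq) (use y that in \<open>auto simp: power_mult_distrib\<close>)
  obtain c' where c': "ori a b c' = ori a b c"
    "energy K (triangle_inside a b c) \<le> energy K (triangle_inside a b c')"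
    "(norm (c' - a))\<^sup>2 = (norm (b - a))\<^sup>2 / 4 + (ori a b c)\<^sup>2 / (norm (b - a))\<^sup>2"
    "norm (c' - b) = norm (c' - a)"
    using energy_triangle_isosceles[OF o0] by metis
  define p where "p = (norm (b - a))\<^sup>2"
  have p: "0 < p" "p \<le> \<sigma>" using ab short by (auto simp: p_def)
  have o2: "(ori a b c)\<^sup>2 = 3 / 4 * \<sigma>\<^sup>2"
    by (subst power2_abs[symmetric]) (simp add: o power_mult_distrib power_divide)
  have leg: "\<sigma> \<le> (norm (c' - a))\<^sup>2"
  proof -
    have "0 \<le> (\<sigma> - p) * (3 * \<sigma> - p)" using p \<sigma> by simp
    then have "4 * p * \<sigma> \<le> p\<^sup>2 + 3 * \<sigma>\<^sup>2" by (simp add: power2_eq_square algebra_simps)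
    then show ?thesis unfolding c'(3) p_def[symmetric] o2 using p by (simp add: field_simps power2_eq_square)
  qed
  have bc': "norm (b - c') = norm (c' - a)" using c'(4) by (metis norm_minus_commute)
  have "((norm (b - a))\<^sup>2 - \<sigma>) * ((norm (b - c'))\<^sup>2 - \<sigma>) \<le> 0"
    unfolding bc' by (rule mult_nonpos_nonneg) (use short leg in auto)
  moreover have "ori a c' b \<noteq> 0" using c'(1) o0 ori_permute(2)[of a b c'] by simp
  ultimately obtain b' where b': "ori a c' b' = ori a c' b"
    "energy K (triangle_inside a c' b) \<le> energy K (triangle_inside a c' b')"
    "(norm (b' - a))\<^sup>2 = \<sigma> \<or> (norm (b' - c'))\<^sup>2 = \<sigma>"
    using energy_triangle_reach_side by metis
  have ob': "\<bar>ori a c' b'\<bar> = sqrt 3 / 2 * \<sigma>"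
    using b'(1) c'(1) o ori_permute(2)[of a b c'] by simp
  have "energy K (triangle_inside a c' b') \<le> energy K (tri n y 0 (sqrt 3))"
    using b'(3)
  proof
    assume s: "(norm (b' - a))\<^sup>2 = \<sigma>"
    have "energy K (triangle_inside a b' c') \<le> energy K (tri n y 0 (sqrt 3))"
      by (rule energy_triangle_le_equal_side) (use s side y ob' ori_permute(2)[of a b' c'] in auto)
    then show ?thesis by (simp add: triangle_inside_permute(2)[of a b' c'])
  next
    assume s: "(norm (b' - c'))\<^sup>2 = \<sigma>"
    have "ori c' b' a = ori a c' b'" by (simp add: ori_def algebra_simps)
    then have "energy K (triangle_inside c' b' a) \<le> energy K (tri n y 0 (sqrt 3))"
      by (intro energy_triangle_le_equal_side) (use s side y ob' in auto)
    moreover have "triangle_inside c' b' a = triangle_inside a c' b'"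
      by (metis triangle_inside_permute)
    ultimately show ?thesis by simp
  qed
  moreover have "triangle_inside a c' b = triangle_inside a b c'" by (rule triangle_inside_permute)
  ultimately show ?thesis using c'(2) b'(2) by simp
qed

text \<open>Here \<open>\<sigma>\<close> is the squared side of the equilateral triangle of equal area. The induction is on \<open>k\<close> with
  some squared side at most \<open>2 ^ k * \<sigma>\<close>. If the squared base \<open>p\<close> exceeds \<open>\<sigma>\<close>, symmetrization along it gives a
  squared leg \<open>q\<close> with \<open>4 p (q - \<sigma>) = (p - \<sigma>) (p - 3 \<sigma>)\<close>: either \<open>q \<le> \<sigma>\<close>, or \<open>p > 3 \<sigma>\<close>
  and then \<open>q \<le> p / 2\<close>.\<close>

lemma energy_triangle_le_equilateral:
  assumes o: "\<bar>ori a b c\<bar> = sqrt 3 / 2 * \<sigma>" and y: "4 * (norm y)\<^sup>2 = \<sigma>" "y \<noteq> 0"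
  shows "energy K (triangle_inside a b c) \<le> energy K (tri n y 0 (sqrt 3))"
proof -
  have \<sigma>: "0 < \<sigma>" using y by (auto simp flip: y(1))
  have main: "energy K (triangle_inside a b c) \<le> energy K (tri n y 0 (sqrt 3))"
    if "\<bar>ori a b c\<bar> = sqrt 3 / 2 * \<sigma>" "(norm (b - a))\<^sup>2 \<le> 2 ^ k * \<sigma>" for k a b c
    using that
  proof (induction k arbitrary: a b c)
    case 0
    then show ?case using energy_triangle_le_short_side[OF _ y] by simp
  next
    case (Suc k)
    have o0: "ori a b c \<noteq> 0" using Suc.prems(1) \<sigma> by auto
    have ab: "a \<noteq> b" using o0 by (auto simp: ori_def)
    define p where "p = (norm (b - a))\<^sup>2"
    have p: "0 < p" using ab by (simp add: p_def)
    obtain c' where c': "ori a b c' = ori a b c"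
      "energy K (triangle_inside a b c) \<le> energy K (triangle_inside a b c')"
      "(norm (c' - a))\<^sup>2 = (norm (b - a))\<^sup>2 / 4 + (ori a b c)\<^sup>2 / (norm (b - a))\<^sup>2"
      using energy_triangle_isosceles[OF o0] by metis
    have o2: "(ori a b c)\<^sup>2 = 3 / 4 * \<sigma>\<^sup>2"
      by (subst power2_abs[symmetric]) (simp add: Suc.prems(1) power_mult_distrib power_divide)
    define q where "q = (norm (c' - a))\<^sup>2"
    have q: "4 * (p * q) = p\<^sup>2 + 3 * \<sigma>\<^sup>2"
      unfolding q_def c'(3) p_def[symmetric] o2 using p by (simp add: field_simps power2_eq_square)
    have oc: "\<bar>ori a c' b\<bar> = sqrt 3 / 2 * \<sigma>" using c'(1) Suc.prems(1) ori_permute(2)[of a b c'] by simp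
    have "energy K (triangle_inside a c' b) \<le> energy K (tri n y 0 (sqrt 3))" if "\<not> p \<le> \<sigma>"
    proof (cases "q \<le> \<sigma>")
      case True
      then show ?thesis using energy_triangle_le_short_side[OF oc y] by (simp add: q_def)
    next
      case False
      have "2 * q \<le> p"
      proof -
        have "p * (4 * \<sigma>) < p * (4 * q)" using False p by simp
        then have "0 < (p - \<sigma>) * (p - 3 * \<sigma>)" using q by (simp add: power2_eq_square algebra_simps)
        then have "3 * \<sigma> < p" using that by (auto simp: zero_less_mult_iff)
        then have "3 * \<sigma> * \<sigma> \<le> p * \<sigma>" using \<sigma> by (intro mult_right_mono) auto
        also have "p * \<sigma> \<le> p * p" using that p by (intro mult_left_mono) auto
        finally have "p * (4 * q) \<le> p * (2 * p)" using q by (simp add: power2_eq_square)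
        then show ?thesis using p by simp
      qed
      then have "(norm (c' - a))\<^sup>2 \<le> 2 ^ k * \<sigma>" using Suc.prems(2) by (simp add: p_def q_def)
      then show ?thesis by (rule Suc.IH[OF oc])
    qed
    then show ?case
      using energy_triangle_le_short_side[OF Suc.prems(1) y] c'(2) triangle_inside_permute(2)[of a b c']
      by (cases "p \<le> \<sigma>") (auto simp: p_def)
  qed
  obtain k where "(norm (b - a))\<^sup>2 / \<sigma> < 2 ^ k" using real_arch_pow[of 2 "(norm (b - a))\<^sup>2 / \<sigma>"] by auto
  then have "(norm (b - a))\<^sup>2 \<le> 2 ^ k * \<sigma>" using \<sigma> by (simp add: divide_less_eq)
  then show ?thesis by (rule main[OF o])
qed

lemma energy_triangle_less_equilateral:
  assumes o: "\<bar>ori a b c\<bar> = sqrt 3 / 2 * \<sigma>" and y: "4 * (norm y)\<^sup>2 = \<sigma>" "y \<noteq> 0"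
    and ne: "norm (c - a) \<noteq> norm (c - b)"
  shows "energy K (triangle_inside a b c) < energy K (tri n y 0 (sqrt 3))"
proof -
  have "0 < \<sigma>" using y by (auto simp flip: y(1))
  then have o0: "ori a b c \<noteq> 0" using o by auto
  obtain c' where c': "ori a b c' = ori a b c"
    "norm (c - a) \<noteq> norm (c - b) \<Longrightarrow> energy K (triangle_inside a b c) < energy K (triangle_inside a b c')"
    using energy_triangle_isosceles[OF o0] by metis
  from c'(2)[OF ne] show ?thesis
    using energy_triangle_le_equilateral[of a b c', OF _ y] c'(1) o by (simp add: less_le_trans)
qed

text \<open>If \<open>\<beta> \<noteq> 0\<close>, the two sides at the apex differ. If \<open>\<beta> = 0\<close> and \<open>\<eta> \<noteq> sqrt 3\<close>, the base differs from the
  legs, and a leg serves as the base of the symmetrization.\<close>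

lemma energy_tri_less_equilateral:
  assumes x: "x \<noteq> 0" and \<eta>: "0 < \<eta>" and area: "(norm x)\<^sup>2 * \<eta> = (norm y)\<^sup>2 * sqrt 3"
    and ne: "\<not> (\<beta> = 0 \<and> \<eta> = sqrt 3)"
  shows "energy K (tri m x \<beta> \<eta>) < energy K (tri n y 0 (sqrt 3))"
proof -
  define a b c where "a = frame m x (-1) 0" and "b = frame m x 1 0" and "c = frame m x \<beta> \<eta>"
  have T: "tri m x \<beta> \<eta> = triangle_inside a b c"
    unfolding triangle_inside_def by (rule inside_tri[OF x \<eta> a_def b_def c_def, symmetric])
  have "0 < (norm x)\<^sup>2 * \<eta>" using x \<eta> by simp
  then have y: "y \<noteq> 0" unfolding area by auto
  have o: "\<bar>ori a b c\<bar> = sqrt 3 / 2 * (4 * (norm y)\<^sup>2)"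
    using area \<eta> unfolding a_def b_def c_def ori_frame by (simp add: abs_mult mult.commute)
  have N: "0 < (norm x)\<^sup>2" using x by simp
  show ?thesis
  proof (cases "\<beta> = 0")
    case False
    have "(norm (c - a))\<^sup>2 - (norm (c - b))\<^sup>2 = 4 * \<beta> * (norm x)\<^sup>2"
      unfolding a_def b_def c_def frame_diff_sq by (simp add: power2_eq_square algebra_simps)
    then have "norm (c - a) \<noteq> norm (c - b)" using False N by auto
    then show ?thesis unfolding T by (rule energy_triangle_less_equilateral[OF o refl y])
  next
    case True
    then have "\<eta> \<noteq> sqrt 3" using ne by simp
    then have "\<eta>\<^sup>2 \<noteq> 3" using \<eta> by (metis less_imp_le real_sqrt_unique)
    moreover have "(norm (b - a))\<^sup>2 - (norm (b - c))\<^sup>2 = (3 - \<eta>\<^sup>2) * (norm x)\<^sup>2"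
      unfolding a_def b_def c_def frame_diff_sq True by (simp add: power2_eq_square algebra_simps)
    ultimately have "norm (b - a) \<noteq> norm (b - c)" using N by auto
    then have "energy K (triangle_inside a c b) < energy K (tri n y 0 (sqrt 3))"
      using o by (intro energy_triangle_less_equilateral[OF _ refl y]) (simp_all add: ori_permute(2)[of a c b])
    then show ?thesis unfolding T triangle_inside_permute(2)[of a c b] .
  qed
qed

end

section \<open>Regular shapes, rigid motions and maximizers\<close>

lemma simple_path_triangle:
  assumes "ori a b c \<noteq> 0"
  shows "simple_path (closed_polygonal_line [a, b, c])"
proof -
  have ne: "a \<noteq> b" "b \<noteq> c" "c \<noteq> a" using assms by (auto simp: ori_def)
  have nc: "\<not> collinear {a, b, c}" "\<not> collinear {b, c, a}" "\<not> collinear {c, a, b}"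
    using assms unfolding collinear_ori by (simp_all add: ori_def algebra_simps)
  have i: "closed_segment a b \<inter> closed_segment b c = {b}" "closed_segment b c \<inter> closed_segment c a = {c}"
    "closed_segment c a \<inter> closed_segment a b = {a}"
    using Int_closed_segment[of b a c] Int_closed_segment[of c b a] Int_closed_segment[of a c b] nc by simp_all
  have "arc (linepath b c +++ linepath c a)"
    by (rule arc_join) (use ne i in auto)
  then have "simple_path (linepath a b +++ (linepath b c +++ linepath c a))"
    by (intro simple_path_join_loop) (use ne i in \<open>auto simp: path_image_join\<close>)
  then show ?thesis by (simp add: closed_polygonal_line_def)
qed

lemma simple_path_square:
  assumes x: "x \<noteq> 0"
  shows "simple_path (closed_polygonal_line [frame m x (-1) 0, frame m x 0 1, frame m x 1 0, frame m x 0 (-1)])"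
proof -
  define a b c d where "a = frame m x (-1) 0" and "b = frame m x 0 1" and "c = frame m x 1 0" and "d = frame m x 0 (-1)"
  note defs = a_def b_def c_def d_def
  have ne: "a \<noteq> b" "b \<noteq> c" "c \<noteq> d" "d \<noteq> a" unfolding defs frame_eq_iff[OF x] by auto
  have z: "z = frame m x (along m x z) (across m x z)" for z using frame_along_across[OF x] by simp
  have ab: "z \<in> closed_segment a b \<longleftrightarrow> (\<exists>u. 0 \<le> u \<and> u \<le> 1 \<and> along m x z = u - 1 \<and> across m x z = u)" for z
    unfolding defs by (subst z, subst frame_in_segment[OF x]) auto
  have bc: "z \<in> closed_segment b c \<longleftrightarrow> (\<exists>u. 0 \<le> u \<and> u \<le> 1 \<and> along m x z = u \<and> across m x z = 1 - u)" for z
    unfolding defs by (subst z, subst frame_in_segment[OF x]) auto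
  have cd: "z \<in> closed_segment c d \<longleftrightarrow> (\<exists>u. 0 \<le> u \<and> u \<le> 1 \<and> along m x z = 1 - u \<and> across m x z = - u)" for z
    unfolding defs by (subst z, subst frame_in_segment[OF x]) auto
  have da: "z \<in> closed_segment d a \<longleftrightarrow> (\<exists>u. 0 \<le> u \<and> u \<le> 1 \<and> along m x z = - u \<and> across m x z = u - 1)" for z
    unfolding defs by (subst z, subst frame_in_segment[OF x]) auto
  have v: "along m x a = -1" "across m x a = 0" "along m x b = 0" "across m x b = 1"
    "along m x c = 1" "across m x c = 0" "along m x d = 0" "across m x d = -1"
    unfolding defs using x by auto
  have eqI: "z = w" if "along m x z = along m x w" "across m x z = across m x w" for z w
    using that z by metis
  have i1: "closed_segment c d \<inter> closed_segment d a \<subseteq> {d}"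
    using eqI v by (auto simp: cd da)
  have i2: "closed_segment b c \<inter> (closed_segment c d \<union> closed_segment d a) \<subseteq> {c}"
    using eqI v by (auto simp: bc cd da)
  have i3: "closed_segment a b \<inter> (closed_segment b c \<union> (closed_segment c d \<union> closed_segment d a)) \<subseteq> {a, b}"
    using eqI v by (auto simp: ab bc cd da)
  have "arc (linepath c d +++ linepath d a)"
    by (rule arc_join) (use ne i1 in auto)
  then have "arc (linepath b c +++ (linepath c d +++ linepath d a))"
    by (intro arc_join) (use ne i1 i2 in \<open>simp_all add: path_image_join\<close>)
  then have "simple_path (linepath a b +++ (linepath b c +++ (linepath c d +++ linepath d a)))"
    by (intro simple_path_join_loop) (use ne i3 in \<open>simp_all add: path_image_join\<close>)
  then show ?thesis by (simp add: closed_polygonal_line_def defs)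
qed

lemma polygon_region_triangle: "polygon_region [a, b, c] = triangle_inside a b c"
  by (simp add: polygon_region_def path_image_triangle triangle_inside_def)

lemma triangle_cases:
  assumes "ori a b c \<noteq> 0"
  obtains m x \<beta> \<eta> a' b' where "x \<noteq> 0" "0 < \<eta>" "(a', b') \<in> {(a, b), (b, a)}"
    "a' = frame m x (-1) 0" "b' = frame m x 1 0" "c = frame m x \<beta> \<eta>"
    "triangle_inside a b c = tri m x \<beta> \<eta>"
proof -
  obtain m x \<beta> \<eta> where x: "x \<noteq> 0" "\<eta> \<noteq> 0" and abc: "a = frame m x (-1) 0" "b = frame m x 1 0" "c = frame m x \<beta> \<eta>"
    using triangle_frame[OF assms] by metis
  show ?thesis
  proof (cases "0 < \<eta>")
    case True
    show ?thesis
      by (rule that[of x \<eta> a b m \<beta>]) (use x True abc inside_tri[OF x(1) True] in \<open>simp_all add: triangle_inside_def\<close>)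
  next
    case False
    then have n: "- x \<noteq> 0" "0 < - \<eta>" using x by auto
    have "triangle_inside a b c = triangle_inside b a c" by (simp add: triangle_inside_permute)
    also have "\<dots> = tri m (- x) (- \<beta>) (- \<eta>)"
      unfolding triangle_inside_def by (rule inside_tri[OF n]) (simp_all add: frame_minus abc)
    finally show ?thesis
      by (intro that[of "- x" "- \<eta>" b a m "- \<beta>"]) (use n abc in \<open>simp_all add: frame_minus\<close>)
  qed
qed

lemma polygons_3_cases:
  assumes "P \<in> polygons 3"
  obtains m x \<beta> \<eta> where "x \<noteq> 0" "0 < \<eta>" "P = tri m x \<beta> \<eta>"
proof -
  obtain vs where vs: "P = polygon_region vs" "polygon_vertices vs" "length vs = 3"
    using assms by (auto simp: polygons_def)
  then obtain a b c where abc: "vs = [a, b, c]"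
    by (auto simp: numeral_3_eq_3 length_Suc_conv)
  then have "ori a b c \<noteq> 0" using vs(2) by (simp add: polygon_vertices_triangle)
  then show ?thesis using that triangle_cases vs(1) abc polygon_region_triangle by metis
qed

lemma polygons_4_cases:
  assumes "P \<in> polygons 4"
  obtains m x \<beta> \<delta> \<eta> \<zeta> where "x \<noteq> 0" "0 < \<eta>" "0 < \<zeta>" "P = quad m x \<beta> \<delta> \<eta> \<zeta>"
proof -
  obtain vs where vs: "P = polygon_region vs" "polygon_vertices vs" "length vs = 4"
    using assms by (auto simp: polygons_def)
  then obtain a b c d where abc: "vs = [a, b, c, d]"
    by (auto simp: eval_nat_numeral length_Suc_conv)
  show ?thesis
    by (rule polygon_quadrilateral_cases[OF vs(2)[unfolded abc]]) (use that vs(1) abc in auto)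
qed

lemma equilateral_triangle_iff:
  "equilateral_triangle T \<longleftrightarrow> (\<exists>m x. x \<noteq> 0 \<and> T = tri m x 0 (sqrt 3))"
proof
  assume "equilateral_triangle T"
  then obtain a b c where pv: "polygon_vertices [a, b, c]" and T: "T = polygon_region [a, b, c]"
    and eq: "dist a b = dist b c" "dist b c = dist c a" by (auto simp: equilateral_triangle_def)
  have "ori a b c \<noteq> 0" using pv by (simp add: polygon_vertices_triangle)
  then obtain m x \<beta> \<eta> a' b' where x: "x \<noteq> 0" "0 < \<eta>" and ab: "(a', b') \<in> {(a, b), (b, a)}"
    and abc: "a' = frame m x (-1) 0" "b' = frame m x 1 0" "c = frame m x \<beta> \<eta>"
    and tri: "triangle_inside a b c = tri m x \<beta> \<eta>" using triangle_cases by metis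
  have "dist a' b' = dist b' c" "dist b' c = dist c a'" using ab eq by (auto simp: dist_commute)
  then have "(dist a' b')\<^sup>2 = (dist b' c)\<^sup>2" "(dist b' c)\<^sup>2 = (dist c a')\<^sup>2" by simp_all
  then have e: "(2::real)\<^sup>2 = (1 - \<beta>)\<^sup>2 + \<eta>\<^sup>2" "(1 - \<beta>)\<^sup>2 = (\<beta> + 1)\<^sup>2"
    unfolding dist_norm abc frame_diff_sq using x by auto
  then have "\<beta> = 0" by (simp add: power2_eq_square algebra_simps)
  moreover have "\<eta> = sqrt 3" using e(1) x(2) \<open>\<beta> = 0\<close> by (intro real_sqrt_unique[symmetric]) auto
  ultimately show "\<exists>m x. x \<noteq> 0 \<and> T = tri m x 0 (sqrt 3)"
    using x tri T polygon_region_triangle by metis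
next
  assume "\<exists>m x. x \<noteq> 0 \<and> T = tri m x 0 (sqrt 3)"
  then obtain m x where x: "x \<noteq> 0" and T: "T = tri m x 0 (sqrt 3)" by blast
  define a b c where "a = frame m x (-1) 0" and "b = frame m x 1 0" and "c = frame m x 0 (sqrt 3)"
  have "ori a b c \<noteq> 0" unfolding a_def b_def c_def ori_frame using x by simp
  then have "polygon_vertices [a, b, c]" using simple_path_triangle by (simp add: polygon_vertices_triangle)
  moreover have "T = polygon_region [a, b, c]"
    unfolding polygon_region_triangle triangle_inside_def T
    by (rule inside_tri[OF x _ a_def b_def c_def, symmetric]) simp
  moreover have "dist a b = dist b c" "dist b c = dist c a"
    unfolding dist_norm a_def b_def c_def frame_diff by simp_all
  ultimately show "equilateral_triangle T" unfolding equilateral_triangle_def by blast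
qed

lemma square_iff:
  "square Q \<longleftrightarrow> (\<exists>m x. x \<noteq> 0 \<and> Q = quad m x 0 0 1 1)"
proof
  assume "square Q"
  then obtain a b c d where pv: "polygon_vertices [a, b, c, d]" and Q: "Q = polygon_region [a, b, c, d]"
    and eq: "dist a b = dist b c" "dist b c = dist c d" "dist c d = dist d a"
    and orth: "orthogonal (b - a) (c - b)" "orthogonal (c - b) (d - c)"
       "orthogonal (d - c) (a - d)" "orthogonal (a - d) (b - a)"
    unfolding square_def by blast
  obtain m x \<beta> \<delta> \<eta> \<zeta> a' b' c' d' where x: "x \<noteq> 0" "0 < \<eta>" "0 < \<zeta>"
    and mem: "(a', b', c', d') \<in> {(a, b, c, d), (c, b, a, d), (b, c, d, a), (d, c, b, a)}"
    and fr: "a' = frame m x (-1) 0" "b' = frame m x \<beta> \<eta>" "c' = frame m x 1 0" "d' = frame m x \<delta> (-\<zeta>)"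
    and quad: "polygon_region [a, b, c, d] = quad m x \<beta> \<delta> \<eta> \<zeta>"
    using polygon_quadrilateral_cases[OF pv] by metis
  have "dist a' b' = dist b' c'" "dist b' c' = dist c' d'" "dist c' d' = dist d' a'"
    using mem eq by (auto simp: dist_commute)
  then have "(dist a' b')\<^sup>2 = (dist b' c')\<^sup>2" "(dist b' c')\<^sup>2 = (dist c' d')\<^sup>2" "(dist c' d')\<^sup>2 = (dist d' a')\<^sup>2" by simp_all
  then have e: "(-1 - \<beta>)\<^sup>2 + \<eta>\<^sup>2 = (\<beta> - 1)\<^sup>2 + \<eta>\<^sup>2" "(\<beta> - 1)\<^sup>2 + \<eta>\<^sup>2 = (1 - \<delta>)\<^sup>2 + \<zeta>\<^sup>2" "(1 - \<delta>)\<^sup>2 + \<zeta>\<^sup>2 = (\<delta> + 1)\<^sup>2 + \<zeta>\<^sup>2"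
    unfolding dist_norm fr frame_diff_sq using x by simp_all
  have bd: "\<beta> = 0" "\<delta> = 0" using e(1,3) by (simp_all add: power2_eq_square algebra_simps)
  then have "\<eta>\<^sup>2 = \<zeta>\<^sup>2" using e(2) by simp
  then have \<zeta>: "\<zeta> = \<eta>" using x by (simp add: power2_eq_iff_nonneg)
  have "(b' - a') \<bullet> (c' - b') = 0"
    using mem orth by (auto simp: orthogonal_def inner_commute inner_diff_left inner_diff_right)
  moreover have "(b' - a') \<bullet> (c' - b') = (1 - \<eta>\<^sup>2) * (norm x)\<^sup>2"
    unfolding fr bd inner_plane norm_plane by (simp add: frame_def power2_eq_square algebra_simps)
  ultimately have "\<eta>\<^sup>2 = 1" using x by simp
  then have "\<eta> = 1" using x by (simp add: power2_eq_1_iff)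
  then show "\<exists>m x. x \<noteq> 0 \<and> Q = quad m x 0 0 1 1" using x quad Q bd \<zeta> by auto
next
  assume "\<exists>m x. x \<noteq> 0 \<and> Q = quad m x 0 0 1 1"
  then obtain m x where x: "x \<noteq> 0" and Q: "Q = quad m x 0 0 1 1" by blast
  define a b c d where "a = frame m x (-1) 0" and "b = frame m x 0 1" and "c = frame m x 1 0" and "d = frame m x 0 (-1)"
  note defs = a_def b_def c_def d_def
  have "ori a b c = - 2 * (norm x)\<^sup>2" "ori b c d = - 2 * (norm x)\<^sup>2" "ori c d a = - 2 * (norm x)\<^sup>2" "ori d a b = - 2 * (norm x)\<^sup>2"
    unfolding defs norm_plane ori_def by (simp_all add: frame_def power2_eq_square algebra_simps)
  then have "polygon_vertices [a, b, c, d]"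
    using simple_path_square[OF x, of m] x by (simp add: polygon_vertices_quadrilateral defs)
  moreover have "Q = polygon_region [a, b, c, d]"
    unfolding polygon_region_def path_image_quadrilateral Q
    by (rule inside_quad[OF x _ _ a_def b_def c_def, symmetric]) (simp_all add: d_def)
  moreover have "dist a b = dist b c" "dist b c = dist c d" "dist c d = dist d a"
    unfolding dist_norm defs frame_diff by simp_all
  moreover have "orthogonal (b - a) (c - b)" "orthogonal (c - b) (d - c)" "orthogonal (d - c) (a - d)" "orthogonal (a - d) (b - a)"
    unfolding orthogonal_def inner_plane defs by (simp_all add: frame_def algebra_simps)
  ultimately show "square Q" unfolding square_def by blast
qed

text \<open>The factor \<open>k\<close> is the determinant of the orthogonal part. A reflection shows up as a
  reversal of \<open>s\<close>, which is invisible on shapes symmetric in \<open>s\<close>.\<close>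

lemma rigid_motion_frame:
  assumes "rigid_motion f" and x: "x \<noteq> 0"
  obtains n y k where "norm y = norm x" "\<bar>k\<bar> = (1::real)" "\<And>s t. f (frame m x s t) = frame n y (k * s) t"
proof -
  obtain g w where g: "orthogonal_transformation g" and f: "f = (\<lambda>z. w + g z)"
    using assms(1) by (auto simp: rigid_motion_def)
  have lin: "linear g" using g by (rule orthogonal_transformation_linear)
  have ng: "norm (g v) = norm v" for v using g by (simp add: orthogonal_transformation)
  have gx: "g x \<noteq> 0" using ng[of x] x by auto
  define p q where "p = along 0 (g x) (g (rot x))" and "q = across 0 (g x) (g (rot x))"
  have gr: "g (rot x) = p *\<^sub>R g x + q *\<^sub>R rot (g x)"
    using frame_along_across[OF gx, of 0 "g (rot x)"] by (simp add: frame_def p_def q_def)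
  have "g (rot x) \<bullet> g x = rot x \<bullet> x" using g by (simp add: orthogonal_transformation_def)
  then have p: "p = 0" by (simp add: p_def along_def)
  have "norm (g (rot x)) = \<bar>q\<bar> * norm (g x)" unfolding gr p by simp
  then have q: "\<bar>q\<bar> = 1" using x by (simp add: ng)
  then have qq: "q * q = 1" by (metis abs_mult_self_eq mult_1)
  have "f (frame m x s t) = frame (f m) (q *\<^sub>R g x) (q * s) t" for s t
    using qq by (simp add: f frame_def linear_add[OF lin] linear_scale[OF lin] gr p rot_scaleR mult.assoc[symmetric] mult.commute[of q s])
  moreover have "norm (q *\<^sub>R g x) = norm x" using q by (simp add: ng)
  ultimately show ?thesis using that q by blast
qed

lemma rigid_motion_of_frames:
  assumes x: "x \<noteq> 0" and "norm x = norm y"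
  obtains f where "rigid_motion f" "\<And>s t. f (frame m x s t) = frame n y s t"
proof -
  define g where "g z = along 0 x z *\<^sub>R y + across 0 x z *\<^sub>R rot y" for z
  have "linear g"
    by (rule linearI) (simp_all add: g_def along_def across_def inner_add_left add_divide_distrib algebra_simps)
  moreover have "norm (g z) = norm z" for z
  proof -
    have "norm (frame 0 y (along 0 x z) (across 0 x z) - frame 0 y 0 0)
        = norm (frame 0 x (along 0 x z) (across 0 x z) - frame 0 x 0 0)"
      unfolding frame_diff assms(2) ..
    then show ?thesis unfolding frame_along_across[OF x] by (simp add: frame_def g_def)
  qed
  ultimately have g: "orthogonal_transformation g" by (simp add: orthogonal_transformation)
  have gx: "g (s *\<^sub>R x + t *\<^sub>R rot x) = s *\<^sub>R y + t *\<^sub>R rot y" for s t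
  proof -
    have "s *\<^sub>R x + t *\<^sub>R rot x = frame 0 x s t" by (simp add: frame_def)
    then show ?thesis unfolding g_def using x by simp
  qed
  show ?thesis
  proof (rule that[of "\<lambda>z. (n - g m) + g z"])
    show "rigid_motion (\<lambda>z. (n - g m) + g z)" unfolding rigid_motion_def using g by blast
    show "(n - g m) + g (frame m x s t) = frame n y s t" for s t
      unfolding frame_def add.assoc linear_add[OF \<open>linear g\<close>, of m] gx by simp
  qed
qed

lemma rigid_motion_symmetric_slices:
  assumes x: "x \<noteq> 0"
  shows "(\<exists>f. rigid_motion f \<and> P = f ` sliced m x (\<lambda>t. 0) l) \<longleftrightarrow>
    (\<exists>n y. norm y = norm x \<and> P = sliced n y (\<lambda>t. 0) l)"
proof safe
  fix f assume f: "rigid_motion f" 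
  obtain n y k where *: "norm y = norm x" "\<bar>k\<bar> = 1" "\<And>s t. f (frame m x s t) = frame n y (k * s) t"
    using rigid_motion_frame[OF f x, of m] by metis
  have y: "y \<noteq> 0" using * x by auto
  have kk: "k * (k * s) = s" for s using *(2) by (metis abs_mult_self_eq mult.assoc mult_1)
  have "f ` sliced m x (\<lambda>t. 0) l = sliced n y (\<lambda>t. 0) l"
  proof (intro equalityI subsetI)
    fix z assume "z \<in> f ` sliced m x (\<lambda>t. 0) l"
    then obtain s t where "\<bar>s\<bar> < l t" "z = f (frame m x s t)"
      unfolding image_iff Bex_def mem_sliced_frame[OF x] by auto
    then show "z \<in> sliced n y (\<lambda>t. 0) l" using *(2,3) y by (simp add: abs_mult)
  next
    fix z assume "z \<in> sliced n y (\<lambda>t. 0) l"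
    then obtain s t where st: "\<bar>s\<bar> < l t" "z = frame n y s t" unfolding mem_sliced_frame[OF y] by auto
    then have "z = f (frame m x (k * s) t)" by (simp add: *(3) kk)
    moreover have "frame m x (k * s) t \<in> sliced m x (\<lambda>t. 0) l" using st *(2) x by (simp add: abs_mult)
    ultimately show "z \<in> f ` sliced m x (\<lambda>t. 0) l" by blast
  qed
  then show "\<exists>n y. norm y = norm x \<and> f ` sliced m x (\<lambda>t. 0) l = sliced n y (\<lambda>t. 0) l" using *(1) by blast
next
  fix n y :: "real^2" assume n: "norm y = norm x"
  then have y: "y \<noteq> 0" using x by auto
  obtain f where f: "rigid_motion f" "\<And>s t. f (frame m x s t) = frame n y s t"
    using rigid_motion_of_frames[OF x n[symmetric]] by metis
  have "sliced n y (\<lambda>t. 0) l = f ` sliced m x (\<lambda>t. 0) l"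
  proof (intro equalityI subsetI)
    fix z assume "z \<in> sliced n y (\<lambda>t. 0) l"
    then obtain s t where st: "\<bar>s\<bar> < l t" "z = frame n y s t" unfolding mem_sliced_frame[OF y] by auto
    then have "z = f (frame m x s t)" "frame m x s t \<in> sliced m x (\<lambda>t. 0) l" using x by (simp_all add: f(2))
    then show "z \<in> f ` sliced m x (\<lambda>t. 0) l" by blast
  next
    fix z assume "z \<in> f ` sliced m x (\<lambda>t. 0) l"
    then obtain s t where "\<bar>s\<bar> < l t" "z = f (frame m x s t)"
      unfolding image_iff Bex_def mem_sliced_frame[OF x] by auto
    then show "z \<in> sliced n y (\<lambda>t. 0) l" using f(2) y by simp
  qed
  then show "\<exists>f. rigid_motion f \<and> sliced n y (\<lambda>t. 0) l = f ` sliced m x (\<lambda>t. 0) l" using f(1) by blast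
qed

lemma rigid_motion_equilateral:
  assumes "x \<noteq> 0"
  shows "(\<exists>f. rigid_motion f \<and> P = f ` tri m x 0 (sqrt 3)) \<longleftrightarrow> (\<exists>n y. norm y = norm x \<and> P = tri n y 0 (sqrt 3))"
  unfolding tri_def using rigid_motion_symmetric_slices[OF assms] by simp

lemma rigid_motion_square:
  assumes "x \<noteq> 0"
  shows "(\<exists>f. rigid_motion f \<and> P = f ` quad m x 0 0 1 1) \<longleftrightarrow> (\<exists>n y. norm y = norm x \<and> P = quad n y 0 0 1 1)"
proof -
  have "quad_centre 0 0 1 1 = (\<lambda>t. 0)" by (auto simp: quad_centre_def)
  then show ?thesis unfolding quad_def using rigid_motion_symmetric_slices[OF assms] by simp
qed

text \<open>In both applications \<open>C\<close> describes the competitors and \<open>M\<close> the congruence class of the regular shape.\<close>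

lemma arg_max_iff_model:
  assumes less: "\<And>P. C P \<Longrightarrow> \<not> M P \<Longrightarrow> E P < (e :: ennreal)" and eq: "\<And>P. M P \<Longrightarrow> E P = e"
    and sub: "\<And>P. M P \<Longrightarrow> C P" and ex: "M T"
  shows "is_arg_max E C P \<longleftrightarrow> M P"
proof
  assume "is_arg_max E C P"
  then have "C P" "\<not> E P < E T" using sub[OF ex] by (auto simp: is_arg_max_def)
  then show "M P" using less eq[OF ex] by auto
next
  assume "M P"
  then show "is_arg_max E C P" unfolding is_arg_max_def
    using less eq sub by (metis less_asym less_irrefl)
qed

lemma equilateral_triangle_polygon: "equilateral_triangle T \<Longrightarrow> T \<in> polygons 3"
  unfolding equilateral_triangle_def polygons_def mem_Collect_eq
  by (metis One_nat_def Suc_eq_plus1 list.size(3) list.size(4) numeral_3_eq_3)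

lemma square_polygon: "square Q \<Longrightarrow> Q \<in> polygons 4"
  unfolding square_def polygons_def by force

lemma vector_of_norm:
  assumes "0 \<le> r" obtains x :: "real^2" where "(norm x)\<^sup>2 = r"
  using assms by (intro that[of "sqrt r *\<^sub>R axis 1 1"]) (simp add: power_mult_distrib)

context decreasing_kernel
begin

lemma arg_max_energy_triangle:
  assumes T: "equilateral_triangle T" "measure lebesgue T = m"
  shows "is_arg_max (energy K) (\<lambda>P. P \<in> polygons 3 \<and> measure lebesgue P = m) P \<longleftrightarrow>
    (\<exists>f. rigid_motion f \<and> P = f ` T)"
proof -
  obtain n x where x: "x \<noteq> 0" and T': "T = tri n x 0 (sqrt 3)" using T(1) equilateral_triangle_iff by auto
  have m: "m = (norm x)\<^sup>2 * sqrt 3" using T(2) measure_tri[OF x] by (simp add: T')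
  define M where "M P = (\<exists>n y. norm y = norm x \<and> P = tri n y 0 (sqrt 3))" for P
  have ny: "y \<noteq> 0" if "norm y = norm x" for y using that x by auto
  have "is_arg_max (energy K) (\<lambda>P. P \<in> polygons 3 \<and> measure lebesgue P = m) P \<longleftrightarrow> M P"
  proof (rule arg_max_iff_model[where e="energy K T"])
    show "M T" unfolding M_def T' by blast
    show "energy K P = energy K T" if "M P" for P
      using that ny unfolding M_def T' by (metis energy_tri_norm_cong)
    show "P \<in> polygons 3 \<and> measure lebesgue P = m" if "M P" for P
    proof -
      obtain n y where y: "norm y = norm x" "P = tri n y 0 (sqrt 3)" using \<open>M P\<close> by (auto simp: M_def)
      then have "equilateral_triangle P" unfolding equilateral_triangle_iff using ny by blast
      then show ?thesis using equilateral_triangle_polygon measure_tri[OF ny[OF y(1)]] y m by simp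
    qed
    show "energy K P < energy K T" if "P \<in> polygons 3 \<and> measure lebesgue P = m" "\<not> M P" for P
    proof -
      obtain n' y \<beta> \<eta> where y: "y \<noteq> 0" "0 < \<eta>" "P = tri n' y \<beta> \<eta>" using polygons_3_cases \<open>P \<in> _ \<and> _\<close> by metis
      then have area: "(norm y)\<^sup>2 * \<eta> = (norm x)\<^sup>2 * sqrt 3" using that(1) m measure_tri[OF y(1,2)] by simp
      have "\<not> (\<beta> = 0 \<and> \<eta> = sqrt 3)"
      proof
        assume a: "\<beta> = 0 \<and> \<eta> = sqrt 3"
        then have "(norm y)\<^sup>2 = (norm x)\<^sup>2" using area by simp
        then have "norm y = norm x" by (rule power2_eq_imp_eq) auto
        then show False using \<open>\<not> M P\<close> y(3) a unfolding M_def by blast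
      qed
      then show ?thesis unfolding y(3) T' by (rule energy_tri_less_equilateral[OF y(1,2) area])
    qed
  qed
  then show ?thesis unfolding M_def T' rigid_motion_equilateral[OF x] .
qed

lemma arg_max_energy_quadrilateral:
  assumes Q: "square Q" "measure lebesgue Q = m"
  shows "is_arg_max (energy K) (\<lambda>P. P \<in> polygons 4 \<and> measure lebesgue P = m) P \<longleftrightarrow>
    (\<exists>f. rigid_motion f \<and> P = f ` Q)"
proof -
  obtain n x where x: "x \<noteq> 0" and Q': "Q = quad n x 0 0 1 1" using Q(1) square_iff by auto
  have m: "m = 2 * (norm x)\<^sup>2" using Q(2) measure_quad[OF x] by (simp add: Q')
  define M where "M P = (\<exists>n y. norm y = norm x \<and> P = quad n y 0 0 1 1)" for P
  have ny: "y \<noteq> 0" if "norm y = norm x" for y using that x by auto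
  have "is_arg_max (energy K) (\<lambda>P. P \<in> polygons 4 \<and> measure lebesgue P = m) P \<longleftrightarrow> M P"
  proof (rule arg_max_iff_model[where e="energy K Q"])
    show "M Q" unfolding M_def Q' by blast
    show "energy K P = energy K Q" if "M P" for P
      using that ny unfolding M_def Q' by (metis energy_quad_norm_cong zero_less_one)
    show "P \<in> polygons 4 \<and> measure lebesgue P = m" if "M P" for P
    proof -
      obtain n y where y: "norm y = norm x" "P = quad n y 0 0 1 1" using \<open>M P\<close> by (auto simp: M_def)
      then have "square P" unfolding square_iff using ny by blast
      then show ?thesis using square_polygon measure_quad[OF ny[OF y(1)], of 1 1] y m by simp
    qed
    show "energy K P < energy K Q" if "P \<in> polygons 4 \<and> measure lebesgue P = m" "\<not> M P" for P
    proof -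
      obtain n' y \<beta> \<delta> \<eta> \<zeta> where y: "y \<noteq> 0" "0 < \<eta>" "0 < \<zeta>" "P = quad n' y \<beta> \<delta> \<eta> \<zeta>"
        using polygons_4_cases \<open>P \<in> _ \<and> _\<close> by metis
      then have area: "(norm y)\<^sup>2 * (\<eta> + \<zeta>) = 2 * (norm x)\<^sup>2" using that(1) m measure_quad[OF y(1-3)] by simp
      have "\<not> (\<beta> = 0 \<and> \<delta> = 0 \<and> \<eta> = 1 \<and> \<zeta> = 1)"
      proof
        assume a: "\<beta> = 0 \<and> \<delta> = 0 \<and> \<eta> = 1 \<and> \<zeta> = 1"
        then have "(norm y)\<^sup>2 = (norm x)\<^sup>2" using area by simp
        then have "norm y = norm x" by (rule power2_eq_imp_eq) auto
        then show False using \<open>\<not> M P\<close> y(4) a unfolding M_def by blast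
      qed
      then show ?thesis unfolding y(4) Q' by (rule energy_quad_less_square[OF y(1-3) area])
    qed
  qed
  then show ?thesis unfolding M_def Q' rigid_motion_square[OF x] .
qed

end

lemma exists_equilateral_triangle:
  assumes "0 < (m::real)"
  shows "\<exists>T. equilateral_triangle T \<and> measure lebesgue T = m"
proof -
  obtain x :: "real^2" where x: "(norm x)\<^sup>2 = m / sqrt 3" using vector_of_norm[of "m / sqrt 3"] assms by auto
  then have "x \<noteq> 0" using assms by auto
  then show ?thesis
    by (intro exI[of _ "tri 0 x 0 (sqrt 3)"]) (auto simp: equilateral_triangle_iff measure_tri x)
qed

lemma exists_square:
  assumes "0 < (m::real)"
  shows "\<exists>Q. square Q \<and> measure lebesgue Q = m"
proof -
  obtain x :: "real^2" where x: "(norm x)\<^sup>2 = m / 2" using vector_of_norm[of "m / 2"] assms by auto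
  then have "x \<noteq> 0" using assms by auto
  then show ?thesis
    by (intro exI[of _ "quad 0 x 0 0 1 1"]) (auto simp: square_iff measure_quad x)
qed

theorem theorem1p1:
  fixes K :: "real \<Rightarrow> real" and m :: real
  assumes "K C1_differentiable_on {0<..}"
    and "\<And>r. 0 < r \<Longrightarrow> 0 \<le> K r"
    and "strict_antimono_on {0<..} K"
    and "set_integrable lborel {0<..<1} (\<lambda>r. K r * r)"
    and "0 < m"
  shows "((\<exists>T. equilateral_triangle T \<and> measure lebesgue T = m) \<and>
          (\<forall>T. equilateral_triangle T \<and> measure lebesgue T = m \<longrightarrow>
             (\<forall>P. is_arg_max (energy K) (\<lambda>P. P \<in> polygons 3 \<and> measure lebesgue P = m) P \<longleftrightarrow>
                  (\<exists>f. rigid_motion f \<and> P = f ` T)))) \<and>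
         ((\<exists>Q. square Q \<and> measure lebesgue Q = m) \<and>
          (\<forall>Q. square Q \<and> measure lebesgue Q = m \<longrightarrow>
             (\<forall>P. is_arg_max (energy K) (\<lambda>P. P \<in> polygons 4 \<and> measure lebesgue P = m) P \<longleftrightarrow>
                  (\<exists>f. rigid_motion f \<and> P = f ` Q))))"
proof -
  interpret decreasing_kernel K
  proof
    show "continuous_on {0<..} K" using assms(1) by (rule C1_differentiable_imp_continuous_on)
    show "K r' < K r" if "0 < r" "r < r'" for r r'
      using assms(3) that by (auto simp: monotone_on_def)
  qed (use assms(2,4) in auto)
  show ?thesis
    by (intro conjI allI impI; (elim conjE)?)
      (rule exists_equilateral_triangle[OF assms(5)] exists_square[OF assms(5)]
        arg_max_energy_triangle arg_max_energy_quadrilateral; assumption?)+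
qed

end
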